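(* Let $(M,g)$ be a pseudo-Riemannian manifold which admits a free $\mathbb{R}_{>0}$-action $m$ and let $f: M \rightarrow \mathbb{R}_{>0}$ be a smooth function. Suppose that $(g,f)$ is a homogeneous pair of degree $\alpha\in\mathbb{R}-\{0\}$. Then: (1) $(df)_x\neq 0$ for any $x\in M$. Thus for any $l>0$, $M_l=\{x\in M\mid f(x)=l\}$ is a submanifold of $M$. The pullback $g_l$ of $g$ to $M_l$ is a pseudo-Riemannian metric on $M_l$. (2) For any $l>0$ and any smooth function $v:\mathbb{R}_{>0}\to\mathbb{R}_{>0}$, the map $$\psi:\mathbb{R}_{>0}\times M_l\to M,\qquad (r,y)\mapsto m\left(\left(\frac{r}{l}\right)^{\frac1\alpha},y\right)$$ gives an isometry between $\left(\mathbb{R}_{>0}\times M_l,\ v(r)\left(\frac{1}{\alpha r}dr^2+\frac{r}{l}g_l\right)\right)$ and $(M,(v\circ f)g)$.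
   Context: For a (smooth) free $\mathbb{R}_{>0}$-action $m:\mathbb{R}_{>0}\times M\to M$ write $m_\lambda=m(\lambda,\cdot)$, and let $P\in\mathfrak{X}(M)$ be the vector field generated by the action, $P_x=\frac{d}{dt}m(e^t,x)|_{t=0}$. For a pseudo-Riemannian metric $g$ on $M$, a smooth function $f:M\to\mathbb{R}_{>0}$ and $\alpha\in\mathbb{R}-\{0\}$, the pair $(g,f)$ is called a homogeneous pair of degree $\alpha$ if $m_\lambda^*g=\lambda^\alpha g$, $m_\lambda^*f=\lambda^\alpha f$ for all $\lambda>0$, and $g(P,\cdot)=df$. *)

theory Defs
  imports "HOL-Analysis.Analysis"
begin

primrec Ck_on :: "nat \<Rightarrow> 'e::euclidean_space set \<Rightarrow> ('e \<Rightarrow> 'f::euclidean_space) \<Rightarrow> bool" where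
  "Ck_on 0 U f \<longleftrightarrow> continuous_on U f"
| "Ck_on (Suc k) U f \<longleftrightarrow> (\<forall>x\<in>U. f differentiable (at x)) \<and>
     (\<forall>h. Ck_on k U (\<lambda>x. frechet_derivative f (at x) h))"

text \<open>Smoothness on an arbitrary set means having smooth local extensions to open sets. It is used
  for open sets and for relatively open subsets of linear subspaces, where it agrees with the
  usual notion.\<close>

definition smooth_on :: "'e::euclidean_space set \<Rightarrow> ('e \<Rightarrow> 'f::euclidean_space) \<Rightarrow> bool" where
  "smooth_on S f \<longleftrightarrow> (\<forall>x\<in>S. \<exists>U F. open U \<and> x \<in> U \<and> (\<forall>k. Ck_on k U F) \<and> (\<forall>y\<in>U \<inter> S. F y = f y))"

text \<open>A chart is a domain together with a coordinate map, only the values on the domain being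
  relevant. Coordinates lie in a linear subspace \<open>model\<close> of a Euclidean space; its dimension is
  the dimension of the manifold. Allowing a subspace (instead of the full type) provides
  submanifolds of every dimension, including 0, without a change of type.\<close>

type_synonym ('a, 'e) chart = "'a set \<times> ('a \<Rightarrow> 'e)"

datatype ('a, 'e) mfd = Mfd (mtop: "'a topology") (model: "'e set") (atlas: "('a, 'e) chart set")

abbreviation points :: "('a, 'e) mfd \<Rightarrow> 'a set" where
  "points M \<equiv> topspace (mtop M)"

definition mdim :: "('a, 'e::euclidean_space) mfd \<Rightarrow> nat" where
  "mdim M = dim (model M)"

abbreviation chart_inv :: "('a, 'e) chart \<Rightarrow> 'e \<Rightarrow> 'a" where
  "chart_inv c \<equiv> inv_into (fst c) (snd c)"

definition is_chart :: "'a topology \<Rightarrow> 'e::euclidean_space set \<Rightarrow> ('a, 'e) chart \<Rightarrow> bool" where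
  "is_chart T V c \<longleftrightarrow> openin T (fst c) \<and> openin (top_of_set V) (snd c ` fst c) \<and>
     homeomorphic_map (subtopology T (fst c)) (top_of_set (snd c ` fst c)) (snd c)"

definition compatible :: "('a, 'e::euclidean_space) chart \<Rightarrow> ('a, 'e) chart \<Rightarrow> bool" where
  "compatible c d \<longleftrightarrow> smooth_on (snd c ` (fst c \<inter> fst d)) (snd d \<circ> chart_inv c) \<and>
     smooth_on (snd d ` (fst c \<inter> fst d)) (snd c \<circ> chart_inv d)"

definition second_countable :: "'a topology \<Rightarrow> bool" where
  "second_countable T \<longleftrightarrow> (\<exists>\<B>. countable \<B> \<and> (\<forall>B\<in>\<B>. openin T B) \<and>
     (\<forall>U x. openin T U \<and> x \<in> U \<longrightarrow> (\<exists>B\<in>\<B>. x \<in> B \<and> B \<subseteq> U)))"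

text \<open>The atlas need not be maximal.\<close>

definition smooth_manifold :: "('a, 'e::euclidean_space) mfd \<Rightarrow> bool" where
  "smooth_manifold M \<longleftrightarrow> Hausdorff_space (mtop M) \<and> second_countable (mtop M) \<and>
     subspace (model M) \<and> (\<forall>c\<in>atlas M. is_chart (mtop M) (model M) c) \<and>
     points M = (\<Union>c\<in>atlas M. fst c) \<and> (\<forall>c\<in>atlas M. \<forall>d\<in>atlas M. compatible c d)"

definition admissible_chart :: "('a, 'e::euclidean_space) mfd \<Rightarrow> ('a, 'e) chart \<Rightarrow> bool" where
  "admissible_chart M c \<longleftrightarrow> is_chart (mtop M) (model M) c \<and> (\<forall>d\<in>atlas M. compatible c d)"

definition smooth_map ::
  "('a, 'e::euclidean_space) mfd \<Rightarrow> ('b, 'f::euclidean_space) mfd \<Rightarrow> ('a \<Rightarrow> 'b) \<Rightarrow> bool" where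
  "smooth_map M N F \<longleftrightarrow> continuous_map (mtop M) (mtop N) F \<and>
     (\<forall>c\<in>atlas M. \<forall>d\<in>atlas N. smooth_on (snd c ` (fst c \<inter> F -` fst d)) (snd d \<circ> F \<circ> chart_inv c))"

definition diffeomorphism ::
  "('a, 'e::euclidean_space) mfd \<Rightarrow> ('b, 'f::euclidean_space) mfd \<Rightarrow> ('a \<Rightarrow> 'b) \<Rightarrow> bool" where
  "diffeomorphism M N F \<longleftrightarrow> bij_betw F (points M) (points N) \<and> smooth_map M N F \<and>
     smooth_map N M (inv_into (points M) F)"

definition open_mfd :: "'e::euclidean_space set \<Rightarrow> ('e, 'e) mfd" where
  "open_mfd U = Mfd (top_of_set U) UNIV {(U, \<lambda>x. x)}"

abbreviation pos_reals :: "(real, real) mfd" where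
  "pos_reals \<equiv> open_mfd {0<..}"

definition prod_mfd :: "('a, 'e) mfd \<Rightarrow> ('b, 'f) mfd \<Rightarrow> ('a \<times> 'b, 'e \<times> 'f) mfd" where
  "prod_mfd M N = Mfd (prod_topology (mtop M) (mtop N)) (model M \<times> model N)
     ((\<lambda>(c, d). (fst c \<times> fst d, map_prod (snd c) (snd d))) ` (atlas M \<times> atlas N))"

text \<open>A fixed \<open>k\<close>-dimensional linear subspace of the model, playing the role of
  \<open>\<real>\<^sup>k \<subseteq> \<real>\<^sup>n\<close> in the definition of slice charts.\<close>

definition slice_model :: "('a, 'e::euclidean_space) mfd \<Rightarrow> nat \<Rightarrow> 'e set" where
  "slice_model M k = (SOME W. subspace W \<and> W \<subseteq> model M \<and> dim W = k)"

definition slice_chart :: "('a, 'e::euclidean_space) mfd \<Rightarrow> nat \<Rightarrow> 'a set \<Rightarrow> ('a, 'e) chart \<Rightarrow> bool" where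
  "slice_chart M k S c \<longleftrightarrow> admissible_chart M c \<and>
     snd c ` (fst c \<inter> S) = snd c ` fst c \<inter> slice_model M k"

definition embedded_submanifold :: "('a, 'e::euclidean_space) mfd \<Rightarrow> nat \<Rightarrow> 'a set \<Rightarrow> bool" where
  "embedded_submanifold M k S \<longleftrightarrow> k \<le> mdim M \<and> S \<subseteq> points M \<and>
     (\<forall>x\<in>S. \<exists>c. slice_chart M k S c \<and> x \<in> fst c)"

definition submfd :: "('a, 'e::euclidean_space) mfd \<Rightarrow> nat \<Rightarrow> 'a set \<Rightarrow> ('a, 'e) mfd" where
  "submfd M k S = Mfd (subtopology (mtop M) S) (slice_model M k)
     {(fst c \<inter> S, snd c) |c. slice_chart M k S c}"

text \<open>A tangent vector at \<open>x\<close> assigns to every chart of the atlas around \<open>x\<close> a coordinate vector,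
  subject to the usual transformation rule under changes of charts; it is 0 on all other charts.
  Addition and scalar multiplication are pointwise. Derivatives are taken within the model
  subspace, hence are determined exactly on vectors of the model, the only ones they are
  applied to.\<close>

type_synonym ('a, 'e) tvec = "('a, 'e) chart \<Rightarrow> 'e"

definition charts_at :: "('a, 'e) mfd \<Rightarrow> 'a \<Rightarrow> ('a, 'e) chart set" where
  "charts_at M x = {c \<in> atlas M. x \<in> fst c}"

definition chart_at :: "('a, 'e) mfd \<Rightarrow> 'a \<Rightarrow> ('a, 'e) chart" where
  "chart_at M x = (SOME c. c \<in> charts_at M x)"

definition chart_deriv ::
  "('a, 'e::euclidean_space) mfd \<Rightarrow> ('a, 'e) chart \<Rightarrow> 'a \<Rightarrow> ('a \<Rightarrow> 'f::euclidean_space) \<Rightarrow> 'e \<Rightarrow> 'f" where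
  "chart_deriv M c x h = frechet_derivative (h \<circ> chart_inv c) (at (snd c x) within model M)"

definition tangent_space :: "('a, 'e::euclidean_space) mfd \<Rightarrow> 'a \<Rightarrow> ('a, 'e) tvec set" where
  "tangent_space M x = {\<xi>. (\<forall>c. c \<notin> charts_at M x \<longrightarrow> \<xi> c = 0) \<and>
     (\<forall>c\<in>charts_at M x. \<xi> c \<in> model M) \<and>
     (\<forall>c\<in>charts_at M x. \<forall>d\<in>charts_at M x. \<xi> d = chart_deriv M c x (snd d) (\<xi> c))}"

text \<open>The tangent vector at \<open>x\<close> with coordinates \<open>u\<close> in the chart \<open>c\<close>.\<close>

definition coord_tvec :: "('a, 'e::euclidean_space) mfd \<Rightarrow> ('a, 'e) chart \<Rightarrow> 'a \<Rightarrow> 'e \<Rightarrow> ('a, 'e) tvec" where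
  "coord_tvec M c x u = (\<lambda>d. if d \<in> charts_at M x then chart_deriv M c x (snd d) u else 0)"

definition differential ::
  "('a, 'e::euclidean_space) mfd \<Rightarrow> ('b, 'f::euclidean_space) mfd \<Rightarrow> ('a \<Rightarrow> 'b) \<Rightarrow> 'a \<Rightarrow>
    ('a, 'e) tvec \<Rightarrow> ('b, 'f) tvec" where
  "differential M N F x \<xi> = (\<lambda>d. if d \<in> charts_at N (F x)
     then chart_deriv M (chart_at M x) x (snd d \<circ> F) (\<xi> (chart_at M x)) else 0)"

definition ext_d :: "('a, 'e::euclidean_space) mfd \<Rightarrow> ('a \<Rightarrow> real) \<Rightarrow> 'a \<Rightarrow> ('a, 'e) tvec \<Rightarrow> real" where
  "ext_d M f x \<xi> = chart_deriv M (chart_at M x) x f (\<xi> (chart_at M x))"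

definition velocity0 :: "('a, 'e::euclidean_space) mfd \<Rightarrow> (real \<Rightarrow> 'a) \<Rightarrow> ('a, 'e) tvec" where
  "velocity0 M \<gamma> = (\<lambda>d. if d \<in> charts_at M (\<gamma> 0) then vector_derivative (snd d \<circ> \<gamma>) (at 0) else 0)"

type_synonym ('a, 'e) tensor2 = "'a \<Rightarrow> ('a, 'e) tvec \<Rightarrow> ('a, 'e) tvec \<Rightarrow> real"

text \<open>No condition on the signature is imposed; by nondegeneracy it is locally constant.
  The last conjunct is smoothness of the components of \<open>g\<close> in the charts of the atlas.\<close>

definition pseudo_riemannian_metric :: "('a, 'e::euclidean_space) mfd \<Rightarrow> ('a, 'e) tensor2 \<Rightarrow> bool" where
  "pseudo_riemannian_metric M g \<longleftrightarrow>
     (\<forall>x\<in>points M.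
        (\<forall>u\<in>tangent_space M x. \<forall>w\<in>tangent_space M x. g x u w = g x w u) \<and>
        (\<forall>u\<in>tangent_space M x. \<forall>v\<in>tangent_space M x. \<forall>w\<in>tangent_space M x.
           g x (\<lambda>c. u c + v c) w = g x u w + g x v w) \<and>
        (\<forall>a. \<forall>u\<in>tangent_space M x. \<forall>w\<in>tangent_space M x. g x (\<lambda>c. a *\<^sub>R u c) w = a * g x u w) \<and>
        (\<forall>u\<in>tangent_space M x. (\<forall>w\<in>tangent_space M x. g x u w = 0) \<longrightarrow> u = (\<lambda>c. 0))) \<and>
     (\<forall>c\<in>atlas M. \<forall>u\<in>model M. \<forall>w\<in>model M. smooth_on (snd c ` fst c)
        (\<lambda>p. g (chart_inv c p) (coord_tvec M c (chart_inv c p) u) (coord_tvec M c (chart_inv c p) w)))"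

definition pseudo_riemannian_manifold :: "('a, 'e::euclidean_space) mfd \<Rightarrow> ('a, 'e) tensor2 \<Rightarrow> bool" where
  "pseudo_riemannian_manifold M g \<longleftrightarrow> smooth_manifold M \<and> pseudo_riemannian_metric M g"

definition pullback ::
  "('a, 'e::euclidean_space) mfd \<Rightarrow> ('b, 'f::euclidean_space) mfd \<Rightarrow> ('a \<Rightarrow> 'b) \<Rightarrow>
    ('b, 'f) tensor2 \<Rightarrow> ('a, 'e) tensor2" where
  "pullback M N F g = (\<lambda>x u w. g (F x) (differential M N F x u) (differential M N F x w))"

definition isometry ::
  "('a, 'e::euclidean_space) mfd \<Rightarrow> ('a, 'e) tensor2 \<Rightarrow> ('b, 'f::euclidean_space) mfd \<Rightarrow>
    ('b, 'f) tensor2 \<Rightarrow> ('a \<Rightarrow> 'b) \<Rightarrow> bool" where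
  "isometry M g N h F \<longleftrightarrow> pseudo_riemannian_manifold M g \<and> pseudo_riemannian_manifold N h \<and>
     diffeomorphism M N F \<and>
     (\<forall>x\<in>points M. \<forall>u\<in>tangent_space M x. \<forall>w\<in>tangent_space M x. pullback M N F h x u w = g x u w)"

text \<open>Only the values \<open>m s x\<close> with \<open>s > 0\<close> and \<open>x\<close> a point of the manifold are relevant.\<close>

definition free_smooth_action :: "('a, 'e::euclidean_space) mfd \<Rightarrow> (real \<Rightarrow> 'a \<Rightarrow> 'a) \<Rightarrow> bool" where
  "free_smooth_action M m \<longleftrightarrow> smooth_map (prod_mfd pos_reals M) M (\<lambda>(s, x). m s x) \<and>
     (\<forall>x\<in>points M. m 1 x = x) \<and>
     (\<forall>s>0. \<forall>t>0. \<forall>x\<in>points M. m (s * t) x = m s (m t x)) \<and>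
     (\<forall>s>0. \<forall>x\<in>points M. m s x = x \<longrightarrow> s = 1)"

definition generator :: "('a, 'e::euclidean_space) mfd \<Rightarrow> (real \<Rightarrow> 'a \<Rightarrow> 'a) \<Rightarrow> 'a \<Rightarrow> ('a, 'e) tvec" where
  "generator M m x = velocity0 M (\<lambda>t. m (exp t) x)"

definition homogeneous_pair ::
  "('a, 'e::euclidean_space) mfd \<Rightarrow> (real \<Rightarrow> 'a \<Rightarrow> 'a) \<Rightarrow> ('a, 'e) tensor2 \<Rightarrow> ('a \<Rightarrow> real) \<Rightarrow> real \<Rightarrow> bool" where
  "homogeneous_pair M m g f \<alpha> \<longleftrightarrow>
     (\<forall>s>0. \<forall>x\<in>points M. \<forall>u\<in>tangent_space M x. \<forall>w\<in>tangent_space M x.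
        pullback M M (m s) g x u w = s powr \<alpha> * g x u w) \<and>
     (\<forall>s>0. \<forall>x\<in>points M. f (m s x) = s powr \<alpha> * f x) \<and>
     (\<forall>x\<in>points M. \<forall>u\<in>tangent_space M x. g x (generator M m x) u = ext_d M f x u)"

definition level_set :: "('a, 'e) mfd \<Rightarrow> ('a \<Rightarrow> real) \<Rightarrow> real \<Rightarrow> 'a set" where
  "level_set M f l = {x \<in> points M. f x = l}"

definition level_mfd :: "('a, 'e::euclidean_space) mfd \<Rightarrow> ('a \<Rightarrow> real) \<Rightarrow> real \<Rightarrow> ('a, 'e) mfd" where
  "level_mfd M f l = submfd M (mdim M - 1) (level_set M f l)"

definition level_metric ::
  "('a, 'e::euclidean_space) mfd \<Rightarrow> ('a, 'e) tensor2 \<Rightarrow> ('a \<Rightarrow> real) \<Rightarrow> real \<Rightarrow> ('a, 'e) tensor2" where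
  "level_metric M g f l = pullback (level_mfd M f l) M (\<lambda>x. x) g"

text \<open>The metric \<open>v(r) (1/(\<alpha> r) dr\<^sup>2 + r/l h)\<close> on \<open>\<real>\<^sub>>\<^sub>0 \<times> N\<close>.\<close>

definition warped_metric ::
  "(real \<Rightarrow> real) \<Rightarrow> real \<Rightarrow> real \<Rightarrow> ('b, 'f::euclidean_space) mfd \<Rightarrow> ('b, 'f) tensor2 \<Rightarrow>
    (real \<times> 'b, real \<times> 'f) tensor2" where
  "warped_metric v \<alpha> l N h = (\<lambda>(r, y) u w.
     v r * (1 / (\<alpha> * r) * (ext_d (prod_mfd pos_reals N) fst (r, y) u * ext_d (prod_mfd pos_reals N) fst (r, y) w)
       + r / l * pullback (prod_mfd pos_reals N) N snd h (r, y) u w))"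

end

theory Submission
  imports Defs
begin

text \<open>
  Write \<open>P\<close> for the vector field generating the action. Differentiating \<open>f (m e\<^sup>t x) = e\<^sup>\<alpha>\<^sup>t f x\<close> at
  \<open>t = 0\<close> gives Euler's relation \<open>df(P) = \<alpha> f\<close>, and since \<open>df = g(P, -)\<close> also \<open>g(P, P) = \<alpha> f\<close>. As
  \<open>\<alpha> f\<close> has no zeros, neither has \<open>df\<close>, so the level sets \<open>f = l\<close> are embedded hypersurfaces
  (\<open>regular_level_set_embedded\<close>) with tangent spaces \<open>ker df\<close> (\<open>level_set_tangent\<close>). Because
  \<open>ker df\<close> is the orthogonal complement of \<open>P\<close> and \<open>P\<close> is not null, the tangent space of \<open>M\<close> is
  the orthogonal sum of the line of \<open>P\<close> and of \<open>ker df\<close>, which makes the restriction of \<open>g\<close> to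
  \<open>ker df\<close> nondegenerate (\<open>level_metric\<close>).

  For the parametrisation \<open>\<psi>(r, y) = m (r/l)\<^bsup>1/\<alpha>\<^esup> y\<close> the function \<open>f \<circ> \<psi>\<close> is the projection to \<open>r\<close>, and
  \<open>x \<mapsto> (f x, m (l / f x)\<^bsup>1/\<alpha>\<^esup> x)\<close> is a smooth inverse. The curve \<open>t \<mapsto> (r e\<^sup>\<alpha>\<^sup>t, y)\<close> is mapped to an
  orbit, so its velocity \<open>\<alpha> r \<partial>\<^sub>r\<close> goes to \<open>P\<close>, while on the slice of a fixed \<open>r\<close> the map is the scaling
  by \<open>s = (r/l)\<^bsup>1/\<alpha>\<^esup>\<close>. Hence \<open>d\<psi>(u) = dr(u)/(\<alpha> r) P + dm\<^sub>s(u')\<close>, where \<open>u'\<close> is the component of \<open>u\<close> along the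
  level set (\<open>differential_flow_box\<close>). The two summands are orthogonal because \<open>df(d\<psi>(u)) = dr(u)\<close>
  is already the value of \<open>df\<close> on the first one. Homogeneity gives \<open>s\<^sup>\<alpha> = r/l\<close> as the factor of the second
  summand, and \<open>g(P, P) = \<alpha> r\<close> gives \<open>dr\<^sup>2 / (\<alpha> r)\<close> (\<open>pullback_flow_box\<close>). That the warped product is
  a metric needs no separate argument: it is the pullback of a conformal multiple of \<open>g\<close> along a
  diffeomorphism.

  The rest is the calculus on manifolds that this computation presupposes. Its organising notion is the
  germ of a smooth function (\<open>smooth_near\<close>), which is independent of the chart. Smooth maps pull
  germs back to germs, and one chain rule for derivatives of germs along tangent vectors
  (\<open>tderiv_differential\<close>) yields the functoriality of differentials.
\<close>

section \<open>Functions of class \<open>C\<^sup>k\<close>\<close>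

lemma Ck_on_subset: "Ck_on k U f \<Longrightarrow> W \<subseteq> U \<Longrightarrow> Ck_on k W f"
  by (induction k arbitrary: f) (auto intro: continuous_on_subset)

text \<open>On an open set a function determines its derivatives, so a recursion on \<open>k\<close> only has to
  transport differentiability and the derivative itself.\<close>

lemma Ck_on_cong:
  assumes "open U" "Ck_on k U f" "\<And>x. x \<in> U \<Longrightarrow> f x = g x"
  shows "Ck_on k U g"
  using assms(2,3)
proof (induction k arbitrary: f g)
  case 0
  then show ?case by (simp cong: continuous_on_cong)
next
  case (Suc k)
  have D: "(g has_derivative D) (at x)" if "(f has_derivative D) (at x)" "x \<in> U" for D x
    using that(1) \<open>open U\<close> that(2) Suc.prems(2) by (rule has_derivative_transform_within_open)
  have eq: "frechet_derivative g (at x) = frechet_derivative f (at x)" if "x \<in> U" for x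
    using D[OF _ that] Suc.prems(1) that
    by (metis Ck_on.simps(2) frechet_derivative_at frechet_derivative_works)
  have "g differentiable (at x)" if "x \<in> U" for x
    using D[OF _ that] that Suc.prems(1) unfolding differentiable_def Ck_on.simps by blast
  moreover have "Ck_on k U (\<lambda>x. frechet_derivative g (at x) h)" for h
  proof (rule Suc.IH)
    show "Ck_on k U (\<lambda>x. frechet_derivative f (at x) h)"
      using Suc.prems(1) unfolding Ck_on.simps by blast
  qed (simp only: eq)
  ultimately show ?case unfolding Ck_on.simps by blast
qed

lemma Ck_on_SucD: "Ck_on (Suc k) U f \<Longrightarrow> Ck_on k U f"
proof (induction k arbitrary: f)
  case 0
  then show ?case
    by (auto intro!: continuous_at_imp_continuous_on differentiable_imp_continuous_within)
next
  case (Suc k)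
  from Suc.prems show ?case
    by (subst Ck_on.simps(2)) (auto simp only: Ck_on.simps(2)[of "Suc k"] intro: Suc.IH)
qed

text \<open>Any explicit formula for the derivative may take the place of the choice made by
  \<open>frechet_derivative\<close>.\<close>

lemma Ck_on_SucI:
  assumes "open U" "\<And>x. x \<in> U \<Longrightarrow> (f has_derivative D x) (at x)" "\<And>h. Ck_on k U (\<lambda>x. D x h)"
  shows "Ck_on (Suc k) U f"
proof -
  have "D x = frechet_derivative f (at x)" if "x \<in> U" for x
    using assms(2)[OF that] by (rule frechet_derivative_at)
  then have "Ck_on k U (\<lambda>x. frechet_derivative f (at x) h)" for h
    using Ck_on_cong[OF assms(1) assms(3)[of h]] by simp
  then show ?thesis using assms(2) unfolding differentiable_def Ck_on.simps by blast
qed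

lemma Ck_on_SucE:
  assumes "Ck_on (Suc k) U f" "x \<in> U"
  shows "(f has_derivative frechet_derivative f (at x)) (at x)"
  using assms by (simp add: frechet_derivative_works)

lemma Ck_on_const [simp]: "Ck_on k U (\<lambda>x. c)"
  by (induction k arbitrary: c) auto

lemma Ck_on_bounded_linear:
  assumes "open U" "bounded_linear L"
  shows "Ck_on k U L"
proof (cases k)
  case 0
  then show ?thesis using assms by (simp add: linear_continuous_on)
next
  case (Suc j)
  have "Ck_on (Suc j) U L"
    using assms(2) by (intro Ck_on_SucI[OF assms(1), where D = "\<lambda>x. L"] Ck_on_const
        bounded_linear_imp_has_derivative)
  with Suc show ?thesis by simp
qed

lemma Ck_on_add:
  assumes "open U"
  shows "Ck_on k U f \<Longrightarrow> Ck_on k U g \<Longrightarrow> Ck_on k U (\<lambda>x. f x + g x)"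
proof (induction k arbitrary: f g)
  case 0
  then show ?case by (auto intro: continuous_intros)
next
  case (Suc k)
  show ?case
  proof (rule Ck_on_SucI[OF assms])
    show "((\<lambda>x. f x + g x) has_derivative
        (\<lambda>h. frechet_derivative f (at x) h + frechet_derivative g (at x) h)) (at x)" if "x \<in> U" for x
      using Suc.prems that by (intro has_derivative_add Ck_on_SucE)
    show "Ck_on k U (\<lambda>x. frechet_derivative f (at x) h + frechet_derivative g (at x) h)" for h
      using Suc by simp
  qed
qed

text \<open>By the product rule a derivative of a product is a sum of two products with one factor
  differentiated, and both fall under the induction hypothesis.\<close>

lemma Ck_on_bilinear:
  assumes "open U" "bounded_bilinear B"
  shows "Ck_on k U f \<Longrightarrow> Ck_on k U g \<Longrightarrow> Ck_on k U (\<lambda>x. B (f x) (g x))"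
proof (induction k arbitrary: f g)
  case 0
  then show ?case by (auto intro: bounded_bilinear.continuous_on[OF assms(2)])
next
  case (Suc k)
  show ?case
  proof (rule Ck_on_SucI[OF assms(1)])
    show "((\<lambda>x. B (f x) (g x)) has_derivative
        (\<lambda>h. B (f x) (frechet_derivative g (at x) h) + B (frechet_derivative f (at x) h) (g x))) (at x)" 
      if "x \<in> U" for x
      using Suc.prems that by (intro bounded_bilinear.FDERIV[OF assms(2)] Ck_on_SucE)
    show "Ck_on k U (\<lambda>x. B (f x) (frechet_derivative g (at x) h) + B (frechet_derivative f (at x) h) (g x))" for h
      using Suc by (intro Ck_on_add assms Suc.IH Ck_on_SucD[of k U f] Ck_on_SucD[of k U g]) auto
  qed
qed

lemmas Ck_on_scaleR = Ck_on_bilinear[OF _ bounded_bilinear_scaleR]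
lemmas Ck_on_mult = Ck_on_bilinear[OF _ bounded_bilinear_mult]

lemma Ck_on_sum:
  assumes "open U" "\<And>i. i \<in> I \<Longrightarrow> Ck_on k U (f i)"
  shows "Ck_on k U (\<lambda>x. \<Sum>i\<in>I. f i x)"
  using assms by (induction I rule: infinite_finite_induct) (auto intro: Ck_on_add)

lemma Ck_on_linear_image:
  assumes "open U" "bounded_linear L" "Ck_on k U f"
  shows "Ck_on k U (\<lambda>x. L (f x))"
  using assms(3)
proof (induction k arbitrary: f)
  case 0
  then show ?case by (auto intro: bounded_linear.continuous_on[OF assms(2)])
next
  case (Suc k)
  show ?case
    using Suc by (intro Ck_on_SucI[OF assms(1), where D = "\<lambda>x h. L (frechet_derivative f (at x) h)"]
        bounded_linear.has_derivative[OF assms(2)] Ck_on_SucE) auto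
qed

lemma Ck_on_Pair:
  assumes "open U" "Ck_on k U f" "Ck_on k U g"
  shows "Ck_on k U (\<lambda>x. (f x, g x))"
proof -
  have "Ck_on k U (\<lambda>x. (f x, 0) + (0, g x))"
    using assms by (intro Ck_on_add Ck_on_linear_image[where L = "\<lambda>y. (y, 0)"]
        Ck_on_linear_image[where L = "\<lambda>y. (0, y)"] bounded_linear_Pair bounded_linear_ident bounded_linear_zero)
  then show ?thesis by simp
qed

text \<open>Expanding the inner derivative in a basis writes a derivative of the composite as a sum of
  products of a coordinate of the inner derivative and a partial derivative of the outer function
  composed with the inner one. The latter is a composite of order \<open>k\<close>.\<close>

lemma Ck_on_compose:
  fixes f :: "'b::euclidean_space \<Rightarrow> 'c::euclidean_space" and u :: "'a::euclidean_space \<Rightarrow> 'b"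
  assumes U: "open U" and W: "open W" and uU: "u ` U \<subseteq> W"
  shows "Ck_on k U u \<Longrightarrow> Ck_on k W f \<Longrightarrow> Ck_on k U (f \<circ> u)"
proof (induction k arbitrary: f)
  case 0
  then show ?case using uU by (metis Ck_on.simps(1) continuous_on_compose continuous_on_subset)
next
  case (Suc k)
  show ?case
  proof (rule Ck_on_SucI[OF U])
    fix x assume x: "x \<in> U"
    then have ux: "u x \<in> W" using uU by auto
    let ?Df = "frechet_derivative f (at (u x))" and ?Du = "frechet_derivative u (at x)"
    have D: "(f \<circ> u has_derivative ?Df \<circ> ?Du) (at x)"
      using Suc.prems x ux by (intro diff_chain_at Ck_on_SucE)
    have lin: "linear ?Df"
      using Ck_on_SucE[OF Suc.prems(2) ux] by (rule has_derivative_linear)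
    have "?Df y = (\<Sum>b\<in>Basis. (y \<bullet> b) *\<^sub>R ?Df b)" for y
    proof -
      have "?Df y = ?Df (\<Sum>b\<in>Basis. (y \<bullet> b) *\<^sub>R b)" by (simp add: euclidean_representation)
      also have "\<dots> = (\<Sum>b\<in>Basis. (y \<bullet> b) *\<^sub>R ?Df b)"
        by (simp add: linear_sum[OF lin] linear_scale[OF lin])
      finally show ?thesis .
    qed
    then show "(f \<circ> u has_derivative (\<lambda>h. \<Sum>b\<in>Basis. (?Du h \<bullet> b) *\<^sub>R ?Df b)) (at x)"
      using D by (metis (no_types, lifting) ext comp_apply)
  next
    fix h
    show "Ck_on k U (\<lambda>x. \<Sum>b\<in>Basis. (frechet_derivative u (at x) h \<bullet> b) *\<^sub>R frechet_derivative f (at (u x)) b)"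
    proof (intro Ck_on_sum Ck_on_scaleR U)
      fix b :: 'b
      show "Ck_on k U (\<lambda>x. frechet_derivative u (at x) h \<bullet> b)"
        using Suc.prems(1)
        by (intro Ck_on_linear_image[where L = "\<lambda>v. v \<bullet> b"] U bounded_linear_inner_left) auto
      have "Ck_on k U ((\<lambda>y. frechet_derivative f (at y) b) \<circ> u)"
        using Suc.prems by (intro Suc.IH Ck_on_SucD[of k U u]) auto
      then show "Ck_on k U (\<lambda>x. frechet_derivative f (at (u x)) b)"
        by (simp add: o_def)
    qed
  qed
qed

text \<open>Up to a constant factor the derivative is the square of the function itself.\<close>

lemma Ck_on_inverse: "Ck_on k (- {0}) (inverse :: real \<Rightarrow> real)"
proof (induction k)
  case 0
  then show ?case by (auto intro: continuous_intros)
next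
  case (Suc k)
  show ?case
  proof (rule Ck_on_SucI[where D = "\<lambda>x h. - (inverse x * h * inverse x)"])
    show "Ck_on k (- {0}) (\<lambda>x. - (inverse x * h * inverse x))" for h :: real
      using Suc by (intro Ck_on_linear_image[where L = uminus] Ck_on_mult Ck_on_const
          bounded_linear_minus bounded_linear_ident) auto
  qed (auto intro!: has_derivative_inverse')
qed

text \<open>The exponent has to vary in the induction, as it drops by one under differentiation.\<close>

lemma Ck_on_powr: "Ck_on k {0<..} (\<lambda>x::real. x powr a)"
proof (induction k arbitrary: a)
  case 0
  then show ?case by (auto intro!: continuous_intros)
next
  case (Suc k)
  show ?case
  proof (rule Ck_on_SucI[where D = "\<lambda>x h. (a * x powr (a - 1)) * h"])
    show "((\<lambda>x. x powr a) has_derivative (\<lambda>h. (a * x powr (a - 1)) * h)) (at x)" if "x \<in> {0<..}" for x :: real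
      using has_real_derivative_powr[of x a] that by (simp add: has_field_derivative_def)
    show "Ck_on k {0<..} (\<lambda>x. (a * x powr (a - 1)) * h)" for h :: real
      using Suc by (intro Ck_on_mult Ck_on_const) auto
  qed auto
qed

section \<open>Smooth functions on arbitrary sets\<close>

lemma smooth_onI_open:
  assumes "open U" "S \<subseteq> U" "\<And>k. Ck_on k U f"
  shows "smooth_on S f"
  unfolding smooth_on_def
  by (intro ballI exI[of _ U] exI[of _ f]) (use assms in auto)

lemma smooth_onE:
  assumes "smooth_on S f" "x \<in> S"
  obtains U F where "open U" "x \<in> U" "\<And>k. Ck_on k U F" "\<And>y. y \<in> U \<Longrightarrow> y \<in> S \<Longrightarrow> F y = f y"
proof -
  from assms obtain U F where UF: "open U \<and> x \<in> U \<and> (\<forall>k. Ck_on k U F) \<and> (\<forall>y\<in>U \<inter> S. F y = f y)"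
    unfolding smooth_on_def by meson
  show thesis by (rule that[of U F]) (use UF in auto)
qed

lemma smooth_onI:
  assumes "\<And>x. x \<in> S \<Longrightarrow> \<exists>U F. open U \<and> x \<in> U \<and> (\<forall>k. Ck_on k U F) \<and> (\<forall>y\<in>U \<inter> S. F y = f y)"
  shows "smooth_on S f"
  using assms unfolding smooth_on_def by (rule ballI)

lemma smooth_on_subset:
  assumes "smooth_on S f" "T \<subseteq> S"
  shows "smooth_on T f"
proof (rule smooth_onI)
  fix x assume "x \<in> T"
  then have x: "x \<in> S" using assms(2) by auto
  obtain U F where "open U" "x \<in> U" "\<And>k. Ck_on k U F" "\<And>y. y \<in> U \<Longrightarrow> y \<in> S \<Longrightarrow> F y = f y"
    by (rule smooth_onE[OF assms(1) x]) (rule that)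
  then show "\<exists>U F. open U \<and> x \<in> U \<and> (\<forall>k. Ck_on k U F) \<and> (\<forall>y\<in>U \<inter> T. F y = f y)"
    using assms(2) by (intro exI[of _ U] exI[of _ F]) auto
qed

lemma smooth_on_cong:
  assumes "smooth_on S f" "\<And>x. x \<in> S \<Longrightarrow> g x = f x"
  shows "smooth_on S g"
proof (rule smooth_onI)
  fix x assume x: "x \<in> S"
  obtain U F where "open U" "x \<in> U" "\<And>k. Ck_on k U F" "\<And>y. y \<in> U \<Longrightarrow> y \<in> S \<Longrightarrow> F y = f y"
    by (rule smooth_onE[OF assms(1) x]) (rule that)
  then show "\<exists>U F. open U \<and> x \<in> U \<and> (\<forall>k. Ck_on k U F) \<and> (\<forall>y\<in>U \<inter> S. F y = g y)"
    using assms(2) by (intro exI[of _ U] exI[of _ F]) auto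
qed

text \<open>A local extension on a piece extends the function on the whole set once its domain is shrunk to
  an open set that meets the set inside the piece.\<close>

lemma smooth_on_local:
  assumes "\<And>x. x \<in> S \<Longrightarrow> \<exists>T. openin (top_of_set S) T \<and> x \<in> T \<and> smooth_on T f"
  shows "smooth_on S f"
proof (rule smooth_onI)
  fix x assume x: "x \<in> S"
  then obtain T where T: "openin (top_of_set S) T" "x \<in> T" "smooth_on T f"
    using assms by meson
  then obtain W where W: "open W" "T = S \<inter> W" by (auto simp: openin_open)
  obtain U F where U: "open U" "x \<in> U" "\<And>k. Ck_on k U F" "\<And>y. y \<in> U \<Longrightarrow> y \<in> T \<Longrightarrow> F y = f y"
    by (rule smooth_onE[OF T(3,2)]) (rule that)
  show "\<exists>U F. open U \<and> x \<in> U \<and> (\<forall>k. Ck_on k U F) \<and> (\<forall>y\<in>U \<inter> S. F y = f y)"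
    using U W T(2) by (intro exI[of _ "U \<inter> W"] exI[of _ F]) (auto intro: Ck_on_subset[of _ U])
qed

lemma smooth_on_compose:
  assumes "smooth_on S u" "smooth_on T f" "u ` S \<subseteq> T"
  shows "smooth_on S (f \<circ> u)"
proof (rule smooth_onI)
  fix x assume x: "x \<in> S"
  obtain U G where U: "open U" "x \<in> U" "\<And>k. Ck_on k U G" "\<And>y. y \<in> U \<Longrightarrow> y \<in> S \<Longrightarrow> G y = u y"
    by (rule smooth_onE[OF assms(1) x]) (rule that)
  have ux: "u x \<in> T" using x assms(3) by auto
  obtain W F where W: "open W" "u x \<in> W" "\<And>k. Ck_on k W F" "\<And>y. y \<in> W \<Longrightarrow> y \<in> T \<Longrightarrow> F y = f y"
    by (rule smooth_onE[OF assms(2) ux]) (rule that)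
  have "continuous_on U G" using U(3)[of 0] by simp
  define U' where "U' = U \<inter> G -` W"
  have U': "open U'" unfolding U'_def
    using \<open>continuous_on U G\<close> U(1) W(1) by (rule continuous_open_preimage)
  moreover have "x \<in> U'"
    using U(2) W(2) U(4)[OF U(2) x] by (simp add: U'_def)
  moreover have "Ck_on k U' (F \<circ> G)" for k
  proof (rule Ck_on_compose[OF U' W(1)])
    show "Ck_on k U' G" using U(3) by (rule Ck_on_subset) (simp add: U'_def)
  qed (auto simp: U'_def W(3))
  moreover have "(F \<circ> G) y = (f \<circ> u) y" if "y \<in> U' \<inter> S" for y
    using U(4)[of y] W(4)[of "G y"] assms(3) that by (auto simp: U'_def)
  ultimately show "\<exists>U F. open U \<and> x \<in> U \<and> (\<forall>k. Ck_on k U F) \<and> (\<forall>y\<in>U \<inter> S. F y = (f \<circ> u) y)"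
    by (intro exI[of _ U'] exI[of _ "F \<circ> G"]) auto
qed

lemma smooth_on_Pair:
  assumes "smooth_on S f" "smooth_on S g"
  shows "smooth_on S (\<lambda>x. (f x, g x))"
proof (rule smooth_onI)
  fix x assume x: "x \<in> S"
  obtain U F where U: "open U" "x \<in> U" "\<And>k. Ck_on k U F" "\<And>y. y \<in> U \<Longrightarrow> y \<in> S \<Longrightarrow> F y = f y"
    by (rule smooth_onE[OF assms(1) x]) (rule that)
  obtain W G where W: "open W" "x \<in> W" "\<And>k. Ck_on k W G" "\<And>y. y \<in> W \<Longrightarrow> y \<in> S \<Longrightarrow> G y = g y"
    by (rule smooth_onE[OF assms(2) x]) (rule that)
  have "Ck_on k (U \<inter> W) (\<lambda>x. (F x, G x))" for k
    using U(1) W(1) Ck_on_subset[OF U(3)[of k], of "U \<inter> W"] Ck_on_subset[OF W(3)[of k], of "U \<inter> W"]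
    by (intro Ck_on_Pair) (simp_all add: open_Int)
  then show "\<exists>V H. open V \<and> x \<in> V \<and> (\<forall>k. Ck_on k V H) \<and> (\<forall>y\<in>V \<inter> S. H y = (f y, g y))"
    by (intro exI[of _ "U \<inter> W"] exI[of _ "\<lambda>x. (F x, G x)"]) (simp add: U W open_Int)
qed

lemma smooth_on_const: "smooth_on S (\<lambda>x. c)"
  by (rule smooth_onI_open[of UNIV]) auto

lemma smooth_on_bounded_linear: "bounded_linear L \<Longrightarrow> smooth_on S L"
  by (rule smooth_onI_open[of UNIV]) (auto intro: Ck_on_bounded_linear)

lemma smooth_on_ident: "smooth_on S (\<lambda>x. x)"
  by (intro smooth_on_bounded_linear bounded_linear_ident)

text \<open>The product is a composite with the bilinear map, which is smooth on the whole product space.\<close>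

lemma smooth_on_bilinear:
  fixes B :: "'a::euclidean_space \<Rightarrow> 'b::euclidean_space \<Rightarrow> 'c::euclidean_space"
  assumes "bounded_bilinear B" "smooth_on S f" "smooth_on S g"
  shows "smooth_on S (\<lambda>x. B (f x) (g x))"
proof -
  have "smooth_on UNIV (\<lambda>p. B (fst p) (snd p))"
    using assms(1) by (intro smooth_onI_open[of UNIV] Ck_on_bilinear[of UNIV B] Ck_on_bounded_linear
        bounded_linear_fst bounded_linear_snd) simp_all
  from smooth_on_compose[OF smooth_on_Pair[OF assms(2,3)] this] show ?thesis
    by (simp add: o_def)
qed

lemmas smooth_on_mult = smooth_on_bilinear[OF bounded_bilinear_mult]

lemma smooth_on_linear_image:
  assumes "bounded_linear L" "smooth_on S f"
  shows "smooth_on S (\<lambda>x. L (f x))"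
  using smooth_on_compose[OF assms(2) smooth_on_bounded_linear[OF assms(1), of UNIV]] by (simp add: o_def)

lemma smooth_on_add:
  assumes "smooth_on S f" "smooth_on S g"
  shows "smooth_on S (\<lambda>x. f x + g x)"
  using smooth_on_linear_image[OF bounded_linear_add[OF bounded_linear_fst bounded_linear_snd]
      smooth_on_Pair[OF assms]] by simp

lemma smooth_on_sum:
  assumes "\<And>i. i \<in> I \<Longrightarrow> smooth_on S (f i)"
  shows "smooth_on S (\<lambda>x. \<Sum>i\<in>I. f i x)"
  using assms by (induction I rule: infinite_finite_induct) (auto intro: smooth_on_add smooth_on_const)

lemma smooth_on_powr:
  fixes f :: "'a::euclidean_space \<Rightarrow> real"
  assumes "smooth_on S f" "\<And>x. x \<in> S \<Longrightarrow> f x > 0"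
  shows "smooth_on S (\<lambda>x. f x powr a)"
proof -
  have "smooth_on {0<..} (\<lambda>x::real. x powr a)"
    by (rule smooth_onI_open[of "{0<..}"]) (simp_all add: Ck_on_powr)
  from smooth_on_compose[OF assms(1) this] assms(2) show ?thesis
    by (simp add: o_def image_subset_iff)
qed

lemma smooth_on_continuous_on:
  assumes "smooth_on S f"
  shows "continuous_on S f"
  unfolding continuous_on_eq_continuous_within
proof
  fix x assume x: "x \<in> S"
  obtain U F where U: "open U" "x \<in> U" "\<And>k. Ck_on k U F" "\<And>y. y \<in> U \<Longrightarrow> y \<in> S \<Longrightarrow> F y = f y"
    by (rule smooth_onE[OF assms x]) (rule that)
  have "continuous_on U F" using U(3)[of 0] by simp
  then have "isCont F x" using U(1,2) by (simp add: continuous_on_eq_continuous_at)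
  then have "continuous (at x within S) F" by (rule continuous_at_imp_continuous_at_within)
  moreover have "\<forall>\<^sub>F y in at x within S. F y = f y"
    unfolding eventually_at_topological using U(1,2,4) by (intro exI[of _ U]) simp
  ultimately show "continuous (at x within S) f"
    using U(4)[OF U(2) x] Lim_transform_eventually unfolding continuous_within by fastforce
qed

section \<open>Derivatives within a linear subspace\<close>

lemma has_derivative_within_openin_cong:
  assumes "openin (top_of_set V) S" "x \<in> S" "\<And>y. y \<in> S \<Longrightarrow> f y = g y"
    and "(f has_derivative D) (at x within V)"
  shows "(g has_derivative D) (at x within V)"
proof (rule has_derivative_transform_eventually[OF assms(4)])
  obtain W where W: "open W" "S = V \<inter> W" using assms(1) by (auto simp: openin_open)
  then show "\<forall>\<^sub>F y in at x within V. f y = g y"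
    unfolding eventually_at_topological using assms(2,3) by (intro exI[of _ W]) auto
  show "f x = g x" "x \<in> V" using assms(2,3) W by auto
qed

text \<open>A derivative within a subspace is not unique as a linear map, but restricting to the line through
  \<open>p\<close> in a direction of the subspace reduces to the unique derivative of a curve.\<close>

lemma has_derivative_subspace_unique:
  assumes V: "subspace V" "p \<in> V" "h \<in> V"
    and D: "(f has_derivative D) (at p within V)" "(f has_derivative D') (at p within V)"
  shows "D h = D' h"
proof -
  have line: "range (\<lambda>t. p + t *\<^sub>R h) \<subseteq> V"
    using V by (auto intro: subspace_add subspace_scale)
  have *: "((\<lambda>t. f (p + t *\<^sub>R h)) has_derivative (\<lambda>t. E (t *\<^sub>R h))) (at 0)"
    if "(f has_derivative E) (at p within V)" for E
  proof -
    have "(f has_derivative E) (at (p + 0 *\<^sub>R h) within range (\<lambda>t. p + t *\<^sub>R h))"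
      using has_derivative_subset[OF that line] by simp
    moreover have "((\<lambda>t. p + t *\<^sub>R h) has_derivative (\<lambda>t. t *\<^sub>R h)) (at 0)"
      by (auto intro!: derivative_eq_intros)
    ultimately show ?thesis
      by (rule has_derivative_in_compose[rotated])
  qed
  have "(\<lambda>t. D (t *\<^sub>R h)) = (\<lambda>t. D' (t *\<^sub>R h))"
    using *[OF D(1)] *[OF D(2)] by (rule has_derivative_unique)
  from fun_cong[OF this, of 1] show ?thesis by simp
qed

lemma frechet_derivative_subspace:
  assumes "subspace V" "p \<in> V" "h \<in> V" "(f has_derivative D) (at p within V)"
  shows "frechet_derivative f (at p within V) h = D h"
proof -
  have "(f has_derivative frechet_derivative f (at p within V)) (at p within V)"
    using assms(4) unfolding differentiable_def frechet_derivative_works[symmetric] by blast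
  from has_derivative_subspace_unique[OF assms(1-3) this assms(4)] show ?thesis .
qed

lemma smooth_on_differentiable:
  assumes "smooth_on S f" "openin (top_of_set V) S" "x \<in> S"
  shows "f differentiable (at x within V)"
proof -
  obtain U F where U: "open U" "x \<in> U" "\<And>k. Ck_on k U F" "\<And>y. y \<in> U \<Longrightarrow> y \<in> S \<Longrightarrow> F y = f y"
    by (rule smooth_onE[OF assms(1,3)]) (rule that)
  have "(F has_derivative frechet_derivative F (at x)) (at x within V)"
    using Ck_on_SucE[OF U(3) U(2)] by (rule has_derivative_at_withinI)
  moreover have "openin (top_of_set V) (S \<inter> U)"
    using assms(2) U(1) by (rule openin_Int_open)
  ultimately have "(f has_derivative frechet_derivative F (at x)) (at x within V)"
    using assms(3) U(2,4) by (intro has_derivative_within_openin_cong[of V "S \<inter> U" x F f]) simp_all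
  then show ?thesis unfolding differentiable_def by blast
qed

text \<open>On directions of the subspace the derivative of a local extension is the derivative within the
  subspace; the former is smooth by definition.\<close>

lemma smooth_on_frechet_derivative:
  assumes "subspace V" "smooth_on S f" "openin (top_of_set V) S" "h \<in> V"
  shows "smooth_on S (\<lambda>x. frechet_derivative f (at x within V) h)"
proof (rule smooth_onI)
  fix x assume x: "x \<in> S"
  obtain U F where U: "open U" "x \<in> U" "\<And>k. Ck_on k U F" "\<And>y. y \<in> U \<Longrightarrow> y \<in> S \<Longrightarrow> F y = f y"
    by (rule smooth_onE[OF assms(2) x]) (rule that)
  have "frechet_derivative F (at y) h = frechet_derivative f (at y within V) h" if y: "y \<in> U" "y \<in> S" for y
  proof -
    have "(F has_derivative frechet_derivative F (at y)) (at y within V)"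
      using Ck_on_SucE[OF U(3) y(1)] by (rule has_derivative_at_withinI)
    moreover have "openin (top_of_set V) (S \<inter> U)"
      using assms(3) U(1) by (rule openin_Int_open)
    ultimately have "(f has_derivative frechet_derivative F (at y)) (at y within V)"
      using y U(4) by (intro has_derivative_within_openin_cong[of V "S \<inter> U" y F f]) simp_all
    then show ?thesis
      using frechet_derivative_subspace[OF assms(1) _ assms(4)] y(2) openin_imp_subset[OF assms(3)] by fastforce
  qed
  moreover have "Ck_on k U (\<lambda>y. frechet_derivative F (at y) h)" for k
    using U(3)[of "Suc k"] by simp
  ultimately show "\<exists>U G. open U \<and> x \<in> U \<and> (\<forall>k. Ck_on k U G) \<and>
      (\<forall>y\<in>U \<inter> S. G y = frechet_derivative f (at y within V) h)"
    using U(1,2) by (intro exI[of _ U] exI[of _ "\<lambda>y. frechet_derivative F (at y) h"]) simp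
qed

section \<open>Straightening a function by a local diffeomorphism\<close>

text \<open>The map \<open>q \<mapsto> q - (q \<bullet> e0) e + \<Phi> q e0\<close> trades the coordinate \<open>q \<bullet> e0\<close> for the value of \<open>\<Phi>\<close>: by
  the normalisation of \<open>e\<close> and \<open>e0\<close> its inner product with \<open>e0\<close> is \<open>\<Phi> q\<close>. Its derivative is invertible as soon as \<open>\<Phi>\<close> has a nonzero derivative
  in the direction \<open>e\<close>, and the inverse is given by an explicit formula in the partial derivatives of
  \<open>\<Phi>\<close>. The inverse function theorem supplies a \<open>C\<^sup>1\<close> local inverse, whose derivative is this formula evaluated
  at the inverse; so the inverse is of class \<open>C\<^bsup>k+1\<^esup>\<close> if it is of class \<open>C\<^sup>k\<close>.\<close>

lemma straightening_local_diffeo: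
  fixes \<Phi> :: "'e::euclidean_space \<Rightarrow> real"
  defines "F \<equiv> \<lambda>e e0 q. q - (q \<bullet> e0) *\<^sub>R e + \<Phi> q *\<^sub>R e0"
  assumes U: "open U" "\<And>k. Ck_on k U \<Phi>" "p \<in> U"
    and e: "e \<bullet> e0 = 1" "e0 \<bullet> e0 = 1" and trans: "frechet_derivative \<Phi> (at p) e \<noteq> 0"
  obtains U' W G where "open U'" "p \<in> U'" "U' \<subseteq> U" "open W" "homeomorphism U' W (F e e0) G"
    "\<And>k. Ck_on k W G" "\<And>k. Ck_on k U' (F e e0)"
proof -
  define D where "D q = frechet_derivative \<Phi> (at q)" for q
  have D: "(\<Phi> has_derivative D q) (at q)" if "q \<in> U" for q
    unfolding D_def using U(2) that by (rule Ck_on_SucE)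
  have D_lin: "linear (D q)" if "q \<in> U" for q
    using D[OF that] by (rule has_derivative_linear)
  have D_Ck: "Ck_on k U (\<lambda>q. D q h)" for k h
    unfolding D_def using U(2)[of "Suc k"] by simp
  \<comment> \<open>The derivative has to be invertible at all points of the domain and not only at \<open>p\<close>.\<close>
  define U1 where "U1 = U \<inter> (\<lambda>q. D q e) -` (- {0})"
  have "open U1" unfolding U1_def
    using D_Ck[of 0 e] by (intro continuous_open_preimage U(1)) auto
  have U1: "q \<in> U" "D q e \<noteq> 0" if "q \<in> U1" for q using that by (auto simp: U1_def)
  have "p \<in> U1" using U(3) trans by (simp add: U1_def D_def)
  define F' where "F' q h = h - (h \<bullet> e0) *\<^sub>R e + D q h *\<^sub>R e0" for q h
  have F': "(F e e0 has_derivative F' q) (at q)" if "q \<in> U" for q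
    unfolding F_def F'_def using D[OF that]
    by (auto intro!: derivative_eq_intros)
  then have bl: "bounded_linear (F' q)" if "q \<in> U" for q
    using that has_derivative_bounded_linear by blast
  \<comment> \<open>Solve \<open>F' q h = k\<close> with \<open>h = w + a e\<close> and \<open>w\<close> orthogonal to \<open>e0\<close>: the component of \<open>k\<close> orthogonal to
    \<open>e0\<close> is \<open>w\<close>, and the component along \<open>e0\<close> is \<open>D q w + a D q e\<close>.\<close>
  define I where "I q k = (k - (k \<bullet> e0) *\<^sub>R e0)
      + (((k \<bullet> e0) - D q (k - (k \<bullet> e0) *\<^sub>R e0)) * inverse (D q e)) *\<^sub>R e" for q k
  have IF: "I q (F' q h) = h" if "q \<in> U1" for q h
  proof -
    note lin = D_lin[OF U1(1)[OF that]]
    have "F' q h \<bullet> e0 = D q h" by (simp add: F'_def inner_add_left inner_diff_left e)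
    moreover have "F' q h - D q h *\<^sub>R e0 = h - (h \<bullet> e0) *\<^sub>R e" by (simp add: F'_def)
    ultimately show ?thesis
      using U1(2)[OF that] by (simp add: I_def linear_diff[OF lin] linear_scale[OF lin])
  qed
  have FI: "F' q (I q k) = k" if "q \<in> U1" for q k
  proof -
    note lin = D_lin[OF U1(1)[OF that]]
    define w where "w = k - (k \<bullet> e0) *\<^sub>R e0"
    define a where "a = ((k \<bullet> e0) - D q w) * inverse (D q e)"
    have I: "I q k = w + a *\<^sub>R e" by (simp add: I_def w_def a_def)
    have "w \<bullet> e0 = 0" by (simp add: w_def inner_diff_left e)
    then have "I q k \<bullet> e0 = a" by (simp add: I inner_add_left e)
    moreover have "D q (I q k) = k \<bullet> e0"
      using U1(2)[OF that] by (simp add: I linear_add[OF lin] linear_scale[OF lin] a_def mult.assoc)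
    ultimately show ?thesis by (simp add: F'_def I w_def)
  qed
  have bI: "bounded_linear (I q)" if "q \<in> U1" for q
  proof -
    note lin = D_lin[OF U1(1)[OF that]]
    have "linear (I q)"
      by (rule linearI) (simp_all add: I_def linear_add[OF lin] linear_diff[OF lin] linear_scale[OF lin]
          inner_add_left algebra_simps)
    then show ?thesis by (simp add: linear_conv_bounded_linear)
  qed
  have ap: "blinfun_apply (Blinfun (F' q)) = F' q" if "q \<in> U1" for q
    using bl[OF U1(1)[OF that]] by (rule bounded_linear_Blinfun_apply)
  have "continuous_on U1 (\<lambda>q. Blinfun (F' q))"
  proof (rule continuous_on_blinfun_componentwise)
    fix i :: 'e
    have "continuous_on U1 (\<lambda>q. D q i)"
      using continuous_on_subset[of U "\<lambda>q. D q i" U1] D_Ck[of 0 i] U1(1) by auto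
    then have "continuous_on U1 (\<lambda>q. F' q i)" unfolding F'_def
      by (intro continuous_intros)
    then show "continuous_on U1 (\<lambda>q. blinfun_apply (Blinfun (F' q)) i)"
      by (rule continuous_on_eq) (simp add: ap)
  qed
  moreover have "(F e e0 has_derivative blinfun_apply (Blinfun (F' q))) (at q)" if "q \<in> U1" for q
    using F' U1(1) that by (simp add: ap)
  moreover have "Blinfun (I p) o\<^sub>L Blinfun (F' p) = id_blinfun"
    by (rule blinfun_eqI) (simp add: ap \<open>p \<in> U1\<close> bounded_linear_Blinfun_apply bI IF)
  ultimately obtain U' W G G' where G: "open U'" "U' \<subseteq> U1" "p \<in> U'" "open W" "F e e0 p \<in> W"
      "homeomorphism U' W (F e e0) G" "\<And>y. y \<in> W \<Longrightarrow> (G has_derivative (G' y)) (at y)"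
      "\<And>y. y \<in> W \<Longrightarrow> G' y = inv (blinfun_apply (Blinfun (F' (G y))))"
    using inverse_function_theorem[OF \<open>open U1\<close> _ _ \<open>p \<in> U1\<close>, of "F e e0" "\<lambda>q. Blinfun (F' q)" "Blinfun (I p)"]
    by metis
  have GW: "G ` W \<subseteq> U'" using G(6) by (auto simp: homeomorphism_def)
  have "G' y = I (G y)" if "y \<in> W" for y
  proof -
    have y: "G y \<in> U1" using GW G(2) that by auto
    have "inv (F' (G y)) = I (G y)"
      using IF[OF y] FI[OF y] by (intro inv_equality)
    then show ?thesis using G(8)[OF that] ap[OF y] by simp
  qed
  then have GI: "(G has_derivative I (G y)) (at y)" if "y \<in> W" for y
    using G(7)[OF that] that by simp
  have "Ck_on k W G" for k
  proof (induction k)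
    case 0
    show ?case using G(6) by (simp add: homeomorphism_def)
  next
    case (Suc k)
    \<comment> \<open>The derivative of the inverse is \<open>I (G y)\<close>, which involves \<open>G\<close> itself but none of its derivatives.\<close>
    have DG: "Ck_on k W (\<lambda>y. D (G y) h)" for h
      using Ck_on_compose[OF G(4) U(1) _ Suc D_Ck[of k h]] GW G(2) U1(1) by (force simp: o_def)
    have "D (G y) e \<noteq> 0" if "y \<in> W" for y
      using U1(2)[of "G y"] GW G(2) that by auto
    then have "Ck_on k W (inverse \<circ> (\<lambda>y. D (G y) e))"
      by (intro Ck_on_compose[OF G(4) _ _ DG Ck_on_inverse]) auto
    then have "Ck_on k W (\<lambda>y. inverse (D (G y) e))" by (simp add: o_def)
    moreover have "Ck_on k W (\<lambda>y. k' + - 1 * D (G y) h)" for k' h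
      by (intro Ck_on_add Ck_on_mult Ck_on_const DG G(4))
    ultimately have DI: "Ck_on k W (\<lambda>y. I (G y) h)" for h
      unfolding I_def by (intro Ck_on_add Ck_on_mult Ck_on_scaleR Ck_on_const G(4)) simp_all
    show ?case using G(4) GI DI by (rule Ck_on_SucI)
  qed
  moreover have "Ck_on k U' (F e e0)" for k
  proof -
    have "Ck_on k U (\<lambda>q. (q + - 1 *\<^sub>R (q \<bullet> e0) *\<^sub>R e) + \<Phi> q *\<^sub>R e0)"
      by (intro Ck_on_add Ck_on_scaleR Ck_on_const U(2) Ck_on_bounded_linear[OF _ bounded_linear_inner_left]
          Ck_on_bounded_linear[OF _ bounded_linear_ident] U(1))
    then have "Ck_on k U (F e e0)" by (simp add: F_def)
    moreover have "U' \<subseteq> U" using G(2) by (auto simp: U1_def)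
    ultimately show ?thesis by (rule Ck_on_subset)
  qed
  moreover have "U' \<subseteq> U" using G(2) by (auto simp: U1_def)
  ultimately show thesis using that[OF G(1,3) _ G(4,6)] by blast
qed

section \<open>Composition within subspaces\<close>

lemma at_within_openin:
  assumes "openin (top_of_set V) S" "p \<in> S"
  shows "at p within S = at p within V"
proof -
  obtain W where "open W" "S = V \<inter> W" using assms(1) by (auto simp: openin_open)
  then show ?thesis using assms(2) by (intro at_within_nhd[of p W]) auto
qed

text \<open>Only a relatively open neighbourhood of \<open>p\<close> has to be mapped into \<open>V'\<close>: coordinate expressions
  take arbitrary values outside the image of the chart.\<close>

lemma has_derivative_compose_openin:
  assumes "(f has_derivative D) (at p within V)" "(g has_derivative E) (at (f p) within V')"
    and "openin (top_of_set V) S" "p \<in> S" "f ` S \<subseteq> V'"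
  shows "((\<lambda>x. g (f x)) has_derivative (\<lambda>h. E (D h))) (at p within V)"
proof -
  note eq = at_within_openin[OF assms(3,4)]
  have "(f has_derivative D) (at p within S)" using assms(1) by (simp add: eq)
  moreover have "(g has_derivative E) (at (f p) within f ` S)"
    using assms(2,5) by (rule has_derivative_subset)
  ultimately have "((\<lambda>x. g (f x)) has_derivative (\<lambda>h. E (D h))) (at p within S)"
    by (rule has_derivative_in_compose)
  then show ?thesis by (simp add: eq)
qed

text \<open>Inner products with vectors normal to \<open>V'\<close> vanish along \<open>f\<close>, hence so do their derivatives, and a
  subspace is the set of vectors orthogonal to its normals.\<close>

lemma has_derivative_range_subspace:
  fixes f :: "'e::euclidean_space \<Rightarrow> 'f::euclidean_space"
  assumes D: "(f has_derivative D) (at p within V)" and V: "subspace V" "h \<in> V"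
    and S: "openin (top_of_set V) S" "p \<in> S" "f ` S \<subseteq> V'" and V': "subspace V'"
  shows "D h \<in> V'"
proof -
  have "b \<bullet> D h = 0" if b: "b \<in> V'\<^sup>\<bottom>" for b
  proof -
    have 1: "((\<lambda>x. b \<bullet> f x) has_derivative (\<lambda>h. b \<bullet> D h)) (at p within V)"
      using D by (intro derivative_intros)
    have "0 = b \<bullet> f x" if "x \<in> S" for x
    proof -
      have "f x \<in> V'" using S(3) that by auto
      then show ?thesis using b by (simp add: orthogonal_comp_def orthogonal_def inner_commute[of b])
    qed
    then have 2: "((\<lambda>x. b \<bullet> f x) has_derivative (\<lambda>h. 0)) (at p within V)"
      by (rule has_derivative_within_openin_cong[OF S(1,2)]) (assumption, rule has_derivative_const)
    have "p \<in> V" using S openin_imp_subset by blast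
    from has_derivative_subspace_unique[OF V(1) this V(2) 1 2] show ?thesis .
  qed
  then have "D h \<in> V'\<^sup>\<bottom>\<^sup>\<bottom>"
    unfolding orthogonal_comp_def[of "V'\<^sup>\<bottom>"] orthogonal_def by blast
  then show ?thesis using orthogonal_comp_self[OF V'] by simp
qed

section \<open>Charts\<close>

lemma is_chartD:
  assumes "is_chart T V c"
  shows "openin T (fst c)" "openin (top_of_set V) (snd c ` fst c)" "inj_on (snd c) (fst c)"
    "snd c ` fst c \<subseteq> V" "fst c \<subseteq> topspace T"
proof -
  show 1: "openin T (fst c)" and 2: "openin (top_of_set V) (snd c ` fst c)"
    using assms by (auto simp: is_chart_def)
  show 3: "fst c \<subseteq> topspace T" using 1 openin_subset by auto
  show "snd c ` fst c \<subseteq> V" using 2 openin_imp_subset by blast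
  have "topspace (subtopology T (fst c)) = fst c" using 3 by auto
  then show "inj_on (snd c) (fst c)"
    using assms homeomorphic_imp_injective_map unfolding is_chart_def by metis
qed

lemma is_chart_openin_image:
  assumes "is_chart T V c" "openin T A" "A \<subseteq> fst c"
  shows "openin (top_of_set V) (snd c ` A)"
proof -
  have "open_map (subtopology T (fst c)) (top_of_set (snd c ` fst c)) (snd c)"
    using assms(1) homeomorphic_imp_open_map unfolding is_chart_def by blast
  moreover have "openin (subtopology T (fst c)) A"
    using assms(2,3) by (auto simp: openin_subtopology)
  ultimately have "openin (top_of_set (snd c ` fst c)) (snd c ` A)"
    unfolding open_map_def by blast
  then show ?thesis using is_chartD(2)[OF assms(1)] openin_trans by blast
qed

lemma is_chart_openin_preimage:
  assumes "is_chart T V c" "openin (top_of_set V) B"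
  shows "openin T {x \<in> fst c. snd c x \<in> B}"
proof -
  have "continuous_map (subtopology T (fst c)) (top_of_set (snd c ` fst c)) (snd c)"
    using assms(1) homeomorphic_imp_continuous_map unfolding is_chart_def by blast
  moreover have "openin (top_of_set (snd c ` fst c)) (snd c ` fst c \<inter> B)"
    using assms(2) is_chartD(4)[OF assms(1)] by (auto simp: openin_open)
  ultimately have "openin (subtopology T (fst c)) {x \<in> topspace (subtopology T (fst c)). snd c x \<in> snd c ` fst c \<inter> B}"
    by (rule openin_continuous_map_preimage)
  moreover have "{x \<in> topspace (subtopology T (fst c)). snd c x \<in> snd c ` fst c \<inter> B} = {x \<in> fst c. snd c x \<in> B}"
    using is_chartD(5)[OF assms(1)] by auto
  ultimately show ?thesis
    using is_chartD(1)[OF assms(1)] by (metis openin_trans_full)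
qed

lemma atlas_admissible: "smooth_manifold M \<Longrightarrow> c \<in> atlas M \<Longrightarrow> admissible_chart M c"
  by (auto simp: smooth_manifold_def admissible_chart_def)

lemma admissible_is_chart: "admissible_chart M c \<Longrightarrow> is_chart (mtop M) (model M) c"
  by (simp add: admissible_chart_def)

lemma subspace_model: "smooth_manifold M \<Longrightarrow> subspace (model M)"
  by (simp add: smooth_manifold_def)

lemma chart_inv_chart:
  assumes "admissible_chart M c" "x \<in> fst c"
  shows "chart_inv c (snd c x) = x"
  using is_chartD(3)[OF admissible_is_chart[OF assms(1)]] assms(2) by (rule inv_into_f_f)

lemma exists_chart:
  assumes "smooth_manifold M" "x \<in> points M"
  obtains c where "c \<in> atlas M" "admissible_chart M c" "x \<in> fst c"
proof -
  have "x \<in> (\<Union>c\<in>atlas M. fst c)" using assms unfolding smooth_manifold_def by blast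
  then show thesis using that atlas_admissible[OF assms(1)] by blast
qed

lemma chart_at:
  assumes "smooth_manifold M" "x \<in> points M"
  shows "chart_at M x \<in> charts_at M x" "admissible_chart M (chart_at M x)" "x \<in> fst (chart_at M x)"
proof -
  have "\<exists>c. c \<in> charts_at M x" using exists_chart[OF assms] unfolding charts_at_def by blast
  then show 1: "chart_at M x \<in> charts_at M x" unfolding chart_at_def by (rule someI_ex)
  then show "admissible_chart M (chart_at M x)" "x \<in> fst (chart_at M x)"
    using atlas_admissible[OF assms(1)] by (auto simp: charts_at_def)
qed

lemma charts_at_admissible:
  assumes "smooth_manifold M" "c \<in> charts_at M x"
  shows "admissible_chart M c" "x \<in> fst c"
  using assms(2) atlas_admissible[OF assms(1)] by (auto simp: charts_at_def)

lemma admissible_points: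
  assumes "admissible_chart M c" "x \<in> fst c"
  shows "x \<in> points M"
  using is_chartD(5)[OF admissible_is_chart[OF assms(1)]] assms(2) by auto

text \<open>Two charts compatible with the atlas are compatible with each other, since near a point the
  transition map factors through a chart of the atlas around this point.\<close>

lemma admissible_compatible:
  assumes M: "smooth_manifold M" and c: "admissible_chart M c" and d: "admissible_chart M d"
  shows "smooth_on (snd c ` (fst c \<inter> fst d)) (snd d \<circ> chart_inv c)"
proof (rule smooth_on_local)
  let ?S = "snd c ` (fst c \<inter> fst d)"
  note cc = admissible_is_chart[OF c] and dc = admissible_is_chart[OF d]
  fix p assume "p \<in> ?S"
  then obtain x where x: "x \<in> fst c" "x \<in> fst d" "p = snd c x" by auto
  obtain e where e: "e \<in> atlas M" "admissible_chart M e" "x \<in> fst e"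
    using exists_chart[OF M admissible_points[OF c x(1)]] by blast
  define A where "A = fst c \<inter> fst d \<inter> fst e"
  have "openin (mtop M) A" unfolding A_def
    by (intro openin_Int is_chartD(1)[OF cc] is_chartD(1)[OF dc] is_chartD(1)[OF admissible_is_chart[OF e(2)]])
  then have "openin (top_of_set (model M)) (snd c ` A)"
    by (rule is_chart_openin_image[OF cc]) (auto simp: A_def)
  then have "openin (top_of_set ?S) (snd c ` A)"
    by (rule openin_subset_trans) (use is_chartD(4)[OF cc] in \<open>auto simp: A_def\<close>)
  moreover have "p \<in> snd c ` A" using x e by (auto simp: A_def)
  moreover have "smooth_on (snd c ` A) (snd d \<circ> chart_inv c)"
  proof (rule smooth_on_cong)
    have "smooth_on (snd c ` A) (snd e \<circ> chart_inv c)"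
      using c e(1) by (auto simp: admissible_chart_def compatible_def A_def elim!: smooth_on_subset)
    moreover have "smooth_on (snd e ` (fst d \<inter> fst e)) (snd d \<circ> chart_inv e)"
      using d e(1) by (auto simp: admissible_chart_def compatible_def)
    moreover have "(snd e \<circ> chart_inv c) ` snd c ` A \<subseteq> snd e ` (fst d \<inter> fst e)"
      by (auto simp: A_def chart_inv_chart[OF c])
    ultimately show "smooth_on (snd c ` A) ((snd d \<circ> chart_inv e) \<circ> (snd e \<circ> chart_inv c))"
      by (rule smooth_on_compose)
  qed (auto simp: A_def chart_inv_chart[OF c] chart_inv_chart[OF e(2)])
  ultimately show "\<exists>T. openin (top_of_set ?S) T \<and> p \<in> T \<and> smooth_on T (snd d \<circ> chart_inv c)" by blast
qed

section \<open>Germs of smooth functions\<close>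

text \<open>Requiring all admissible charts at once makes the notion manifestly independent of charts; the
  open set serves all of them.\<close>

definition smooth_near ::
  "('a, 'e::euclidean_space) mfd \<Rightarrow> ('a \<Rightarrow> 'f::euclidean_space) \<Rightarrow> 'a \<Rightarrow> bool" where
  "smooth_near M h x \<longleftrightarrow> (\<exists>A. openin (mtop M) A \<and> x \<in> A \<and>
     (\<forall>c. admissible_chart M c \<longrightarrow> smooth_on (snd c ` (fst c \<inter> A)) (h \<circ> chart_inv c)))"

text \<open>By compatibility one chart decides about smoothness in all of them.\<close>

lemma smooth_nearI:
  assumes M: "smooth_manifold M" and c: "admissible_chart M c"
    and A: "openin (mtop M) A" "x \<in> A" "A \<subseteq> fst c" and h: "smooth_on (snd c ` A) (h \<circ> chart_inv c)"
  shows "smooth_near M h x"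
  unfolding smooth_near_def
proof (intro exI conjI allI impI)
  fix d assume d: "admissible_chart M d"
  show "smooth_on (snd d ` (fst d \<inter> A)) (h \<circ> chart_inv d)"
  proof (rule smooth_on_cong)
    have "smooth_on (snd d ` (fst d \<inter> A)) (snd c \<circ> chart_inv d)"
      by (rule smooth_on_subset[OF admissible_compatible[OF M d c]]) (use A in auto)
    moreover note h
    moreover have "(snd c \<circ> chart_inv d) ` snd d ` (fst d \<inter> A) \<subseteq> snd c ` A"
      by (auto simp: chart_inv_chart[OF d])
    ultimately show "smooth_on (snd d ` (fst d \<inter> A)) ((h \<circ> chart_inv c) \<circ> (snd c \<circ> chart_inv d))"
      by (rule smooth_on_compose)
  qed (use A(3) in \<open>auto simp: chart_inv_chart[OF d] chart_inv_chart[OF c]\<close>)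
qed (use A in auto)

lemma smooth_nearE:
  assumes "smooth_near M h x" "admissible_chart M c" "x \<in> fst c"
  obtains A where "openin (mtop M) A" "x \<in> A" "A \<subseteq> fst c" "smooth_on (snd c ` A) (h \<circ> chart_inv c)"
    "openin (top_of_set (model M)) (snd c ` A)"
proof -
  obtain A where A: "openin (mtop M) A" "x \<in> A" "smooth_on (snd c ` (fst c \<inter> A)) (h \<circ> chart_inv c)"
    using assms(1,2) unfolding smooth_near_def by blast
  note ic = admissible_is_chart[OF assms(2)]
  have o: "openin (mtop M) (fst c \<inter> A)"
    by (intro openin_Int is_chartD(1)[OF ic] A(1))
  show thesis
    by (rule that[OF o _ _ A(3) is_chart_openin_image[OF ic o]]) (use A(2) assms(3) in auto)
qed

lemma smooth_near_chart:
  assumes "smooth_manifold M" "admissible_chart M c" "x \<in> fst c"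
  shows "smooth_near M (snd c) x"
proof (rule smooth_nearI[OF assms(1,2) _ assms(3) order_refl])
  show "openin (mtop M) (fst c)" by (intro is_chartD(1)[OF admissible_is_chart[OF assms(2)]])
  show "smooth_on (snd c ` fst c) (snd c \<circ> chart_inv c)"
    by (rule smooth_on_cong[OF smooth_on_ident]) (auto simp: chart_inv_chart[OF assms(2)])
qed

lemma smooth_near_cong:
  assumes "smooth_near M h x" "\<And>y. y \<in> points M \<Longrightarrow> h y = h' y"
  shows "smooth_near M h' x"
proof -
  obtain A where A: "openin (mtop M) A" "x \<in> A"
    "\<And>c. admissible_chart M c \<Longrightarrow> smooth_on (snd c ` (fst c \<inter> A)) (h \<circ> chart_inv c)"
    using assms(1) unfolding smooth_near_def by blast
  have "smooth_on (snd c ` (fst c \<inter> A)) (h' \<circ> chart_inv c)" if "admissible_chart M c" for c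
    by (rule smooth_on_cong[OF A(3)[OF that]])
      (use assms(2) admissible_points[OF that] in \<open>auto simp: chart_inv_chart[OF that]\<close>)
  then show ?thesis using A(1,2) unfolding smooth_near_def by blast
qed

lemma smooth_near_compose:
  assumes "smooth_near M h x" "smooth_on S \<phi>" "\<And>y. y \<in> points M \<Longrightarrow> h y \<in> S"
  shows "smooth_near M (\<lambda>y. \<phi> (h y)) x"
proof -
  obtain A where A: "openin (mtop M) A" "x \<in> A"
    "\<And>c. admissible_chart M c \<Longrightarrow> smooth_on (snd c ` (fst c \<inter> A)) (h \<circ> chart_inv c)"
    using assms(1) unfolding smooth_near_def by blast
  have "smooth_on (snd c ` (fst c \<inter> A)) ((\<lambda>y. \<phi> (h y)) \<circ> chart_inv c)" if c: "admissible_chart M c" for c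
  proof -
    have "(h \<circ> chart_inv c) ` snd c ` (fst c \<inter> A) \<subseteq> S"
      using assms(3) admissible_points[OF c] by (auto simp: chart_inv_chart[OF c])
    from smooth_on_compose[OF A(3)[OF c] assms(2) this] show ?thesis by (simp add: o_def)
  qed
  then show ?thesis using A(1,2) unfolding smooth_near_def by blast
qed

lemma smooth_near_Pair:
  assumes "smooth_near M h x" "smooth_near M k x"
  shows "smooth_near M (\<lambda>y. (h y, k y)) x"
proof -
  obtain A where A: "openin (mtop M) A" "x \<in> A"
    "\<And>c. admissible_chart M c \<Longrightarrow> smooth_on (snd c ` (fst c \<inter> A)) (h \<circ> chart_inv c)"
    using assms(1) unfolding smooth_near_def by blast
  obtain B where B: "openin (mtop M) B" "x \<in> B"
    "\<And>c. admissible_chart M c \<Longrightarrow> smooth_on (snd c ` (fst c \<inter> B)) (k \<circ> chart_inv c)"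
    using assms(2) unfolding smooth_near_def by blast
  have "smooth_on (snd c ` (fst c \<inter> (A \<inter> B))) ((\<lambda>y. (h y, k y)) \<circ> chart_inv c)" if "admissible_chart M c" for c
  proof -
    have "snd c ` (fst c \<inter> (A \<inter> B)) \<subseteq> snd c ` (fst c \<inter> A)" "snd c ` (fst c \<inter> (A \<inter> B)) \<subseteq> snd c ` (fst c \<inter> B)"
      by auto
    then show ?thesis
      using smooth_on_Pair[OF smooth_on_subset[OF A(3)[OF that]] smooth_on_subset[OF B(3)[OF that]]]
      by (simp add: o_def)
  qed
  then show ?thesis
    unfolding smooth_near_def
    by (intro exI[of _ "A \<inter> B"] conjI allI impI) (simp_all add: A(1,2) B(1,2) openin_Int)
qed

section \<open>Smooth maps\<close>

lemma continuous_map_points: "continuous_map (mtop M) (mtop N) F \<Longrightarrow> x \<in> points M \<Longrightarrow> F x \<in> points N"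
  by (auto simp: continuous_map_def)

lemma smooth_map_points: "smooth_map M N F \<Longrightarrow> x \<in> points M \<Longrightarrow> F x \<in> points N"
  by (auto simp: smooth_map_def intro: continuous_map_points)

text \<open>In charts of the two atlases the composite is the coordinate expression of \<open>h\<close> after that of
  \<open>F\<close>. Continuity of \<open>F\<close> provides an open set on which both are defined.\<close>

lemma smooth_map_smooth_near:
  assumes M: "smooth_manifold M" and N: "smooth_manifold N" and F: "smooth_map M N F"
    and x: "x \<in> points M" and h: "smooth_near N h (F x)"
  shows "smooth_near M (h \<circ> F) x"
proof -
  obtain c where c: "c \<in> atlas M" "admissible_chart M c" "x \<in> fst c" using exists_chart[OF M x] .
  obtain d where d: "d \<in> atlas N" "admissible_chart N d" "F x \<in> fst d"
    using exists_chart[OF N smooth_map_points[OF F x]] .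
  obtain B where B: "openin (mtop N) B" "F x \<in> B" "B \<subseteq> fst d" "smooth_on (snd d ` B) (h \<circ> chart_inv d)"
    using smooth_nearE[OF h d(2,3)] .
  define A where "A = fst c \<inter> {y \<in> points M. F y \<in> B}"
  have F': "continuous_map (mtop M) (mtop N) F"
    "smooth_on (snd c ` (fst c \<inter> F -` fst d)) (snd d \<circ> F \<circ> chart_inv c)"
    using F c(1) d(1) by (auto simp: smooth_map_def)
  have "openin (mtop M) A" unfolding A_def
    by (intro openin_Int is_chartD(1)[OF admissible_is_chart[OF c(2)]]
        openin_continuous_map_preimage[OF F'(1)] B(1))
  moreover have "x \<in> A" using c x B by (simp add: A_def)
  moreover have "A \<subseteq> fst c" by (auto simp: A_def)
  moreover have "smooth_on (snd c ` A) (h \<circ> F \<circ> chart_inv c)"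
  proof (rule smooth_on_cong)
    have "smooth_on (snd c ` A) (snd d \<circ> F \<circ> chart_inv c)"
      using F'(2) by (rule smooth_on_subset) (use B(3) in \<open>auto simp: A_def\<close>)
    moreover note B(4)
    moreover have "(snd d \<circ> F \<circ> chart_inv c) ` snd c ` A \<subseteq> snd d ` B"
      by (auto simp: A_def chart_inv_chart[OF c(2)])
    ultimately show "smooth_on (snd c ` A) ((h \<circ> chart_inv d) \<circ> (snd d \<circ> F \<circ> chart_inv c))"
      by (rule smooth_on_compose)
  next
    fix p assume "p \<in> snd c ` A"
    then obtain y where y: "y \<in> fst c" "F y \<in> fst d" "p = snd c y" using B(3) by (auto simp: A_def)
    then show "(h \<circ> F \<circ> chart_inv c) p = (h \<circ> chart_inv d \<circ> (snd d \<circ> F \<circ> chart_inv c)) p"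
      by (simp add: chart_inv_chart[OF c(2)] chart_inv_chart[OF d(2)])
  qed
  ultimately show ?thesis by (rule smooth_nearI[OF M c(2)])
qed

text \<open>Smoothness in one chart of the target for each point implies it for all pairs of charts of the
  atlases, by composing with transition maps of the target.\<close>

lemma smooth_mapI:
  assumes M: "smooth_manifold M" and N: "smooth_manifold N"
    and F: "continuous_map (mtop M) (mtop N) F"
    and d: "\<And>x. x \<in> points M \<Longrightarrow> \<exists>d. admissible_chart N d \<and> F x \<in> fst d \<and> smooth_near M (snd d \<circ> F) x"
  shows "smooth_map M N F"
  unfolding smooth_map_def
proof (intro conjI ballI F)
  fix c d assume "c \<in> atlas M" "d \<in> atlas N"
  then have c: "admissible_chart M c" and d: "admissible_chart N d"
    using atlas_admissible M N by blast+
  note cc = admissible_is_chart[OF c]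
  let ?S = "snd c ` (fst c \<inter> F -` fst d)"
  show "smooth_on ?S (snd d \<circ> F \<circ> chart_inv c)"
  proof (rule smooth_on_local)
    fix p assume "p \<in> ?S"
    then obtain x where x: "x \<in> fst c" "F x \<in> fst d" "p = snd c x" by auto
    obtain e where e: "admissible_chart N e" "F x \<in> fst e" "smooth_near M (snd e \<circ> F) x"
      using assms(4)[OF admissible_points[OF c x(1)]] by blast
    obtain A where A: "openin (mtop M) A" "x \<in> A" "A \<subseteq> fst c" "smooth_on (snd c ` A) (snd e \<circ> F \<circ> chart_inv c)"
      using smooth_nearE[OF e(3) c x(1)] .
    define B where "B = A \<inter> {y \<in> points M. F y \<in> fst d \<inter> fst e}"
    have "openin (mtop M) B" unfolding B_def
      by (intro openin_Int A(1) openin_continuous_map_preimage[OF F]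
          is_chartD(1)[OF admissible_is_chart[OF d]] is_chartD(1)[OF admissible_is_chart[OF e(1)]])
    then have "openin (top_of_set (model M)) (snd c ` B)"
      by (rule is_chart_openin_image[OF cc]) (use A(3) in \<open>auto simp: B_def\<close>)
    then have "openin (top_of_set ?S) (snd c ` B)"
      by (rule openin_subset_trans) (use A(3) is_chartD(4)[OF cc] in \<open>auto simp: B_def\<close>)
    moreover have "p \<in> snd c ` B" using x e A(2) admissible_points[OF c x(1)] by (auto simp: B_def)
    moreover have "smooth_on (snd c ` B) (snd d \<circ> F \<circ> chart_inv c)"
    proof (rule smooth_on_cong)
      have "smooth_on (snd c ` B) (snd e \<circ> F \<circ> chart_inv c)"
        using A(4) by (rule smooth_on_subset) (auto simp: B_def)
      moreover have "smooth_on (snd e ` (fst e \<inter> fst d)) (snd d \<circ> chart_inv e)"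
        by (rule admissible_compatible[OF N e(1) d])
      moreover have "(snd e \<circ> F \<circ> chart_inv c) ` snd c ` B \<subseteq> snd e ` (fst e \<inter> fst d)"
      proof -
        have "chart_inv c (snd c y) = y" "F y \<in> fst e \<inter> fst d" if "y \<in> B" for y
          using that A(3) chart_inv_chart[OF c, of y] by (auto simp: B_def)
        then show ?thesis by auto
      qed
      ultimately show "smooth_on (snd c ` B) ((snd d \<circ> chart_inv e) \<circ> (snd e \<circ> F \<circ> chart_inv c))"
        by (rule smooth_on_compose)
    next
      fix q assume "q \<in> snd c ` B"
      then obtain y where y: "y \<in> fst c" "F y \<in> fst e" "q = snd c y" using A(3) by (auto simp: B_def)
      then show "(snd d \<circ> F \<circ> chart_inv c) q = (snd d \<circ> chart_inv e \<circ> (snd e \<circ> F \<circ> chart_inv c)) q"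
        by (simp add: chart_inv_chart[OF c] chart_inv_chart[OF e(1)])
    qed
    ultimately show "\<exists>T. openin (top_of_set ?S) T \<and> p \<in> T \<and> smooth_on T (snd d \<circ> F \<circ> chart_inv c)"
      by blast
  qed
qed

lemma smooth_map_compose:
  assumes "smooth_manifold M" "smooth_manifold N" "smooth_manifold P" "smooth_map M N F" "smooth_map N P G"
  shows "smooth_map M P (G \<circ> F)"
proof (rule smooth_mapI[OF assms(1,3)])
  show "continuous_map (mtop M) (mtop P) (G \<circ> F)"
    using assms(4,5) continuous_map_compose by (auto simp: smooth_map_def)
  fix x assume x: "x \<in> points M"
  have Fx: "F x \<in> points N" using smooth_map_points[OF assms(4) x] .
  obtain d where d: "d \<in> atlas P" "admissible_chart P d" "G (F x) \<in> fst d"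
    using exists_chart[OF assms(3) smooth_map_points[OF assms(5) Fx]] .
  have "smooth_near N (snd d \<circ> G) (F x)"
    by (rule smooth_map_smooth_near[OF assms(2,3,5) Fx smooth_near_chart[OF assms(3) d(2,3)]])
  then have "smooth_near M ((snd d \<circ> G) \<circ> F) x"
    by (rule smooth_map_smooth_near[OF assms(1,2,4) x])
  then show "\<exists>d. admissible_chart P d \<and> (G \<circ> F) x \<in> fst d \<and> smooth_near M (snd d \<circ> (G \<circ> F)) x"
    using d by (intro exI[of _ d]) (simp add: comp_assoc)
qed

lemma smooth_map_ident: "smooth_manifold M \<Longrightarrow> smooth_map M M (\<lambda>x. x)"
proof (rule smooth_mapI)
  assume M: "smooth_manifold M"
  fix x assume x: "x \<in> points M"
  obtain d where d: "d \<in> atlas M" "admissible_chart M d" "x \<in> fst d"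
    using exists_chart[OF M x] .
  then show "\<exists>d. admissible_chart M d \<and> x \<in> fst d \<and> smooth_near M (snd d \<circ> (\<lambda>x. x)) x"
    using smooth_near_chart[OF M d(2,3)] by (intro exI[of _ d]) (simp add: o_def)
qed auto

lemma smooth_map_cong:
  assumes "smooth_manifold M" "smooth_manifold N" "smooth_map M N F" "\<And>x. x \<in> points M \<Longrightarrow> F x = G x"
  shows "smooth_map M N G"
proof (rule smooth_mapI[OF assms(1,2)])
  show "continuous_map (mtop M) (mtop N) G"
    using assms(3,4) unfolding smooth_map_def by (metis continuous_map_eq)
  fix x assume x: "x \<in> points M"
  obtain d where d: "d \<in> atlas N" "admissible_chart N d" "F x \<in> fst d"
    using exists_chart[OF assms(2) smooth_map_points[OF assms(3) x]] .
  have "smooth_near M (snd d \<circ> F) x"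
    by (rule smooth_map_smooth_near[OF assms(1-3) x smooth_near_chart[OF assms(2) d(2,3)]])
  then have "smooth_near M (snd d \<circ> G) x"
    by (rule smooth_near_cong) (use assms(4) in auto)
  then show "\<exists>d. admissible_chart N d \<and> G x \<in> fst d \<and> smooth_near M (snd d \<circ> G) x"
    using d assms(4)[OF x] by (intro exI[of _ d]) simp
qed

section \<open>Tangent vectors\<close>

lemma chart_deriv_has_derivative:
  assumes "admissible_chart M c" "x \<in> fst c" "smooth_near M h x"
  shows "((h \<circ> chart_inv c) has_derivative chart_deriv M c x h) (at (snd c x) within model M)"
proof -
  obtain A where A: "openin (mtop M) A" "x \<in> A" "A \<subseteq> fst c" "smooth_on (snd c ` A) (h \<circ> chart_inv c)"
    "openin (top_of_set (model M)) (snd c ` A)"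
    using smooth_nearE[OF assms(3,1,2)] .
  have "(h \<circ> chart_inv c) differentiable (at (snd c x) within model M)"
    using smooth_on_differentiable[OF A(4,5)] A(2) by auto
  moreover have "frechet_derivative (h \<circ> chart_inv c) (at (snd c x) within model M) = chart_deriv M c x h"
    by (simp add: chart_deriv_def fun_eq_iff)
  ultimately show ?thesis by (simp add: frechet_derivative_works)
qed

lemma linear_chart_deriv:
  assumes "admissible_chart M c" "x \<in> fst c" "smooth_near M h x"
  shows "linear (chart_deriv M c x h)"
  using chart_deriv_has_derivative[OF assms] by (rule has_derivative_linear)

lemma chart_image_model:
  assumes "admissible_chart M c" "x \<in> fst c"
  shows "snd c x \<in> model M"
  using is_chartD(4)[OF admissible_is_chart[OF assms(1)]] assms(2) by auto

lemma chart_deriv_unique: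
  assumes "smooth_manifold M" "admissible_chart M c" "x \<in> fst c" "v \<in> model M"
    and "((h \<circ> chart_inv c) has_derivative D) (at (snd c x) within model M)"
  shows "chart_deriv M c x h v = D v"
  unfolding chart_deriv_def
  by (rule frechet_derivative_subspace[OF subspace_model[OF assms(1)] chart_image_model[OF assms(2,3)] assms(4,5)])

text \<open>Near the point the coordinate expression of \<open>h \<circ> F\<close> is that of \<open>h\<close> after that of \<open>F\<close>. For the identity
  map the rule says how derivatives transform under a change of charts.\<close>

lemma chart_deriv_chain:
  assumes M: "smooth_manifold M" and N: "smooth_manifold N" and F: "smooth_map M N F"
    and c: "admissible_chart M c" "x \<in> fst c" and d: "admissible_chart N d" "F x \<in> fst d"
    and v: "v \<in> model M"
  shows "chart_deriv M c x (snd d \<circ> F) v \<in> model N" (is ?th1)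
    and "smooth_near N h (F x) \<Longrightarrow>
      chart_deriv M c x (h \<circ> F) v = chart_deriv N d (F x) h (chart_deriv M c x (snd d \<circ> F) v)"
proof -
  note x = admissible_points[OF c]
  note cc = admissible_is_chart[OF c(1)]
  have near: "smooth_near M (snd d \<circ> F) x"
    by (rule smooth_map_smooth_near[OF M N F x smooth_near_chart[OF N d]])
  define A where "A = fst c \<inter> {y \<in> points M. F y \<in> fst d}"
  have contF: "continuous_map (mtop M) (mtop N) F" using F by (simp add: smooth_map_def)
  have "openin (mtop M) A" unfolding A_def
    by (intro openin_Int is_chartD(1)[OF cc] is_chartD(1)[OF admissible_is_chart[OF d(1)]]
        openin_continuous_map_preimage[OF contF])
  then have oA: "openin (top_of_set (model M)) (snd c ` A)"
    by (rule is_chart_openin_image[OF cc]) (auto simp: A_def)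
  have xA: "snd c x \<in> snd c ` A" using c d x by (auto simp: A_def)
  have im: "((snd d \<circ> F) \<circ> chart_inv c) ` snd c ` A \<subseteq> model N"
    using chart_image_model[OF d(1)] by (auto simp: A_def chart_inv_chart[OF c(1)])
  note D = chart_deriv_has_derivative[OF c near]
  show ?th1
    by (rule has_derivative_range_subspace[OF D subspace_model[OF M] v oA xA im subspace_model[OF N]])
  assume h: "smooth_near N h (F x)"
  have "((h \<circ> chart_inv d) has_derivative chart_deriv N d (F x) h)
      (at (((snd d \<circ> F) \<circ> chart_inv c) (snd c x)) within model N)"
    using chart_deriv_has_derivative[OF d h] by (simp add: chart_inv_chart[OF c])
  from has_derivative_compose_openin[OF D this oA xA im]
  have "((h \<circ> F) \<circ> chart_inv c has_derivative
      (\<lambda>v. chart_deriv N d (F x) h (chart_deriv M c x (snd d \<circ> F) v))) (at (snd c x) within model M)"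
    by (rule has_derivative_within_openin_cong[OF oA xA, rotated])
      (auto simp: A_def chart_inv_chart[OF c(1)] chart_inv_chart[OF d(1)])
  from chart_deriv_unique[OF M c v this]
  show "chart_deriv M c x (h \<circ> F) v = chart_deriv N d (F x) h (chart_deriv M c x (snd d \<circ> F) v)" .
qed

lemma chart_deriv_change:
  assumes "smooth_manifold M" "admissible_chart M c" "x \<in> fst c" "admissible_chart M d" "x \<in> fst d" "v \<in> model M"
  shows "chart_deriv M c x (snd d) v \<in> model M"
    and "smooth_near M h x \<Longrightarrow> chart_deriv M d x h (chart_deriv M c x (snd d) v) = chart_deriv M c x h v"
proof -
  note chain = chart_deriv_chain[OF assms(1,1) smooth_map_ident[OF assms(1)] assms(2-6)]
  show "chart_deriv M c x (snd d) v \<in> model M" using chain(1) by (simp add: o_def)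
  show "chart_deriv M d x h (chart_deriv M c x (snd d) v) = chart_deriv M c x h v" if "smooth_near M h x"
    using chain(2)[OF that] by (simp add: o_def)
qed

lemma chart_deriv_self:
  assumes "smooth_manifold M" "admissible_chart M c" "x \<in> fst c" "v \<in> model M"
  shows "chart_deriv M c x (snd c) v = v"
proof (rule chart_deriv_unique[OF assms])
  show "((snd c \<circ> chart_inv c) has_derivative (\<lambda>v. v)) (at (snd c x) within model M)"
    by (rule has_derivative_within_openin_cong[where f = "\<lambda>p. p"])
      (use is_chartD(2)[OF admissible_is_chart[OF assms(2)]] assms(3) in
        \<open>auto simp: chart_inv_chart[OF assms(2)]\<close>)
qed

text \<open>Functions that agree on the points of the manifold have the same derivatives in charts, and hence
  also the same derivative chosen by \<open>frechet_derivative\<close>, on all vectors.\<close>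

lemma chart_deriv_cong:
  assumes "admissible_chart M c" "x \<in> fst c" "\<And>y. y \<in> points M \<Longrightarrow> h y = h' y"
  shows "chart_deriv M c x h = chart_deriv M c x h'"
proof -
  note oc = is_chartD(2)[OF admissible_is_chart[OF assms(1)]]
  have eq: "(h \<circ> chart_inv c) p = (h' \<circ> chart_inv c) p" if "p \<in> snd c ` fst c" for p
    using that assms(3) admissible_points[OF assms(1)] by (auto simp: chart_inv_chart[OF assms(1)])
  have x: "snd c x \<in> snd c ` fst c" using assms(2) by simp
  have "((h \<circ> chart_inv c) has_derivative D) (at (snd c x) within model M) \<longleftrightarrow>
      ((h' \<circ> chart_inv c) has_derivative D) (at (snd c x) within model M)" for D
    using has_derivative_within_openin_cong[OF oc x, of "h \<circ> chart_inv c" "h' \<circ> chart_inv c" D]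
      has_derivative_within_openin_cong[OF oc x, of "h' \<circ> chart_inv c" "h \<circ> chart_inv c" D] eq by fastforce
  then show ?thesis unfolding chart_deriv_def frechet_derivative_def by simp
qed

text \<open>A common generalisation of the exterior derivative of a function and of the components of the
  differential of a map, so that one chain rule serves both. The chart chosen at the point does not
  matter for functions that are smooth near it.\<close>

definition tderiv :: "('a, 'e::euclidean_space) mfd \<Rightarrow> ('a \<Rightarrow> 'f::euclidean_space) \<Rightarrow> 'a \<Rightarrow> ('a, 'e) tvec \<Rightarrow> 'f" where
  "tderiv M h x \<xi> = chart_deriv M (chart_at M x) x h (\<xi> (chart_at M x))"

lemma ext_d_eq_tderiv: "ext_d M f x \<xi> = tderiv M f x \<xi>"
  by (simp add: ext_d_def tderiv_def)

lemma differential_eq_tderiv: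
  "differential M N F x \<xi> d = (if d \<in> charts_at N (F x) then tderiv M (snd d \<circ> F) x \<xi> else 0)"
  by (simp add: differential_def tderiv_def)

lemma tangent_spaceD:
  assumes "\<xi> \<in> tangent_space M x"
  shows "c \<notin> charts_at M x \<Longrightarrow> \<xi> c = 0" "c \<in> charts_at M x \<Longrightarrow> \<xi> c \<in> model M"
    "c \<in> charts_at M x \<Longrightarrow> d \<in> charts_at M x \<Longrightarrow> \<xi> d = chart_deriv M c x (snd d) (\<xi> c)"
  using assms unfolding tangent_space_def by blast+

lemma tderiv_chart:
  assumes "smooth_manifold M" "x \<in> points M" "\<xi> \<in> tangent_space M x" "c \<in> charts_at M x"
  shows "tderiv M (snd c) x \<xi> = \<xi> c"
  using tangent_spaceD(3)[OF assms(3) chart_at(1)[OF assms(1,2)] assms(4)] by (simp add: tderiv_def)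

lemma tderiv_chart_model:
  assumes "smooth_manifold M" "\<xi> \<in> tangent_space M x" "admissible_chart M c" "x \<in> fst c"
  shows "tderiv M (snd c) x \<xi> \<in> model M"
proof -
  note x = admissible_points[OF assms(3,4)]
  show ?thesis unfolding tderiv_def
    by (rule chart_deriv_change(1)[OF assms(1) chart_at(2,3)[OF assms(1) x] assms(3,4)
          tangent_spaceD(2)[OF assms(2) chart_at(1)[OF assms(1) x]]])
qed

text \<open>The chain rule for the transition map relates the chart chosen at the point to the chart \<open>c\<close>.\<close>

lemma tderiv_in_chart:
  assumes "smooth_manifold M" "\<xi> \<in> tangent_space M x" "admissible_chart M c" "x \<in> fst c" "smooth_near M h x"
  shows "tderiv M h x \<xi> = chart_deriv M c x h (tderiv M (snd c) x \<xi>)"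
proof -
  note x = admissible_points[OF assms(3,4)]
  show ?thesis unfolding tderiv_def
    by (rule chart_deriv_change(2)[OF assms(1) chart_at(2,3)[OF assms(1) x] assms(3,4)
          tangent_spaceD(2)[OF assms(2) chart_at(1)[OF assms(1) x]] assms(5), symmetric])
qed

text \<open>The transformation rule between two charts of the atlas is the chain rule for the transition
  from \<open>c\<close>, which may be any admissible chart.\<close>

lemma coord_tvec_tangent:
  assumes M: "smooth_manifold M" and c: "admissible_chart M c" "x \<in> fst c" and v: "v \<in> model M"
  shows "coord_tvec M c x v \<in> tangent_space M x"
  unfolding tangent_space_def
proof (intro CollectI conjI allI impI ballI)
  fix d assume d: "d \<in> charts_at M x"
  note d' = charts_at_admissible[OF M d]
  show "coord_tvec M c x v d \<in> model M"
    using chart_deriv_change(1)[OF M c d' v] d by (simp add: coord_tvec_def)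
  fix e assume e: "e \<in> charts_at M x"
  note e' = charts_at_admissible[OF M e]
  show "coord_tvec M c x v e = chart_deriv M d x (snd e) (coord_tvec M c x v d)"
    using chart_deriv_change(2)[OF M c d' v smooth_near_chart[OF M e']] d e by (simp add: coord_tvec_def)
qed (simp add: coord_tvec_def)

lemma tderiv_coord_tvec:
  assumes M: "smooth_manifold M" and c: "admissible_chart M c" "x \<in> fst c" and v: "v \<in> model M"
    and h: "smooth_near M h x"
  shows "tderiv M h x (coord_tvec M c x v) = chart_deriv M c x h v"
proof -
  note x = admissible_points[OF c]
  show ?thesis
    using chart_deriv_change(2)[OF M c chart_at(2,3)[OF M x] v h] chart_at(1)[OF M x]
    by (simp add: tderiv_def coord_tvec_def)
qed

text \<open>The transformation rule recovers all components of a tangent vector from its coordinates in a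
  single chart.\<close>

lemma tangent_eqI:
  assumes M: "smooth_manifold M" and c: "admissible_chart M c" "x \<in> fst c"
    and "\<xi> \<in> tangent_space M x" "\<eta> \<in> tangent_space M x" "tderiv M (snd c) x \<xi> = tderiv M (snd c) x \<eta>"
  shows "\<xi> = \<eta>"
proof
  fix d
  note x = admissible_points[OF c]
  show "\<xi> d = \<eta> d"
  proof (cases "d \<in> charts_at M x")
    case True
    note n = smooth_near_chart[OF M charts_at_admissible[OF M True]]
    show ?thesis
      using tderiv_in_chart[OF M assms(4) c n] tderiv_in_chart[OF M assms(5) c n] assms(6)
        tderiv_chart[OF M x assms(4) True] tderiv_chart[OF M x assms(5) True] by simp
  next
    case False
    then show ?thesis using tangent_spaceD(1) assms(4,5) by metis
  qed
qed

lemma coord_tvec_tderiv: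
  assumes "smooth_manifold M" "admissible_chart M c" "x \<in> fst c" "\<xi> \<in> tangent_space M x"
  shows "coord_tvec M c x (tderiv M (snd c) x \<xi>) = \<xi>"
proof (rule tangent_eqI[OF assms(1-3) _ assms(4)])
  note v = tderiv_chart_model[OF assms(1,4,2,3)]
  show "coord_tvec M c x (tderiv M (snd c) x \<xi>) \<in> tangent_space M x"
    by (rule coord_tvec_tangent[OF assms(1-3) v])
  show "tderiv M (snd c) x (coord_tvec M c x (tderiv M (snd c) x \<xi>)) = tderiv M (snd c) x \<xi>"
    using tderiv_coord_tvec[OF assms(1-3) v smooth_near_chart[OF assms(1-3)]]
      chart_deriv_self[OF assms(1-3) v] by simp
qed

lemma tderiv_add:
  assumes "smooth_manifold M" "x \<in> points M" "smooth_near M h x"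
  shows "tderiv M h x (\<lambda>c. \<xi> c + \<eta> c) = tderiv M h x \<xi> + tderiv M h x \<eta>"
  unfolding tderiv_def
  by (rule linear_add[OF linear_chart_deriv[OF chart_at(2,3)[OF assms(1,2)] assms(3)]])

lemma tderiv_scale:
  assumes "smooth_manifold M" "x \<in> points M" "smooth_near M h x"
  shows "tderiv M h x (\<lambda>c. a *\<^sub>R \<xi> c) = a *\<^sub>R tderiv M h x \<xi>"
  unfolding tderiv_def
  by (rule linear_scale[OF linear_chart_deriv[OF chart_at(2,3)[OF assms(1,2)] assms(3)]])

lemma chart_deriv_linear_charts:
  assumes "smooth_manifold M" "c \<in> charts_at M x" "d \<in> charts_at M x"
  shows "linear (chart_deriv M c x (snd d))"
  by (rule linear_chart_deriv[OF charts_at_admissible[OF assms(1,2)]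
        smooth_near_chart[OF assms(1) charts_at_admissible[OF assms(1,3)]]])

lemma tangent_add:
  assumes "smooth_manifold M" "\<xi> \<in> tangent_space M x" "\<eta> \<in> tangent_space M x"
  shows "(\<lambda>c. \<xi> c + \<eta> c) \<in> tangent_space M x"
  unfolding tangent_space_def
proof (intro CollectI conjI allI impI ballI)
  fix c d assume cd: "c \<in> charts_at M x" "d \<in> charts_at M x"
  show "\<xi> d + \<eta> d = chart_deriv M c x (snd d) (\<xi> c + \<eta> c)"
    using tangent_spaceD(3)[OF assms(2) cd] tangent_spaceD(3)[OF assms(3) cd]
      linear_add[OF chart_deriv_linear_charts[OF assms(1) cd]] by simp
qed (simp_all add: tangent_spaceD(1,2)[OF assms(2)] tangent_spaceD(1,2)[OF assms(3)]
    subspace_add[OF subspace_model[OF assms(1)]])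

lemma tangent_scale:
  assumes "smooth_manifold M" "\<xi> \<in> tangent_space M x"
  shows "(\<lambda>c. a *\<^sub>R \<xi> c) \<in> tangent_space M x"
  unfolding tangent_space_def
proof (intro CollectI conjI allI impI ballI)
  fix c d assume cd: "c \<in> charts_at M x" "d \<in> charts_at M x"
  show "a *\<^sub>R \<xi> d = chart_deriv M c x (snd d) (a *\<^sub>R \<xi> c)"
    using tangent_spaceD(3)[OF assms(2) cd]
      linear_scale[OF chart_deriv_linear_charts[OF assms(1) cd]] by simp
qed (simp_all add: tangent_spaceD(1,2)[OF assms(2)] subspace_scale[OF subspace_model[OF assms(1)]])

lemma tangent_zero:
  assumes "smooth_manifold M" 
  shows "(\<lambda>c. 0) \<in> tangent_space M x"
  unfolding tangent_space_def
  by (simp add: linear_0[OF chart_deriv_linear_charts[OF assms]] subspace_0[OF subspace_model[OF assms]])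

section \<open>The differential of a smooth map\<close>

text \<open>In charts the differential is the derivative of the coordinate expression of the map, and both
  parts are instances of the chain rule: the first for the coordinate functions of the target, the
  second for an arbitrary germ.\<close>

lemma
  fixes M :: "('a, 'e::euclidean_space) mfd" and N :: "('b, 'f::euclidean_space) mfd"
  assumes M: "smooth_manifold M" and N: "smooth_manifold N" and F: "smooth_map M N F"
    and x: "x \<in> points M" and \<xi>: "\<xi> \<in> tangent_space M x"
  shows differential_tangent: "differential M N F x \<xi> \<in> tangent_space N (F x)"
    and tderiv_differential: "smooth_near N h (F x) \<Longrightarrow>
      tderiv N h (F x) (differential M N F x \<xi>) = tderiv M (h \<circ> F) x \<xi>"
proof -
  note c = chart_at(2,3)[OF M x]
  note v = tangent_spaceD(2)[OF \<xi> chart_at(1)[OF M x]]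
  have eq: "differential M N F x \<xi> d = chart_deriv M (chart_at M x) x (snd d \<circ> F) (\<xi> (chart_at M x))"
    if "d \<in> charts_at N (F x)" for d
    using that by (simp add: differential_def)
  have chain: "chart_deriv N d (F x) h (differential M N F x \<xi> d) = tderiv M (h \<circ> F) x \<xi>"
    if d: "d \<in> charts_at N (F x)" and h: "smooth_near N h (F x)" for d and h :: "'b \<Rightarrow> 'x::euclidean_space"
    using chart_deriv_chain(2)[OF M N F c charts_at_admissible[OF N d] v h] eq[OF d]
    by (simp add: tderiv_def)
  show "differential M N F x \<xi> \<in> tangent_space N (F x)"
    unfolding tangent_space_def
  proof (intro CollectI conjI allI impI ballI)
    fix d assume d: "d \<in> charts_at N (F x)"
    show "differential M N F x \<xi> d \<in> model N"
      using chart_deriv_chain(1)[OF M N F c charts_at_admissible[OF N d] v] eq[OF d] by simp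
    fix e assume e: "e \<in> charts_at N (F x)"
    show "differential M N F x \<xi> e = chart_deriv N d (F x) (snd e) (differential M N F x \<xi> d)"
      using chain[OF d smooth_near_chart[OF N charts_at_admissible[OF N e]]] eq[OF e]
      by (simp add: tderiv_def)
  qed (simp add: differential_def)
  assume h: "smooth_near N h (F x)"
  show "tderiv N h (F x) (differential M N F x \<xi>) = tderiv M (h \<circ> F) x \<xi>"
    using chart_deriv_chain(2)[OF M N F c chart_at(2,3)[OF N smooth_map_points[OF F x]] v h]
      eq[OF chart_at(1)[OF N smooth_map_points[OF F x]]]
    by (simp add: tderiv_def)
qed

lemma smooth_map_chart_near:
  assumes "smooth_manifold M" "smooth_manifold N" "smooth_map M N F" "x \<in> points M"
    and "admissible_chart N d" "F x \<in> fst d"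
  shows "smooth_near M (snd d \<circ> F) x"
  by (rule smooth_map_smooth_near[OF assms(1-4) smooth_near_chart[OF assms(2,5,6)]])

lemma differential_add:
  assumes "smooth_manifold M" "smooth_manifold N" "smooth_map M N F" "x \<in> points M"
  shows "differential M N F x (\<lambda>c. \<xi> c + \<eta> c) = (\<lambda>d. differential M N F x \<xi> d + differential M N F x \<eta> d)"
  using tderiv_add[OF assms(1,4) smooth_map_chart_near[OF assms charts_at_admissible[OF assms(2)]]]
  by (auto simp: differential_eq_tderiv fun_eq_iff)

lemma differential_scale:
  assumes "smooth_manifold M" "smooth_manifold N" "smooth_map M N F" "x \<in> points M"
  shows "differential M N F x (\<lambda>c. a *\<^sub>R \<xi> c) = (\<lambda>d. a *\<^sub>R differential M N F x \<xi> d)"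
  using tderiv_scale[OF assms(1,4) smooth_map_chart_near[OF assms charts_at_admissible[OF assms(2)]]]
  by (auto simp: differential_eq_tderiv fun_eq_iff)

text \<open>Both sides have the same components, by the chain rule for the coordinate functions of the
  target.\<close>

lemma differential_compose:
  assumes M: "smooth_manifold M" and N: "smooth_manifold N" and P: "smooth_manifold P"
    and F: "smooth_map M N F" and G: "smooth_map N P G" and x: "x \<in> points M" and \<xi>: "\<xi> \<in> tangent_space M x"
  shows "differential M P (G \<circ> F) x \<xi> = differential N P G (F x) (differential M N F x \<xi>)"
proof
  fix d
  show "differential M P (G \<circ> F) x \<xi> d = differential N P G (F x) (differential M N F x \<xi>) d"
  proof (cases "d \<in> charts_at P (G (F x))")
    case True
    from tderiv_differential[OF M N F x \<xi>
        smooth_map_chart_near[OF N P G smooth_map_points[OF F x] charts_at_admissible[OF P True]]]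
    show ?thesis using True by (simp add: differential_eq_tderiv o_def)
  qed (simp add: differential_eq_tderiv)
qed

lemma tderiv_cong:
  assumes "smooth_manifold M" "x \<in> points M" "\<And>y. y \<in> points M \<Longrightarrow> h y = h' y"
  shows "tderiv M h x \<xi> = tderiv M h' x \<xi>"
  using chart_deriv_cong[OF chart_at(2,3)[OF assms(1,2)] assms(3)] by (simp add: tderiv_def)

lemma differential_cong:
  fixes M :: "('a, 'e::euclidean_space) mfd" and N :: "('b, 'f::euclidean_space) mfd"
  assumes "smooth_manifold M" "x \<in> points M" "\<And>y. y \<in> points M \<Longrightarrow> F y = G y"
  shows "differential M N F x \<xi> = differential M N G x \<xi>"
proof
  fix d :: "('b, 'f) chart"
  have "tderiv M (snd d \<circ> F) x \<xi> = tderiv M (snd d \<circ> G) x \<xi>"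
    by (rule tderiv_cong[OF assms(1,2)]) (simp add: assms(3))
  then show "differential M N F x \<xi> d = differential M N G x \<xi> d"
    using assms(3)[OF assms(2)] by (simp add: differential_eq_tderiv)
qed

lemma differential_ident:
  assumes "smooth_manifold M" "x \<in> points M" "\<xi> \<in> tangent_space M x"
  shows "differential M M (\<lambda>x. x) x \<xi> = \<xi>"
  using tderiv_chart[OF assms] tangent_spaceD(1)[OF assms(3)]
  by (auto simp: differential_eq_tderiv fun_eq_iff o_def)

text \<open>Near \<open>0\<close> a function along the curve is the coordinate expression of the function after that of
  the curve. So the velocity is the tangent vector whose coordinates are the derivative of the
  coordinate expression of the curve.\<close>

lemma
  fixes M :: "('a, 'e::euclidean_space) mfd"
  assumes M: "smooth_manifold M" and c: "admissible_chart M c" "\<gamma> 0 \<in> fst c"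
    and J: "open J" "0 \<in> J" "\<And>t. t \<in> J \<Longrightarrow> \<gamma> t \<in> fst c"
    and v: "((snd c \<circ> \<gamma>) has_vector_derivative v) (at 0)"
  shows velocity0_tangent: "velocity0 M \<gamma> \<in> tangent_space M (\<gamma> 0)"
    and tderiv_velocity0: "smooth_near M h (\<gamma> 0) \<Longrightarrow>
      ((h \<circ> \<gamma>) has_vector_derivative tderiv M h (\<gamma> 0) (velocity0 M \<gamma>)) (at 0)"
proof -
  have D: "((snd c \<circ> \<gamma>) has_derivative (\<lambda>t. t *\<^sub>R v)) (at 0)"
    using v by (simp add: has_vector_derivative_def)
  have oJ: "openin (top_of_set UNIV) J" using J(1) by simp
  have im: "(snd c \<circ> \<gamma>) ` J \<subseteq> model M"
    using chart_image_model[OF c(1)] J(3) by auto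
  have vV: "v \<in> model M"
    using has_derivative_range_subspace[OF D subspace_UNIV _ oJ J(2) im subspace_model[OF M], of 1] by simp
  have *: "((h \<circ> \<gamma>) has_vector_derivative chart_deriv M c (\<gamma> 0) h v) (at 0)"
    if h: "smooth_near M h (\<gamma> 0)" for h :: "'a \<Rightarrow> 'x::euclidean_space"
  proof -
    note E = chart_deriv_has_derivative[OF c h]
    have "((h \<circ> chart_inv c) has_derivative chart_deriv M c (\<gamma> 0) h) (at ((snd c \<circ> \<gamma>) 0) within model M)"
      using E by simp
    from has_derivative_compose_openin[OF D this oJ J(2) im]
    have "((h \<circ> \<gamma>) has_derivative (\<lambda>t. chart_deriv M c (\<gamma> 0) h (t *\<^sub>R v))) (at 0)"
      by (rule has_derivative_within_openin_cong[OF oJ J(2), rotated])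
        (simp add: chart_inv_chart[OF c(1) J(3)])
    then show ?thesis
      by (simp add: has_vector_derivative_def linear_scale[OF linear_chart_deriv[OF c h]])
  qed
  have eq: "velocity0 M \<gamma> = coord_tvec M c (\<gamma> 0) v"
    using *[OF smooth_near_chart[OF M charts_at_admissible[OF M]]]
    by (auto simp: velocity0_def coord_tvec_def fun_eq_iff vector_derivative_at)
  show "velocity0 M \<gamma> \<in> tangent_space M (\<gamma> 0)"
    unfolding eq by (rule coord_tvec_tangent[OF M c vV])
  show "((h \<circ> \<gamma>) has_vector_derivative tderiv M h (\<gamma> 0) (velocity0 M \<gamma>)) (at 0)"
    if h: "smooth_near M h (\<gamma> 0)"
    using *[OF h] tderiv_coord_tvec[OF M c vV h] by (simp add: eq)
qed

section \<open>Metrics\<close>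

lemma
  assumes "pseudo_riemannian_metric M g" "x \<in> points M"
  shows metric_sym: "u \<in> tangent_space M x \<Longrightarrow> w \<in> tangent_space M x \<Longrightarrow> g x u w = g x w u"
    and metric_add_left: "u \<in> tangent_space M x \<Longrightarrow> v \<in> tangent_space M x \<Longrightarrow> w \<in> tangent_space M x \<Longrightarrow>
      g x (\<lambda>c. u c + v c) w = g x u w + g x v w"
    and metric_scale_left: "u \<in> tangent_space M x \<Longrightarrow> w \<in> tangent_space M x \<Longrightarrow>
      g x (\<lambda>c. a *\<^sub>R u c) w = a * g x u w"
    and metric_nondegenerate: "u \<in> tangent_space M x \<Longrightarrow>
      (\<And>w. w \<in> tangent_space M x \<Longrightarrow> g x u w = 0) \<Longrightarrow> u = (\<lambda>c. 0)"
  using assms unfolding pseudo_riemannian_metric_def by blast+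

lemma metric_add_right:
  assumes "smooth_manifold M" "pseudo_riemannian_metric M g" "x \<in> points M"
    and "u \<in> tangent_space M x" "v \<in> tangent_space M x" "w \<in> tangent_space M x"
  shows "g x w (\<lambda>c. u c + v c) = g x w u + g x w v"
  using metric_sym[OF assms(2,3) tangent_add[OF assms(1,4,5)] assms(6)]
    metric_sym[OF assms(2,3,4,6)] metric_sym[OF assms(2,3,5,6)] metric_add_left[OF assms(2-6)] by simp

lemma metric_scale_right:
  assumes "smooth_manifold M" "pseudo_riemannian_metric M g" "x \<in> points M"
    and "u \<in> tangent_space M x" "w \<in> tangent_space M x"
  shows "g x w (\<lambda>c. a *\<^sub>R u c) = a * g x w u"
  using metric_sym[OF assms(2,3) tangent_scale[OF assms(1,4)] assms(5), of a]
    metric_sym[OF assms(2-5)] metric_scale_left[OF assms(2-5), of a] by simp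

lemma coord_tvec_add:
  assumes "smooth_manifold M" "admissible_chart M c" "x \<in> fst c"
  shows "coord_tvec M c x (u + v) = (\<lambda>d. coord_tvec M c x u d + coord_tvec M c x v d)"
proof
  fix d
  show "coord_tvec M c x (u + v) d = coord_tvec M c x u d + coord_tvec M c x v d"
    using linear_add[OF linear_chart_deriv[OF assms(2,3) smooth_near_chart[OF assms(1) charts_at_admissible[OF assms(1)]]]]
    by (simp add: coord_tvec_def)
qed

lemma coord_tvec_scale:
  assumes "smooth_manifold M" "admissible_chart M c" "x \<in> fst c"
  shows "coord_tvec M c x (a *\<^sub>R u) = (\<lambda>d. a *\<^sub>R coord_tvec M c x u d)"
proof
  fix d
  show "coord_tvec M c x (a *\<^sub>R u) d = a *\<^sub>R coord_tvec M c x u d"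
    using linear_scale[OF linear_chart_deriv[OF assms(2,3) smooth_near_chart[OF assms(1) charts_at_admissible[OF assms(1)]]]]
    by (simp add: coord_tvec_def)
qed

lemma metric_zero_left:
  assumes "smooth_manifold M" "pseudo_riemannian_metric M g" "x \<in> points M" "w \<in> tangent_space M x"
  shows "g x (\<lambda>c. 0) w = 0"
  using metric_scale_left[OF assms(2,3) tangent_zero[OF assms(1)] assms(4), of 0] by simp

lemma metric_coord_sum_left:
  assumes M: "smooth_manifold M" and g: "pseudo_riemannian_metric M g"
    and c: "admissible_chart M c" "x \<in> fst c" and w: "w \<in> tangent_space M x"
    and B: "finite B" "B \<subseteq> model M"
  shows "g x (coord_tvec M c x (\<Sum>b\<in>B. a b *\<^sub>R b)) w = (\<Sum>b\<in>B. a b * g x (coord_tvec M c x b) w)"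
  using B
proof (induction B rule: finite_induct)
  case empty
  have "coord_tvec M c x 0 = (\<lambda>d. 0)" using coord_tvec_scale[OF M c, of 0] by simp
  then show ?case using metric_zero_left[OF M g admissible_points[OF c] w] by simp
next
  case (insert b B)
  note x = admissible_points[OF c]
  have b: "b \<in> model M" "a b *\<^sub>R b \<in> model M"
    using insert.prems subspace_scale[OF subspace_model[OF M]] by auto
  have s: "(\<Sum>b\<in>B. a b *\<^sub>R b) \<in> model M"
    using insert.prems by (intro subspace_sum subspace_model[OF M] subspace_scale) auto
  have "g x (coord_tvec M c x (a b *\<^sub>R b + (\<Sum>b\<in>B. a b *\<^sub>R b))) w =
      a b * g x (coord_tvec M c x b) w + g x (coord_tvec M c x (\<Sum>b\<in>B. a b *\<^sub>R b)) w"
    unfolding coord_tvec_add[OF M c]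
    using metric_add_left[OF g x coord_tvec_tangent[OF M c b(2)] coord_tvec_tangent[OF M c s] w]
      metric_scale_left[OF g x coord_tvec_tangent[OF M c b(1)] w, of "a b"] coord_tvec_scale[OF M c, of "a b" b]
    by simp
  then show ?case using insert by simp
qed

lemma metric_coord_sum:
  assumes M: "smooth_manifold M" and g: "pseudo_riemannian_metric M g"
    and c: "admissible_chart M c" "x \<in> fst c" and B: "finite B" "B \<subseteq> model M"
  shows "g x (coord_tvec M c x (\<Sum>b\<in>B. a b *\<^sub>R b)) (coord_tvec M c x (\<Sum>b\<in>B. a' b *\<^sub>R b)) =
    (\<Sum>b\<in>B. \<Sum>b'\<in>B. a b * (a' b' * g x (coord_tvec M c x b) (coord_tvec M c x b')))"
proof -
  have T: "coord_tvec M c x (\<Sum>b\<in>B. a' b *\<^sub>R b) \<in> tangent_space M x"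
    using B by (intro coord_tvec_tangent[OF M c] subspace_sum subspace_model[OF M] subspace_scale) auto
  have "g x (coord_tvec M c x b) (coord_tvec M c x (\<Sum>b\<in>B. a' b *\<^sub>R b)) =
      (\<Sum>b'\<in>B. a' b' * g x (coord_tvec M c x b) (coord_tvec M c x b'))" if b: "b \<in> B" for b
  proof -
    note x = admissible_points[OF c]
    have Tb: "coord_tvec M c x e \<in> tangent_space M x" if "e \<in> B" for e
      using B that by (intro coord_tvec_tangent[OF M c]) auto
    have "(\<Sum>b'\<in>B. a' b' * g x (coord_tvec M c x b') (coord_tvec M c x b)) =
        (\<Sum>b'\<in>B. a' b' * g x (coord_tvec M c x b) (coord_tvec M c x b'))"
      by (intro sum.cong refl) (simp add: metric_sym[OF g x Tb[OF b] Tb])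
    then show ?thesis
      using metric_coord_sum_left[OF M g c Tb[OF b] B, of a'] metric_sym[OF g x Tb[OF b] T] by simp
  qed
  then show ?thesis
    unfolding metric_coord_sum_left[OF M g c T B] by (simp add: sum_distrib_left)
qed

abbreviation metric_component ::
  "('a, 'e::euclidean_space) mfd \<Rightarrow> ('a, 'e) chart \<Rightarrow> ('a, 'e) tensor2 \<Rightarrow> 'e \<Rightarrow> 'e \<Rightarrow> 'e \<Rightarrow> real" where
  "metric_component M c g u w \<equiv> \<lambda>p. g (chart_inv c p)
    (coord_tvec M c (chart_inv c p) u) (coord_tvec M c (chart_inv c p) w)"

text \<open>Components of a pulled back metric are sums of products of derivatives of the map with
  components of the metric, hence smooth. An orthonormal basis of the model space provides the indices.\<close>

lemma pullback_components_smooth: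
  assumes M: "smooth_manifold M" and N: "smooth_manifold N" and F: "smooth_map M N F"
    and g: "pseudo_riemannian_metric N g" and c: "admissible_chart M c"
    and u: "u \<in> model M" and w: "w \<in> model M"
  shows "smooth_on (snd c ` fst c) (metric_component M c (pullback M N F g) u w)"
proof (rule smooth_on_local)
  note cc = admissible_is_chart[OF c]
  fix p assume "p \<in> snd c ` fst c"
  then obtain x where x: "x \<in> fst c" "p = snd c x" by auto
  note xM = admissible_points[OF c x(1)]
  obtain d where d: "d \<in> atlas N" "admissible_chart N d" "F x \<in> fst d"
    using exists_chart[OF N smooth_map_points[OF F xM]] .
  obtain A1 where A1: "openin (mtop M) A1" "x \<in> A1" "A1 \<subseteq> fst c"
    "smooth_on (snd c ` A1) (snd d \<circ> F \<circ> chart_inv c)" "openin (top_of_set (model M)) (snd c ` A1)"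
    using smooth_nearE[OF smooth_map_chart_near[OF M N F xM d(2,3)] c x(1)] .
  have contF: "continuous_map (mtop M) (mtop N) F" using F by (simp add: smooth_map_def)
  define A where "A = A1 \<inter> {y \<in> points M. F y \<in> fst d}"
  have A: "A \<subseteq> fst c" "F ` A \<subseteq> fst d" "A \<subseteq> A1" using A1 by (auto simp: A_def)
  have "openin (mtop M) A" unfolding A_def
    by (intro openin_Int A1(1) is_chartD(1)[OF admissible_is_chart[OF d(2)]]
        openin_continuous_map_preimage[OF contF])
  then have oA: "openin (top_of_set (model M)) (snd c ` A)"
    using A(1) by (rule is_chart_openin_image[OF cc])
  have sA: "smooth_on (snd c ` A) (snd d \<circ> F \<circ> chart_inv c)"
    using A1(4) by (rule smooth_on_subset) (use A in auto)
  \<comment> \<open>The coordinates in \<open>d\<close> of the image of the vector with coordinates \<open>v\<close> in \<open>c\<close>.\<close>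
  define W where "W v q = frechet_derivative (snd d \<circ> F \<circ> chart_inv c) (at q within model M) v" for v q
  have W: "differential M N F y (coord_tvec M c y v) = coord_tvec N d (F y) (W v (snd c y))"
      and WN: "W v (snd c y) \<in> model N"
    if y: "y \<in> A" and v: "v \<in> model M" for y v
  proof -
    have yc: "y \<in> fst c" and yd: "F y \<in> fst d" using y A by auto
    note yM = admissible_points[OF c yc]
    note near = smooth_map_chart_near[OF M N F yM d(2) yd]
    note T = coord_tvec_tangent[OF M c yc v]
    have "tderiv N (snd d) (F y) (differential M N F y (coord_tvec M c y v)) = W v (snd c y)"
      using tderiv_differential[OF M N F yM T smooth_near_chart[OF N d(2) yd]]
        tderiv_coord_tvec[OF M c yc v near] by (simp add: W_def chart_deriv_def)
    then show "differential M N F y (coord_tvec M c y v) = coord_tvec N d (F y) (W v (snd c y))"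
        "W v (snd c y) \<in> model N"
      using coord_tvec_tderiv[OF N d(2) yd differential_tangent[OF M N F yM T]]
        tderiv_chart_model[OF N differential_tangent[OF M N F yM T] d(2) yd] by simp_all
  qed
  have sW: "smooth_on (snd c ` A) (W v)" if "v \<in> model M" for v
    unfolding W_def using smooth_on_frechet_derivative[OF subspace_model[OF M] sA oA that] .
  obtain B where B: "B \<subseteq> model N" "pairwise orthogonal B" "\<And>b. b \<in> B \<Longrightarrow> norm b = 1"
      "independent B" "span B = model N"
    using orthonormal_basis_subspace[OF subspace_model[OF N]] by metis
  have finB: "finite B" using B(4) by (rule independent_imp_finite)
  define G where "G b b' = (metric_component N d g b b')" for b b'
  have sG: "smooth_on (snd c ` A) (G b b' \<circ> (snd d \<circ> F \<circ> chart_inv c))" if b: "b \<in> B" "b' \<in> B" for b b'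
  proof (rule smooth_on_compose[OF sA])
    show "smooth_on (snd d ` fst d) (G b b')"
      using g d(1) b B(1) unfolding pseudo_riemannian_metric_def G_def by blast
    have "chart_inv c (snd c y) = y" "F y \<in> fst d" if "y \<in> A" for y
      using that A chart_inv_chart[OF c] by auto
    then show "(snd d \<circ> F \<circ> chart_inv c) ` snd c ` A \<subseteq> snd d ` fst d" by auto
  qed
  have "smooth_on (snd c ` A) (\<lambda>q. \<Sum>b\<in>B. \<Sum>b'\<in>B.
      (W u q \<bullet> b) * ((W w q \<bullet> b') * (G b b' \<circ> (snd d \<circ> F \<circ> chart_inv c)) q))"
    by (intro smooth_on_sum smooth_on_mult sG smooth_on_linear_image[OF bounded_linear_inner_left] sW u w)
  then have "smooth_on (snd c ` A) (metric_component M c (pullback M N F g) u w)"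
  proof (rule smooth_on_cong)
    fix q assume "q \<in> snd c ` A"
    then obtain y where y: "y \<in> A" "q = snd c y" by auto
    then have y': "chart_inv c q = y" "F y \<in> fst d" "chart_inv d (snd d (F y)) = F y"
      using A chart_inv_chart[OF c, of y] chart_inv_chart[OF d(2), of "F y"] by auto
    have ex: "(\<Sum>b\<in>B. (W v q \<bullet> b) *\<^sub>R b) = W v q" if "v \<in> model M" for v
      using orthonormal_basis_expand[OF B(2,3) _ finB, of "W v q"] WN[OF y(1) that] y(2) B(5) by simp
    show "pullback M N F g (chart_inv c q) (coord_tvec M c (chart_inv c q) u) (coord_tvec M c (chart_inv c q) w) =
      (\<Sum>b\<in>B. \<Sum>b'\<in>B. (W u q \<bullet> b) * ((W w q \<bullet> b') * (G b b' \<circ> (snd d \<circ> F \<circ> chart_inv c)) q))"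
      using metric_coord_sum[OF N g d(2) y'(2) finB B(1), of "\<lambda>b. W u q \<bullet> b" "\<lambda>b. W w q \<bullet> b"]
      by (simp add: pullback_def y' W[OF y(1) u] W[OF y(1) w] ex[OF u] ex[OF w] y(2)[symmetric] G_def)
  qed
  moreover have "openin (top_of_set (snd c ` fst c)) (snd c ` A)"
    using oA by (rule openin_subset_trans) (use A is_chartD(4)[OF cc] in auto)
  moreover have "p \<in> snd c ` A" using x xM A1(2) d(3) by (auto simp: A_def)
  ultimately show "\<exists>T. openin (top_of_set (snd c ` fst c)) T \<and> p \<in> T \<and>
      smooth_on T (metric_component M c (pullback M N F g) u w)" by blast
qed

text \<open>The algebraic conditions are inherited through the linearity of the differential. Nondegeneracy
  is a hypothesis since it depends on the map.\<close>

lemma pullback_metric: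
  assumes M: "smooth_manifold M" and N: "smooth_manifold N" and F: "smooth_map M N F"
    and g: "pseudo_riemannian_metric N g"
    and nondeg: "\<And>x u. x \<in> points M \<Longrightarrow> u \<in> tangent_space M x \<Longrightarrow>
      (\<And>w. w \<in> tangent_space M x \<Longrightarrow> pullback M N F g x u w = 0) \<Longrightarrow> u = (\<lambda>c. 0)"
  shows "pseudo_riemannian_metric M (pullback M N F g)"
  unfolding pseudo_riemannian_metric_def
proof (intro conjI ballI allI impI)
  fix x assume x: "x \<in> points M"
  note Fx = smooth_map_points[OF F x]
  note T = differential_tangent[OF M N F x]
  fix u assume u: "u \<in> tangent_space M x"
  show "u = (\<lambda>c. 0)" if "\<forall>w\<in>tangent_space M x. pullback M N F g x u w = 0"
    by (rule nondeg[OF x u]) (use that in blast)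
  fix w assume w: "w \<in> tangent_space M x"
  show "pullback M N F g x u w = pullback M N F g x w u"
    unfolding pullback_def by (rule metric_sym[OF g Fx T[OF u] T[OF w]])
  show "pullback M N F g x (\<lambda>c. a *\<^sub>R u c) w = a * pullback M N F g x u w" for a
    unfolding pullback_def differential_scale[OF M N F x]
    by (rule metric_scale_left[OF g Fx T[OF u] T[OF w]])
  fix v assume v: "v \<in> tangent_space M x"
  show "pullback M N F g x (\<lambda>c. u c + w c) v = pullback M N F g x u v + pullback M N F g x w v"
    unfolding pullback_def differential_add[OF M N F x]
    by (rule metric_add_left[OF g Fx T[OF u] T[OF w] T[OF v]])
next
  fix c u w assume "c \<in> atlas M" "u \<in> model M" "w \<in> model M"
  then show "smooth_on (snd c ` fst c) (metric_component M c (pullback M N F g) u w)"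
    using pullback_components_smooth[OF M N F g atlas_admissible[OF M]] by blast
qed

lemma metric_cong:
  assumes M: "smooth_manifold M" and g: "pseudo_riemannian_metric M g"
    and eq: "\<And>x u w. x \<in> points M \<Longrightarrow> u \<in> tangent_space M x \<Longrightarrow> w \<in> tangent_space M x \<Longrightarrow> g' x u w = g x u w"
  shows "pseudo_riemannian_metric M g'"
  unfolding pseudo_riemannian_metric_def
proof (intro conjI ballI allI impI)
  fix x assume x: "x \<in> points M"
  note eq = eq[OF x]
  fix u assume u: "u \<in> tangent_space M x"
  show "u = (\<lambda>c. 0)" if "\<forall>w\<in>tangent_space M x. g' x u w = 0"
    by (rule metric_nondegenerate[OF g x u]) (use that eq[OF u] in auto)
  fix w assume w: "w \<in> tangent_space M x"
  show "g' x u w = g' x w u"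
    using metric_sym[OF g x u w] eq[OF u w] eq[OF w u] by simp
  show "g' x (\<lambda>c. a *\<^sub>R u c) w = a * g' x u w" for a
    using metric_scale_left[OF g x u w, of a] eq[OF u w] eq[OF tangent_scale[OF M u] w, of a] by simp
  fix v assume v: "v \<in> tangent_space M x"
  show "g' x (\<lambda>c. u c + w c) v = g' x u v + g' x w v"
    using metric_add_left[OF g x u w v] eq[OF u v] eq[OF w v] eq[OF tangent_add[OF M u w] v] by simp
next
  fix c u w assume c: "c \<in> atlas M" and uw: "u \<in> model M" "w \<in> model M"
  note c' = atlas_admissible[OF M c]
  have "smooth_on (snd c ` fst c) (metric_component M c g u w)"
    using g c uw unfolding pseudo_riemannian_metric_def by blast
  then show "smooth_on (snd c ` fst c) (metric_component M c g' u w)"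
  proof (rule smooth_on_cong)
    fix p assume "p \<in> snd c ` fst c"
    then have p: "chart_inv c p \<in> fst c" by (simp add: inv_into_into)
    show "g' (chart_inv c p) (coord_tvec M c (chart_inv c p) u) (coord_tvec M c (chart_inv c p) w) =
        g (chart_inv c p) (coord_tvec M c (chart_inv c p) u) (coord_tvec M c (chart_inv c p) w)"
      by (intro eq admissible_points[OF c' p] coord_tvec_tangent[OF M c' p] uw)
  qed
qed

lemma smooth_near_imp_smooth_on_chart:
  assumes c: "admissible_chart M c" and h: "\<And>x. x \<in> fst c \<Longrightarrow> smooth_near M h x"
  shows "smooth_on (snd c ` fst c) (h \<circ> chart_inv c)"
proof (rule smooth_on_local)
  fix p assume "p \<in> snd c ` fst c"
  then obtain x where x: "x \<in> fst c" "p = snd c x" by auto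
  obtain A where A: "openin (mtop M) A" "x \<in> A" "A \<subseteq> fst c" "smooth_on (snd c ` A) (h \<circ> chart_inv c)"
    "openin (top_of_set (model M)) (snd c ` A)"
    using smooth_nearE[OF h[OF x(1)] c x(1)] .
  have "openin (top_of_set (snd c ` fst c)) (snd c ` A)"
    using A(5) by (rule openin_subset_trans) (use A(3) is_chartD(4)[OF admissible_is_chart[OF c]] in auto)
  then show "\<exists>T. openin (top_of_set (snd c ` fst c)) T \<and> p \<in> T \<and> smooth_on T (h \<circ> chart_inv c)"
    using A(2,4) x(2) by blast
qed

lemma conformal_metric:
  assumes M: "smooth_manifold M" and g: "pseudo_riemannian_metric M g"
    and k: "\<And>x. x \<in> points M \<Longrightarrow> smooth_near M k x" "\<And>x. x \<in> points M \<Longrightarrow> k x \<noteq> (0::real)"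
  shows "pseudo_riemannian_metric M (\<lambda>x u w. k x * g x u w)"
  unfolding pseudo_riemannian_metric_def
proof (intro conjI ballI allI impI)
  fix x assume x: "x \<in> points M"
  fix u assume u: "u \<in> tangent_space M x"
  show "u = (\<lambda>c. 0)" if "\<forall>w\<in>tangent_space M x. k x * g x u w = 0"
    by (rule metric_nondegenerate[OF g x u]) (use that k(2)[OF x] in auto)
  fix w assume w: "w \<in> tangent_space M x"
  show "k x * g x u w = k x * g x w u"
    using metric_sym[OF g x u w] by simp
  show "k x * g x (\<lambda>c. a *\<^sub>R u c) w = a * (k x * g x u w)" for a
    using metric_scale_left[OF g x u w, of a] by simp
  fix v assume v: "v \<in> tangent_space M x"
  show "k x * g x (\<lambda>c. u c + w c) v = k x * g x u v + k x * g x w v"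
    using metric_add_left[OF g x u w v] by (simp add: distrib_left)
next
  fix c u w assume c: "c \<in> atlas M" and uw: "u \<in> model M" "w \<in> model M"
  note c' = atlas_admissible[OF M c]
  have 1: "smooth_on (snd c ` fst c) (metric_component M c g u w)"
    using g c uw unfolding pseudo_riemannian_metric_def by blast
  have "smooth_on (snd c ` fst c) (k \<circ> chart_inv c)"
    by (rule smooth_near_imp_smooth_on_chart[OF c' k(1)[OF admissible_points[OF c']]])
  from smooth_on_mult[OF this 1]
  show "smooth_on (snd c ` fst c) (\<lambda>p. k (chart_inv c p) * g (chart_inv c p)
      (coord_tvec M c (chart_inv c p) u) (coord_tvec M c (chart_inv c p) w))"
    by (simp add: o_def)
qed

section \<open>Open subsets of Euclidean spaces and products\<close>

text \<open>The two constants have the same definition, so that permanence of second countability under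
  subspaces applies.\<close>

lemma second_countable_iff: "second_countable T \<longleftrightarrow> Abstract_Topological_Spaces.second_countable T"
  by (simp add: Defs.second_countable_def Abstract_Topological_Spaces.second_countable_def)

lemma second_countable_euclidean:
  "Abstract_Topological_Spaces.second_countable (euclidean :: 'a::second_countable_topology topology)"
proof -
  obtain B :: "'a set set" where B: "countable B" "topological_basis B" using ex_countable_basis by blast
  have "\<exists>V\<in>B. x \<in> V \<and> V \<subseteq> U" if U: "open U" "x \<in> U" for U and x :: 'a
    by (rule topological_basisE[OF B(2) U]) blast
  then show ?thesis
    unfolding Abstract_Topological_Spaces.second_countable_def
    by (intro exI[of _ B] conjI ballI allI impI) (auto simp: B(1) topological_basis_open[OF B(2)])
qed

lemma second_countable_prod:
  assumes "second_countable T" "second_countable T'"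
  shows "second_countable (prod_topology T T')"
proof -
  obtain \<B> where B: "countable \<B>" "\<forall>B\<in>\<B>. openin T B" "\<forall>U x. openin T U \<and> x \<in> U \<longrightarrow> (\<exists>B\<in>\<B>. x \<in> B \<and> B \<subseteq> U)"
    using assms(1) unfolding Defs.second_countable_def by blast
  obtain \<C> where C: "countable \<C>" "\<forall>B\<in>\<C>. openin T' B" "\<forall>U x. openin T' U \<and> x \<in> U \<longrightarrow> (\<exists>B\<in>\<C>. x \<in> B \<and> B \<subseteq> U)"
    using assms(2) unfolding Defs.second_countable_def by blast
  let ?D = "(\<lambda>(B, C). B \<times> C) ` (\<B> \<times> \<C>)"
  have "\<exists>D\<in>?D. z \<in> D \<and> D \<subseteq> W" if W: "openin (prod_topology T T') W" "z \<in> W" for W z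
  proof -
    obtain U V where UV: "openin T U" "openin T' V" "fst z \<in> U" "snd z \<in> V" "U \<times> V \<subseteq> W"
      using W(1)[unfolded openin_prod_topology_alt, rule_format, of "fst z" "snd z"] W(2) by auto
    obtain B where "B \<in> \<B>" "fst z \<in> B" "B \<subseteq> U" using B(3) UV(1,3) by blast
    moreover obtain C where "C \<in> \<C>" "snd z \<in> C" "C \<subseteq> V" using C(3) UV(2,4) by blast
    ultimately show ?thesis using UV(5) by (intro bexI[of _ "B \<times> C"]) (auto simp: mem_Times_iff)
  qed
  moreover have "countable ?D" using B(1) C(1) by blast
  moreover have "openin (prod_topology T T') D" if "D \<in> ?D" for D
    using that B(2) C(2) by (auto simp: openin_prod_Times_iff)
  ultimately show ?thesis
    unfolding Defs.second_countable_def by (intro exI[of _ ?D]) blast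
qed

lemma smooth_manifold_open_mfd:
  assumes "open U"
  shows "smooth_manifold (open_mfd U)"
proof -
  have "is_chart (top_of_set U) UNIV (U, \<lambda>x. x)"
    using assms homeomorphic_map_id[of "top_of_set U" "top_of_set U"]
    by (simp add: is_chart_def subtopology_subtopology id_def)
  moreover have "compatible (U, \<lambda>x. x) (U, \<lambda>x. x)"
    unfolding compatible_def
    by (auto intro!: smooth_on_cong[OF smooth_on_ident] simp: inv_into_f_f[of "\<lambda>x. x"])
  moreover have "second_countable (top_of_set U)"
    unfolding second_countable_iff
    by (rule Abstract_Topological_Spaces.second_countable_subtopology[OF second_countable_euclidean])
  ultimately show ?thesis
    by (auto simp: smooth_manifold_def open_mfd_def Hausdorff_space_subtopology)
qed

lemma open_mfd_simps [simp]:
  "mtop (open_mfd U) = top_of_set U" "model (open_mfd U) = UNIV" "atlas (open_mfd U) = {(U, \<lambda>x. x)}"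
  by (simp_all add: open_mfd_def)

lemma smooth_manifold_pos_reals: "smooth_manifold pos_reals"
  by (rule smooth_manifold_open_mfd) simp

lemma smooth_near_real:
  assumes "smooth_manifold M" "smooth_map M pos_reals f" "x \<in> points M"
  shows "smooth_near M f x"
proof -
  have "admissible_chart pos_reals ({0<..}, \<lambda>x. x)"
    by (rule atlas_admissible[OF smooth_manifold_pos_reals]) simp
  from smooth_map_chart_near[OF assms(1) smooth_manifold_pos_reals assms(2,3) this]
    smooth_map_points[OF assms(2,3)] show ?thesis by (simp add: o_def)
qed

text \<open>The only chart of the positive reals is the identity, so a map to them is smooth if it is a
  smooth function.\<close>

lemma smooth_map_realI:
  assumes "smooth_manifold M" "continuous_map (mtop M) (top_of_set {0<..}) f"
    and "\<And>x. x \<in> points M \<Longrightarrow> smooth_near M f x"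
  shows "smooth_map M pos_reals f"
proof (rule smooth_mapI[OF assms(1) smooth_manifold_pos_reals])
  fix x assume x: "x \<in> points M"
  have "admissible_chart pos_reals ({0<..}, \<lambda>x. x)"
    by (rule atlas_admissible[OF smooth_manifold_pos_reals]) simp
  moreover have "f x \<in> {0<..}"
    using assms(2) x by (auto simp: continuous_map_def)
  ultimately show "\<exists>d. admissible_chart pos_reals d \<and> f x \<in> fst d \<and> smooth_near M (snd d \<circ> f) x"
    using assms(3)[OF x] by (intro exI[of _ "({0<..}, \<lambda>x. x)"]) (simp add: o_def)
qed (use assms(2) in simp)

lemma smooth_map_real_compose:
  assumes M: "smooth_manifold M" and f: "smooth_map M pos_reals f"
    and \<phi>: "smooth_on {0<..} \<phi>" "\<And>s. s > 0 \<Longrightarrow> \<phi> s > (0::real)"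
  shows "smooth_map M pos_reals (\<lambda>x. \<phi> (f x))"
proof (rule smooth_map_realI[OF M])
  have pos: "f x > 0" if "x \<in> points M" for x using smooth_map_points[OF f that] by simp
  have "continuous_map (top_of_set {0<..}) (top_of_set {0<..}) \<phi>"
    using smooth_on_continuous_on[OF \<phi>(1)] \<phi>(2) by auto
  then have "continuous_map (mtop M) (top_of_set {0<..}) (\<phi> \<circ> f)"
    using f by (intro continuous_map_compose) (auto simp: smooth_map_def)
  then show "continuous_map (mtop M) (top_of_set {0<..}) (\<lambda>x. \<phi> (f x))" by (simp add: o_def)
  show "smooth_near M (\<lambda>x. \<phi> (f x)) x" if "x \<in> points M" for x
    using smooth_near_real[OF M f that] \<phi>(1) by (rule smooth_near_compose) (simp add: pos)
qed

abbreviation prod_chart :: "('a, 'e) chart \<Rightarrow> ('b, 'f) chart \<Rightarrow> ('a \<times> 'b, 'e \<times> 'f) chart" where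
  "prod_chart c d \<equiv> (fst c \<times> fst d, map_prod (snd c) (snd d))"

lemma map_prod_image: "map_prod f g ` (A \<times> B) = f ` A \<times> g ` B"
  by force

lemma is_chart_prod:
  assumes c: "is_chart T V c" and d: "is_chart T' W d"
  shows "is_chart (prod_topology T T') (V \<times> W) (prod_chart c d)"
proof -
  obtain c' where c': "homeomorphic_maps (subtopology T (fst c)) (top_of_set (snd c ` fst c)) (snd c) c'"
    using c homeomorphic_map_maps unfolding is_chart_def by blast
  obtain d' where d': "homeomorphic_maps (subtopology T' (fst d)) (top_of_set (snd d ` fst d)) (snd d) d'"
    using d homeomorphic_map_maps unfolding is_chart_def by blast
  have "homeomorphic_maps (prod_topology (subtopology T (fst c)) (subtopology T' (fst d)))
      (prod_topology (top_of_set (snd c ` fst c)) (top_of_set (snd d ` fst d)))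
      (\<lambda>(x, y). (snd c x, snd d y)) (\<lambda>(x, y). (c' x, d' y))"
    using homeomorphic_maps_prod c' d' by blast
  then have "homeomorphic_map (subtopology (prod_topology T T') (fst c \<times> fst d))
      (top_of_set (snd c ` fst c \<times> snd d ` fst d)) (map_prod (snd c) (snd d))"
    unfolding subtopology_Times map_prod_def prod_topology_subtopology_eu
    by (auto simp: homeomorphic_map_maps)
  then show ?thesis
    using is_chartD(1,2)[OF c] is_chartD(1,2)[OF d]
    by (simp add: is_chart_def map_prod_image openin_prod_Times_iff openin_Times)
qed

lemma prod_chart_inv:
  assumes "inj_on (snd c) (fst c)" "inj_on (snd d) (fst d)" "x \<in> fst c" "y \<in> fst d"
  shows "chart_inv (prod_chart c d) (snd c x, snd d y) = (x, y)"
proof -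
  have "inj_on (map_prod (snd c) (snd d)) (fst c \<times> fst d)"
    using assms(1,2) by (rule map_prod_inj_on)
  from inv_into_f_f[OF this, of "(x, y)"] show ?thesis using assms(3,4) by simp
qed

lemma smooth_on_prod_transition:
  assumes cc: "smooth_on (snd c ` (fst c \<inter> fst c')) (snd c' \<circ> chart_inv c)"
    and dd: "smooth_on (snd d ` (fst d \<inter> fst d')) (snd d' \<circ> chart_inv d)"
    and inj: "inj_on (snd c) (fst c)" "inj_on (snd d) (fst d)"
  shows "smooth_on (snd (prod_chart c d) ` (fst (prod_chart c d) \<inter> fst (prod_chart c' d')))
    (snd (prod_chart c' d') \<circ> chart_inv (prod_chart c d))"
proof -
  let ?A = "fst c \<inter> fst c'" and ?B = "fst d \<inter> fst d'"
  have im: "snd (prod_chart c d) ` (fst (prod_chart c d) \<inter> fst (prod_chart c' d')) = snd c ` ?A \<times> snd d ` ?B"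
    by (simp add: Times_Int_Times map_prod_image)
  have 1: "smooth_on (snd c ` ?A \<times> snd d ` ?B) ((snd c' \<circ> chart_inv c) \<circ> fst)"
    by (rule smooth_on_compose[OF smooth_on_bounded_linear[OF bounded_linear_fst] cc]) auto
  have 2: "smooth_on (snd c ` ?A \<times> snd d ` ?B) ((snd d' \<circ> chart_inv d) \<circ> snd)"
    by (rule smooth_on_compose[OF smooth_on_bounded_linear[OF bounded_linear_snd] dd]) auto
  show ?thesis
    unfolding im
  proof (rule smooth_on_cong[OF smooth_on_Pair[OF 1 2]])
    fix p assume "p \<in> snd c ` ?A \<times> snd d ` ?B"
    then obtain x y where xy: "x \<in> fst c" "y \<in> fst d" "p = (snd c x, snd d y)" by auto
    then show "(snd (prod_chart c' d') \<circ> chart_inv (prod_chart c d)) p =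
        (((snd c' \<circ> chart_inv c) \<circ> fst) p, ((snd d' \<circ> chart_inv d) \<circ> snd) p)"
      using prod_chart_inv[OF inj xy(1,2)] inj by (simp add: inv_into_f_f)
  qed
qed

lemma prod_mfd_simps [simp]:
  "mtop (prod_mfd M N) = prod_topology (mtop M) (mtop N)" "model (prod_mfd M N) = model M \<times> model N"
  by (simp_all add: prod_mfd_def)

lemma atlas_prod_mfd: "C \<in> atlas (prod_mfd M N) \<longleftrightarrow> (\<exists>c\<in>atlas M. \<exists>d\<in>atlas N. C = prod_chart c d)"
  by (force simp: prod_mfd_def)

lemma smooth_manifold_prod_mfd:
  assumes M: "smooth_manifold M" and N: "smooth_manifold N"
  shows "smooth_manifold (prod_mfd M N)"
proof -
  have H: "Hausdorff_space (prod_topology (mtop M) (mtop N))"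
    using M N by (simp add: smooth_manifold_def Hausdorff_space_prod_topology)
  have S: "second_countable (prod_topology (mtop M) (mtop N))"
    using M N by (simp add: smooth_manifold_def second_countable_prod)
  have V: "subspace (model M \<times> model N)"
    using subspace_model[OF M] subspace_model[OF N] by (rule subspace_Times)
  have ic: "is_chart (mtop M) (model M) c" if "c \<in> atlas M" for c
    using M that by (simp add: smooth_manifold_def)
  have id: "is_chart (mtop N) (model N) d" if "d \<in> atlas N" for d
    using N that by (simp add: smooth_manifold_def)
  have C: "is_chart (prod_topology (mtop M) (mtop N)) (model M \<times> model N) C" if "C \<in> atlas (prod_mfd M N)" for C
    using that is_chart_prod[OF ic id] by (auto simp: atlas_prod_mfd)
  have P: "points M \<times> points N = (\<Union>C\<in>atlas (prod_mfd M N). fst C)"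
  proof
    have "points M \<subseteq> (\<Union>c\<in>atlas M. fst c)" "points N \<subseteq> (\<Union>d\<in>atlas N. fst d)"
      using M N unfolding smooth_manifold_def by blast+
    then show "points M \<times> points N \<subseteq> (\<Union>C\<in>atlas (prod_mfd M N). fst C)"
      by (fastforce simp: prod_mfd_def)
    show "(\<Union>C\<in>atlas (prod_mfd M N). fst C) \<subseteq> points M \<times> points N"
      using is_chartD(5)[OF C] by fastforce
  qed
  have K: "compatible C D" if CD: "C \<in> atlas (prod_mfd M N)" "D \<in> atlas (prod_mfd M N)" for C D
  proof -
    obtain c d where c: "c \<in> atlas M" "d \<in> atlas N" "C = prod_chart c d" using CD(1) by (auto simp: atlas_prod_mfd)
    obtain c' d' where c': "c' \<in> atlas M" "d' \<in> atlas N" "D = prod_chart c' d'" using CD(2) by (auto simp: atlas_prod_mfd)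
    have *: "smooth_on (snd a ` (fst a \<inter> fst b)) (snd b \<circ> chart_inv a)" if "a \<in> atlas M" "b \<in> atlas M" for a b
      using that M by (simp add: smooth_manifold_def compatible_def)
    have **: "smooth_on (snd a ` (fst a \<inter> fst b)) (snd b \<circ> chart_inv a)" if "a \<in> atlas N" "b \<in> atlas N" for a b
      using that N by (simp add: smooth_manifold_def compatible_def)
    note i = is_chartD(3)[OF ic] is_chartD(3)[OF id]
    have "smooth_on (snd C ` (fst C \<inter> fst D)) (snd D \<circ> chart_inv C)"
      unfolding c(3) c'(3)
      by (rule smooth_on_prod_transition[OF *[OF c(1) c'(1)] **[OF c(2) c'(2)] i(1)[OF c(1)] i(2)[OF c(2)]])
    moreover have "smooth_on (snd D ` (fst D \<inter> fst C)) (snd C \<circ> chart_inv D)"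
      unfolding c(3) c'(3)
      by (rule smooth_on_prod_transition[OF *[OF c'(1) c(1)] **[OF c'(2) c(2)] i(1)[OF c'(1)] i(2)[OF c'(2)]])
    ultimately show ?thesis by (simp add: compatible_def Int_commute)
  qed
  show ?thesis
    unfolding smooth_manifold_def prod_mfd_simps topspace_prod_topology
    using H S V C P K by blast
qed

lemma smooth_map_fst:
  assumes M: "smooth_manifold M" and N: "smooth_manifold N"
  shows "smooth_map (prod_mfd M N) M fst"
proof (rule smooth_mapI[OF smooth_manifold_prod_mfd[OF M N] M])
  fix z assume z: "z \<in> points (prod_mfd M N)"
  note P = smooth_manifold_prod_mfd[OF M N]
  obtain C where C: "C \<in> atlas (prod_mfd M N)" "admissible_chart (prod_mfd M N) C" "z \<in> fst C"
    using exists_chart[OF P z] .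
  obtain c d where c: "c \<in> atlas M" "d \<in> atlas N" "C = prod_chart c d" using C(1) by (auto simp: atlas_prod_mfd)
  have "smooth_near (prod_mfd M N) (\<lambda>z. fst (snd C z)) z"
    by (rule smooth_near_compose[OF smooth_near_chart[OF P C(2,3)] smooth_on_bounded_linear[OF bounded_linear_fst]])
      (rule UNIV_I)
  moreover have "(\<lambda>z. fst (snd C z)) = snd c \<circ> fst" by (auto simp: c)
  ultimately show "\<exists>d. admissible_chart M d \<and> fst z \<in> fst d \<and> smooth_near (prod_mfd M N) (snd d \<circ> fst) z"
    using atlas_admissible[OF M c(1)] C(3) c(3) by (intro exI[of _ c]) auto
qed (simp add: continuous_map_fst)

lemma smooth_map_snd:
  assumes M: "smooth_manifold M" and N: "smooth_manifold N"
  shows "smooth_map (prod_mfd M N) N snd"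
proof (rule smooth_mapI[OF smooth_manifold_prod_mfd[OF M N] N])
  fix z assume z: "z \<in> points (prod_mfd M N)"
  note P = smooth_manifold_prod_mfd[OF M N]
  obtain C where C: "C \<in> atlas (prod_mfd M N)" "admissible_chart (prod_mfd M N) C" "z \<in> fst C"
    using exists_chart[OF P z] .
  obtain c d where c: "c \<in> atlas M" "d \<in> atlas N" "C = prod_chart c d" using C(1) by (auto simp: atlas_prod_mfd)
  have "smooth_near (prod_mfd M N) (\<lambda>z. snd (snd C z)) z"
    by (rule smooth_near_compose[OF smooth_near_chart[OF P C(2,3)] smooth_on_bounded_linear[OF bounded_linear_snd]])
      (rule UNIV_I)
  moreover have "(\<lambda>z. snd (snd C z)) = snd d \<circ> snd" by (auto simp: c)
  ultimately show "\<exists>d. admissible_chart N d \<and> snd z \<in> fst d \<and> smooth_near (prod_mfd M N) (snd d \<circ> snd) z"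
    using atlas_admissible[OF N c(2)] C(3) c(3) by (intro exI[of _ d]) auto
qed (simp add: continuous_map_snd)

lemma smooth_map_paired:
  assumes P: "smooth_manifold P" and M: "smooth_manifold M" and N: "smooth_manifold N"
    and F: "smooth_map P M F" and G: "smooth_map P N G"
  shows "smooth_map P (prod_mfd M N) (\<lambda>x. (F x, G x))"
proof (rule smooth_mapI[OF P smooth_manifold_prod_mfd[OF M N]])
  show "continuous_map (mtop P) (mtop (prod_mfd M N)) (\<lambda>x. (F x, G x))"
    using F G by (auto simp: smooth_map_def intro: continuous_map_pairedI)
  fix x assume x: "x \<in> points P"
  obtain c where c: "c \<in> atlas M" "admissible_chart M c" "F x \<in> fst c"
    using exists_chart[OF M smooth_map_points[OF F x]] .
  obtain d where d: "d \<in> atlas N" "admissible_chart N d" "G x \<in> fst d"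
    using exists_chart[OF N smooth_map_points[OF G x]] .
  have "prod_chart c d \<in> atlas (prod_mfd M N)" using c(1) d(1) by (auto simp: atlas_prod_mfd)
  then have "admissible_chart (prod_mfd M N) (prod_chart c d)"
    by (rule atlas_admissible[OF smooth_manifold_prod_mfd[OF M N]])
  moreover have "smooth_near P (\<lambda>x. ((snd c \<circ> F) x, (snd d \<circ> G) x)) x"
    by (intro smooth_near_Pair smooth_map_chart_near[OF P M F x c(2,3)] smooth_map_chart_near[OF P N G x d(2,3)])
  ultimately show "\<exists>d. admissible_chart (prod_mfd M N) d \<and> (F x, G x) \<in> fst d \<and>
      smooth_near P (snd d \<circ> (\<lambda>x. (F x, G x))) x"
    using c(3) d(3) by (intro exI[of _ "prod_chart c d"]) (simp add: o_def)
qed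

lemma smooth_map_const:
  assumes P: "smooth_manifold P" and M: "smooth_manifold M" and y: "y \<in> points M"
  shows "smooth_map P M (\<lambda>x. y)"
proof (rule smooth_mapI[OF P M])
  fix x assume x: "x \<in> points P"
  obtain d where d: "d \<in> atlas M" "admissible_chart M d" "y \<in> fst d" using exists_chart[OF M y] .
  obtain c where c: "c \<in> atlas P" "admissible_chart P c" "x \<in> fst c" using exists_chart[OF P x] .
  have "smooth_near P (\<lambda>z. snd d y) x"
    using smooth_near_compose[OF smooth_near_chart[OF P c(2,3)] smooth_on_const[of UNIV "snd d y"]] by simp
  then show "\<exists>d. admissible_chart M d \<and> y \<in> fst d \<and> smooth_near P (snd d \<circ> (\<lambda>x. y)) x"
    using d by (intro exI[of _ d]) (simp add: o_def)
qed (use y in simp)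

section \<open>Embedded submanifolds\<close>

lemma slice_model:
  assumes "k \<le> mdim M" "smooth_manifold M"
  shows "subspace (slice_model M k)" "slice_model M k \<subseteq> model M" "dim (slice_model M k) = k"
proof -
  obtain W where "subspace W" "W \<subseteq> span (model M)" "dim W = k"
    using choose_subspace_of_subspace[of k "model M"] assms(1) unfolding mdim_def by metis
  then have "\<exists>W. subspace W \<and> W \<subseteq> model M \<and> dim W = k"
    using span_eq_iff[of "model M"] subspace_model[OF assms(2)] by metis
  from someI_ex[OF this] show "subspace (slice_model M k)" "slice_model M k \<subseteq> model M" "dim (slice_model M k) = k"
    unfolding slice_model_def by blast+
qed

lemma submfd_simps [simp]:
  "mtop (submfd M k S) = subtopology (mtop M) S" "model (submfd M k S) = slice_model M k"
  by (simp_all add: submfd_def)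

lemma atlas_submfd: "c' \<in> atlas (submfd M k S) \<longleftrightarrow> (\<exists>c. slice_chart M k S c \<and> c' = (fst c \<inter> S, snd c))"
  by (auto simp: submfd_def)

lemma slice_chartD:
  assumes "slice_chart M k S c"
  shows "admissible_chart M c" "snd c ` (fst c \<inter> S) = snd c ` fst c \<inter> slice_model M k"
  using assms by (simp_all add: slice_chart_def)

lemma slice_chart_is_chart:
  assumes k: "k \<le> mdim M" and M: "smooth_manifold M" and c: "slice_chart M k S c" 
  shows "is_chart (subtopology (mtop M) S) (slice_model M k) (fst c \<inter> S, snd c)"
proof -
  note sc = slice_chartD[OF c]
  note ic = admissible_is_chart[OF sc(1)]
  have "openin (subtopology (mtop M) S) (fst c \<inter> S)"
    using is_chartD(1)[OF ic] by (auto simp: openin_subtopology)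
  moreover have "openin (top_of_set (slice_model M k)) (snd c ` (fst c \<inter> S))"
    using is_chartD(2)[OF ic] slice_model(2)[OF k M] unfolding sc(2) by (auto simp: openin_open)
  moreover have "homeomorphic_map (subtopology (subtopology (mtop M) (fst c)) S)
      (subtopology (top_of_set (snd c ` fst c)) (slice_model M k)) (snd c)"
  proof (rule homeomorphic_map_subtopologies)
    show "homeomorphic_map (subtopology (mtop M) (fst c)) (top_of_set (snd c ` fst c)) (snd c)"
      using ic by (simp add: is_chart_def)
    have "topspace (subtopology (mtop M) (fst c)) = fst c" using is_chartD(5)[OF ic] by auto
    then show "snd c ` (topspace (subtopology (mtop M) (fst c)) \<inter> S) =
        topspace (top_of_set (snd c ` fst c)) \<inter> slice_model M k"
      using sc(2) by simp
  qed
  then have "homeomorphic_map (subtopology (subtopology (mtop M) S) (fst c \<inter> S))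
      (top_of_set (snd c ` (fst c \<inter> S))) (snd c)"
    using sc(2) by (simp add: subtopology_subtopology Int_ac)
  ultimately show ?thesis by (simp add: is_chart_def)
qed

text \<open>Restricted charts inherit their transition maps from the charts of the ambient manifold.\<close>

lemma smooth_manifold_submfd:
  assumes M: "smooth_manifold M" and S: "embedded_submanifold M k S"
  shows "smooth_manifold (submfd M k S)"
proof -
  have k: "k \<le> mdim M" and SM: "S \<subseteq> points M"
    and ex: "\<And>x. x \<in> S \<Longrightarrow> \<exists>c. slice_chart M k S c \<and> x \<in> fst c"
    using S unfolding embedded_submanifold_def by blast+
  have "Hausdorff_space (subtopology (mtop M) S)"
    using M by (simp add: smooth_manifold_def Hausdorff_space_subtopology)
  moreover have "second_countable (subtopology (mtop M) S)"
    using M unfolding smooth_manifold_def second_countable_iff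
    by (simp add: Abstract_Topological_Spaces.second_countable_subtopology)
  moreover have "is_chart (subtopology (mtop M) S) (slice_model M k) c" if "c \<in> atlas (submfd M k S)" for c
    using that slice_chart_is_chart[OF k M] by (auto simp: atlas_submfd)
  moreover have "topspace (subtopology (mtop M) S) = (\<Union>c\<in>atlas (submfd M k S). fst c)"
  proof -
    have "S \<subseteq> (\<Union>c\<in>atlas (submfd M k S). fst c)"
    proof
      fix x assume x: "x \<in> S"
      then obtain c where "slice_chart M k S c" "x \<in> fst c" using ex by blast
      then have "(fst c \<inter> S, snd c) \<in> atlas (submfd M k S)" "x \<in> fst (fst c \<inter> S, snd c)"
        using x unfolding atlas_submfd by (blast, simp)
      then show "x \<in> (\<Union>c\<in>atlas (submfd M k S). fst c)" by blast
    qed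
    moreover have "(\<Union>c\<in>atlas (submfd M k S). fst c) \<subseteq> S" by (auto simp: atlas_submfd)
    ultimately show ?thesis using SM by auto
  qed
  moreover have "compatible c' d'" if cd: "c' \<in> atlas (submfd M k S)" "d' \<in> atlas (submfd M k S)" for c' d'
  proof -
    have *: "smooth_on (snd c ` ((fst c \<inter> S) \<inter> (fst d \<inter> S))) (snd d \<circ> inv_into (fst c \<inter> S) (snd c))"
      if c: "admissible_chart M c" and d: "admissible_chart M d" for c d
    proof (rule smooth_on_cong)
      show "smooth_on (snd c ` ((fst c \<inter> S) \<inter> (fst d \<inter> S))) (snd d \<circ> chart_inv c)"
        by (rule smooth_on_subset[OF admissible_compatible[OF M c d]]) auto
      have "inj_on (snd c) (fst c \<inter> S)"
        using is_chartD(3)[OF admissible_is_chart[OF c]] by (rule inj_on_subset) simp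
      then show "(snd d \<circ> inv_into (fst c \<inter> S) (snd c)) p = (snd d \<circ> chart_inv c) p"
        if "p \<in> snd c ` ((fst c \<inter> S) \<inter> (fst d \<inter> S))" for p
        using that by (auto simp: inv_into_f_f chart_inv_chart[OF c])
    qed
    obtain c where c: "slice_chart M k S c" "c' = (fst c \<inter> S, snd c)" using cd(1) unfolding atlas_submfd by blast
    obtain d where d: "slice_chart M k S d" "d' = (fst d \<inter> S, snd d)" using cd(2) unfolding atlas_submfd by blast
    show ?thesis
      using *[OF slice_chartD(1)[OF c(1)] slice_chartD(1)[OF d(1)]]
        *[OF slice_chartD(1)[OF d(1)] slice_chartD(1)[OF c(1)]]
      unfolding compatible_def c(2) d(2) fst_conv snd_conv by (simp add: Int_ac)
  qed
  ultimately show ?thesis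
    using slice_model(1)[OF k M] unfolding smooth_manifold_def submfd_simps by blast
qed

lemma submfd_slice_chart:
  assumes M: "smooth_manifold M" and S: "embedded_submanifold M k S" and c: "slice_chart M k S c"
  shows "(fst c \<inter> S, snd c) \<in> atlas (submfd M k S)" "admissible_chart (submfd M k S) (fst c \<inter> S, snd c)"
proof -
  show "(fst c \<inter> S, snd c) \<in> atlas (submfd M k S)" using c unfolding atlas_submfd by blast
  then show "admissible_chart (submfd M k S) (fst c \<inter> S, snd c)"
    by (rule atlas_admissible[OF smooth_manifold_submfd[OF M S]])
qed

lemma points_submfd: "embedded_submanifold M k S \<Longrightarrow> points (submfd M k S) = S"
  by (auto simp: embedded_submanifold_def)

text \<open>The coordinate map of a slice chart is the same function on the submanifold and on the ambient
  manifold. Therefore the inclusion is smooth, and so is a smooth map with values in the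
  submanifold when it is regarded as a map into it.\<close>

lemma smooth_map_inclusion:
  assumes M: "smooth_manifold M" and S: "embedded_submanifold M k S"
  shows "smooth_map (submfd M k S) M (\<lambda>x. x)"
proof (rule smooth_mapI[OF smooth_manifold_submfd[OF M S] M])
  show "continuous_map (mtop (submfd M k S)) (mtop M) (\<lambda>x. x)"
    by (simp add: continuous_map_from_subtopology)
  fix x assume "x \<in> points (submfd M k S)"
  then have x: "x \<in> S" by (simp add: points_submfd[OF S])
  then obtain c where c: "slice_chart M k S c" "x \<in> fst c"
    using S unfolding embedded_submanifold_def by blast
  have "smooth_near (submfd M k S) (snd (fst c \<inter> S, snd c)) x"
    by (rule smooth_near_chart[OF smooth_manifold_submfd[OF M S] submfd_slice_chart(2)[OF M S c(1)]])
      (use x c in simp)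
  then show "\<exists>d. admissible_chart M d \<and> x \<in> fst d \<and> smooth_near (submfd M k S) (snd d \<circ> (\<lambda>x. x)) x"
    using slice_chartD(1)[OF c(1)] c(2) by (intro exI[of _ c]) (simp add: o_def)
qed

lemma smooth_map_into_submfd:
  assumes P: "smooth_manifold P" and M: "smooth_manifold M" and S: "embedded_submanifold M k S"
    and F: "smooth_map P M F" and FS: "\<And>x. x \<in> points P \<Longrightarrow> F x \<in> S"
  shows "smooth_map P (submfd M k S) F"
proof (rule smooth_mapI[OF P smooth_manifold_submfd[OF M S]])
  show "continuous_map (mtop P) (mtop (submfd M k S)) F"
    using F FS by (auto simp: smooth_map_def continuous_map_in_subtopology)
  fix x assume x: "x \<in> points P"
  obtain c where c: "slice_chart M k S c" "F x \<in> fst c"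
    using S FS[OF x] unfolding embedded_submanifold_def by blast
  have "smooth_near P (snd c \<circ> F) x"
    by (rule smooth_map_chart_near[OF P M F x slice_chartD(1)[OF c(1)] c(2)])
  then show "\<exists>d. admissible_chart (submfd M k S) d \<and> F x \<in> fst d \<and> smooth_near P (snd d \<circ> F) x"
    using submfd_slice_chart(2)[OF M S c(1)] c(2) FS[OF x] by (intro exI[of _ "(fst c \<inter> S, snd c)"]) simp
qed

section \<open>Velocities\<close>

lemma pos_reals_chart:
  shows "({0<..}, \<lambda>x. x) \<in> atlas pos_reals" "admissible_chart pos_reals ({0<..}, \<lambda>x. x)"
  using atlas_admissible[OF smooth_manifold_pos_reals, of "({0<..}, \<lambda>x. x)"] by simp_all

text \<open>The generator of an action is the velocity of a curve \<open>t \<mapsto> \<sigma> (exp t)\<close> with \<open>\<sigma>\<close> smooth on the positive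
  reals. As the exponential function has derivative \<open>1\<close> at \<open>0\<close>, this is the derivative of \<open>\<sigma>\<close> at \<open>1\<close>.\<close>

lemma
  fixes M :: "('a, 'e::euclidean_space) mfd"
  assumes M: "smooth_manifold M" and \<sigma>: "smooth_map pos_reals M \<sigma>"
  shows velocity0_exp_tangent: "velocity0 M (\<lambda>t. \<sigma> (exp t)) \<in> tangent_space M (\<sigma> 1)" (is ?th1)
    and velocity0_exp_tderiv: "smooth_near M h (\<sigma> 1) \<Longrightarrow>
      ((\<lambda>t. h (\<sigma> (exp t))) has_vector_derivative tderiv M h (\<sigma> 1) (velocity0 M (\<lambda>t. \<sigma> (exp t)))) (at 0)"
proof -
  have one: "(1::real) \<in> points pos_reals" by simp
  note pt = smooth_map_points[OF \<sigma> one]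
  obtain c where c: "c \<in> atlas M" "admissible_chart M c" "\<sigma> 1 \<in> fst c" using exists_chart[OF M pt] .
  note R = smooth_manifold_pos_reals
  have near: "smooth_near pos_reals (snd c \<circ> \<sigma>) 1"
    by (rule smooth_map_chart_near[OF R M \<sigma> one c(2,3)])
  obtain D where D: "((snd c \<circ> \<sigma> \<circ> chart_inv ({0<..}, \<lambda>x. x)) has_derivative D) (at 1)"
    using chart_deriv_has_derivative[OF pos_reals_chart(2) _ near] by auto
  have "((snd c \<circ> \<sigma>) has_derivative D) (at (exp 0))"
    using has_derivative_transform_within_open[OF D, of "{0<..}" "snd c \<circ> \<sigma>"]
    by (simp add: inv_into_f_f[of "\<lambda>x. x"])
  moreover have "(exp has_derivative (\<lambda>t::real. t)) (at 0)"
    using DERIV_exp[of "0::real"] unfolding has_field_derivative_def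
    by (rule has_derivative_eq_rhs) (simp add: fun_eq_iff)
  ultimately have "((\<lambda>t. (snd c \<circ> \<sigma>) (exp t)) has_derivative D) (at 0)"
    by (rule has_derivative_compose[rotated])
  moreover obtain v where "D = (\<lambda>t. t *\<^sub>R v)"
  proof
    show "D = (\<lambda>t. t *\<^sub>R D 1)"
    proof
      fix t
      show "D t = t *\<^sub>R D 1"
        using linear_scale[OF has_derivative_linear[OF D], of t 1] by simp
    qed
  qed
  ultimately have v: "((snd c \<circ> (\<lambda>t. \<sigma> (exp t))) has_vector_derivative v) (at 0)"
    by (simp add: has_vector_derivative_def o_def)
  have contm: "continuous_map (top_of_set {0<..}) (mtop M) \<sigma>" using \<sigma> by (simp add: smooth_map_def)
  have "openin (top_of_set {0<..}) {s \<in> {0<..}. \<sigma> s \<in> fst c}"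
    using openin_continuous_map_preimage[OF contm is_chartD(1)[OF admissible_is_chart[OF c(2)]]] by simp
  then have "open {s \<in> {0<..}. \<sigma> s \<in> fst c}"
    by (rule openin_open_trans) simp
  then have J: "open (exp -` {s \<in> {0<..}. \<sigma> s \<in> fst c})"
    by (rule open_vimage) (intro continuous_intros)
  have J0: "0 \<in> exp -` {s \<in> {0<..}. \<sigma> s \<in> fst c}" using c(3) by simp
  have c0: "\<sigma> (exp 0) \<in> fst c" using c(3) by simp
  note v0 = velocity0_tangent[where \<gamma> = "\<lambda>t. \<sigma> (exp t)", OF M c(2) c0 J J0 _ v]
    tderiv_velocity0[where \<gamma> = "\<lambda>t. \<sigma> (exp t)", OF M c(2) c0 J J0 _ v]
  show ?th1 using v0(1) by simp
  show "((\<lambda>t. h (\<sigma> (exp t))) has_vector_derivative tderiv M h (\<sigma> 1) (velocity0 M (\<lambda>t. \<sigma> (exp t)))) (at 0)"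
    if "smooth_near M h (\<sigma> 1)"
    using v0(2)[of h] that by (simp add: o_def)
qed

lemma differential_velocity0_exp:
  fixes M :: "('a, 'e::euclidean_space) mfd" and N :: "('b, 'f::euclidean_space) mfd"
  assumes M: "smooth_manifold M" and N: "smooth_manifold N" and \<sigma>: "smooth_map pos_reals M \<sigma>"
    and F: "smooth_map M N F"
  shows "differential M N F (\<sigma> 1) (velocity0 M (\<lambda>t. \<sigma> (exp t))) = velocity0 N (\<lambda>t. F (\<sigma> (exp t)))"
proof
  fix d :: "('b, 'f) chart"
  have pt: "\<sigma> 1 \<in> points M" using smooth_map_points[OF \<sigma>, of 1] by simp
  show "differential M N F (\<sigma> 1) (velocity0 M (\<lambda>t. \<sigma> (exp t))) d = velocity0 N (\<lambda>t. F (\<sigma> (exp t))) d"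
  proof (cases "d \<in> charts_at N (F (\<sigma> 1))")
    case True
    have "((\<lambda>t. (snd d \<circ> F) (\<sigma> (exp t))) has_vector_derivative
        tderiv M (snd d \<circ> F) (\<sigma> 1) (velocity0 M (\<lambda>t. \<sigma> (exp t)))) (at 0)"
      by (rule velocity0_exp_tderiv[OF M \<sigma> smooth_map_chart_near[OF M N F pt charts_at_admissible[OF N True]]])
    then show ?thesis
      using True by (simp add: differential_eq_tderiv velocity0_def vector_derivative_at o_def)
  qed (simp add: differential_eq_tderiv velocity0_def)
qed

lemma tderiv_Pair:
  assumes M: "smooth_manifold M" and \<xi>: "\<xi> \<in> tangent_space M x" and x: "x \<in> points M"
    and h: "smooth_near M h x" and k: "smooth_near M k x"
  shows "tderiv M (\<lambda>y. (h y, k y)) x \<xi> = (tderiv M h x \<xi>, tderiv M k x \<xi>)"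
  unfolding tderiv_def
proof (rule chart_deriv_unique[OF M chart_at(2,3)[OF M x] tangent_spaceD(2)[OF \<xi> chart_at(1)[OF M x]]])
  note D = chart_deriv_has_derivative[OF chart_at(2,3)[OF M x]]
  show "((\<lambda>y. (h y, k y)) \<circ> chart_inv (chart_at M x) has_derivative
      (\<lambda>v. (chart_deriv M (chart_at M x) x h v, chart_deriv M (chart_at M x) x k v)))
      (at (snd (chart_at M x) x) within model M)"
    using has_derivative_Pair[OF D[OF h] D[OF k]] by (simp add: o_def)
qed

lemma tderiv_const:
  assumes M: "smooth_manifold M" and \<xi>: "\<xi> \<in> tangent_space M x" and x: "x \<in> points M"
    and h: "\<And>y. y \<in> points M \<Longrightarrow> h y = a"
  shows "tderiv M h x \<xi> = 0"
proof -
  have "tderiv M (\<lambda>y. a) x \<xi> = 0"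
    unfolding tderiv_def
    by (rule chart_deriv_unique[OF M chart_at(2,3)[OF M x] tangent_spaceD(2)[OF \<xi> chart_at(1)[OF M x]]])
      (simp add: o_def)
  then show ?thesis using tderiv_cong[OF M x, of h "\<lambda>y. a"] h by simp
qed

lemma differential_zero:
  assumes "smooth_manifold M" "smooth_manifold N" "smooth_map M N F" "x \<in> points M"
  shows "differential M N F x (\<lambda>c. 0) = (\<lambda>d. 0)"
  using differential_scale[OF assms, of 0 "\<lambda>c. 0"] by simp

lemma differential_inverse:
  assumes M: "smooth_manifold M" and N: "smooth_manifold N" and F: "smooth_map M N F" and G: "smooth_map N M G"
    and GF: "\<And>x. x \<in> points M \<Longrightarrow> G (F x) = x" and x: "x \<in> points M" and u: "u \<in> tangent_space M x"
  shows "differential N M G (F x) (differential M N F x u) = u"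
proof -
  have "differential M M (G \<circ> F) x u = differential M M (\<lambda>x. x) x u"
    by (rule differential_cong[OF M x]) (simp add: GF)
  then show ?thesis
    using differential_compose[OF M N M F G x u] differential_ident[OF M x u] by simp
qed

text \<open>Differentials of a diffeomorphism are bijective, with the differentials of the inverse map as
  inverses, so nondegeneracy is transported.\<close>

lemma diffeomorphism_pullback_metric:
  assumes M: "smooth_manifold M" and N: "smooth_manifold N" and F: "smooth_map M N F" and G: "smooth_map N M G"
    and GF: "\<And>x. x \<in> points M \<Longrightarrow> G (F x) = x" and FG: "\<And>y. y \<in> points N \<Longrightarrow> F (G y) = y"
    and g: "pseudo_riemannian_metric N g"
  shows "pseudo_riemannian_metric M (pullback M N F g)"
proof (rule pullback_metric[OF M N F g])
  fix x u assume x: "x \<in> points M" and u: "u \<in> tangent_space M x"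
    and 0: "\<And>w. w \<in> tangent_space M x \<Longrightarrow> pullback M N F g x u w = 0"
  note Fx = smooth_map_points[OF F x]
  have "differential M N F x u = (\<lambda>d. 0)"
  proof (rule metric_nondegenerate[OF g Fx differential_tangent[OF M N F x u]])
    fix z assume z: "z \<in> tangent_space N (F x)"
    have "differential N M G (F x) z \<in> tangent_space M x"
      using differential_tangent[OF N M G Fx z] GF[OF x] by simp
    from 0[OF this] show "g (F x) (differential M N F x u) z = 0"
      using differential_inverse[OF N M G F FG Fx z] GF[OF x] by (simp add: pullback_def)
  qed
  then show "u = (\<lambda>c. 0)"
    using differential_inverse[OF M N F G GF x u] differential_zero[OF N M G Fx] by simp
qed

section \<open>Regular level sets\<close>

text \<open>Following a chart by a diffeomorphism \<open>F\<close> of open sets that preserves the model space yields a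
  chart: transition maps are composed with \<open>F\<close> or with its inverse.\<close>

lemma admissible_chart_straighten:
  fixes M :: "('a, 'e::euclidean_space) mfd"
  assumes M: "smooth_manifold M" and c: "admissible_chart M c"
    and A: "openin (mtop M) A" "A \<subseteq> fst c" "snd c ` A \<subseteq> U"
    and U: "open U" "open W" "homeomorphism U W F G" "\<And>k. Ck_on k U F" "\<And>k. Ck_on k W G"
    and FV: "\<And>q. q \<in> U \<Longrightarrow> F q \<in> model M \<longleftrightarrow> q \<in> model M"
  shows "admissible_chart M (A, F \<circ> snd c)"
proof -
  let ?V = "model M"
  note ic = admissible_is_chart[OF c]
  have FU: "F q \<in> W" "G (F q) = q" if "q \<in> U" for q
    using U(3) that by (auto simp: homeomorphism_def)
  have GW: "G q \<in> U" "F (G q) = q" if "q \<in> W" for q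
    using U(3) that by (auto simp: homeomorphism_def)
  define S where "S = snd c ` A"
  have oS: "openin (top_of_set ?V) S" unfolding S_def by (rule is_chart_openin_image[OF ic A(1,2)])
  have SU: "S \<subseteq> U" using A(3) by (simp add: S_def)
  have SV: "S \<subseteq> ?V" using oS by (rule openin_imp_subset)
  obtain B where B: "open B" "S = ?V \<inter> B" using oS by (auto simp: openin_open)
  have FS: "F ` S = ?V \<inter> (W \<inter> G -` B)"
  proof
    show "F ` S \<subseteq> ?V \<inter> (W \<inter> G -` B)"
      using SU SV FU FV B(2) by auto
    show "?V \<inter> (W \<inter> G -` B) \<subseteq> F ` S"
    proof
      fix y assume y: "y \<in> ?V \<inter> (W \<inter> G -` B)"
      then have "G y \<in> U" "F (G y) = y" using GW by auto
      moreover then have "G y \<in> ?V" using FV[of "G y"] y by simp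
      ultimately have "G y \<in> S" using y B(2) by simp
      then show "y \<in> F ` S" using \<open>F (G y) = y\<close> by (metis imageI)
    qed
  qed
  have "continuous_on W G" using U(3) by (simp add: homeomorphism_def)
  then have "open (W \<inter> G -` B)" using U(2) B(1) by (rule continuous_open_preimage)
  then have oFS: "openin (top_of_set ?V) (F ` S)" unfolding FS by (rule openin_open_Int)
  have "homeomorphic_map (subtopology (subtopology (mtop M) (fst c)) A) (subtopology (top_of_set (snd c ` fst c)) S) (snd c)"
  proof (rule homeomorphic_map_subtopologies)
    show "homeomorphic_map (subtopology (mtop M) (fst c)) (top_of_set (snd c ` fst c)) (snd c)"
      using ic by (simp add: is_chart_def)
    show "snd c ` (topspace (subtopology (mtop M) (fst c)) \<inter> A) = topspace (top_of_set (snd c ` fst c)) \<inter> S"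
      using A(2) is_chartD(5)[OF ic] by (auto simp: S_def)
  qed
  moreover have "fst c \<inter> A = A" "snd c ` fst c \<inter> S = S" using A(2) by (auto simp: S_def)
  ultimately have 1: "homeomorphic_map (subtopology (mtop M) A) (top_of_set S) (snd c)"
    by (simp add: subtopology_subtopology)
  have "homeomorphism S (F ` S) F G"
    using FU(1) SU by (intro homeomorphism_of_subsets[OF U(3)]) auto
  then have "homeomorphic_maps (top_of_set S) (top_of_set (F ` S)) F G"
    by (auto simp: homeomorphic_maps_def homeomorphism_def)
  then have 2: "homeomorphic_map (top_of_set S) (top_of_set (F ` S)) F"
    using homeomorphic_map_maps by blast
  have im: "(F \<circ> snd c) ` A = F ` S" by (simp add: S_def image_comp)
  have "is_chart (mtop M) ?V (A, F \<circ> snd c)"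
    unfolding is_chart_def fst_conv snd_conv im
    using A(1) oFS homeomorphic_map_compose[OF 1 2] by blast
  moreover have "compatible (A, F \<circ> snd c) d" if d: "d \<in> atlas M" for d
  proof -
    note d' = atlas_admissible[OF M d]
    have inj: "inj_on (F \<circ> snd c) A"
      using is_chartD(3)[OF \<open>is_chart (mtop M) ?V (A, F \<circ> snd c)\<close>] by simp
    have yU: "snd c y \<in> U" "y \<in> fst c" if "y \<in> A" for y using that A by auto
    let ?T = "(F \<circ> snd c) ` (A \<inter> fst d)"
    have "smooth_on W G" by (rule smooth_onI_open[OF U(2) order_refl U(5)])
    then have "smooth_on ?T G" by (rule smooth_on_subset) (use yU FU in auto)
    moreover have "G ` ?T \<subseteq> snd c ` (fst c \<inter> fst d)" using yU FU by auto
    ultimately have "smooth_on ?T ((snd d \<circ> chart_inv c) \<circ> G)"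
      using admissible_compatible[OF M c d'] by (intro smooth_on_compose[of ?T G])
    then have 1: "smooth_on ?T (snd d \<circ> chart_inv (A, F \<circ> snd c))"
    proof (rule smooth_on_cong)
      fix p assume "p \<in> ?T"
      then obtain y where y: "y \<in> A" "p = (F \<circ> snd c) y" by auto
      then show "(snd d \<circ> chart_inv (A, F \<circ> snd c)) p = ((snd d \<circ> chart_inv c) \<circ> G) p"
        using inv_into_f_f[OF inj y(1)] yU[OF y(1)] by (simp add: FU chart_inv_chart[OF c])
    qed
    let ?T' = "snd d ` (A \<inter> fst d)"
    have "smooth_on (snd d ` (fst d \<inter> fst c)) (snd c \<circ> chart_inv d)"
      by (rule admissible_compatible[OF M d' c])
    then have "smooth_on ?T' (snd c \<circ> chart_inv d)"
      by (rule smooth_on_subset) (use A in auto)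
    moreover have "smooth_on U F" by (rule smooth_onI_open[OF U(1) order_refl U(4)])
    moreover have "(snd c \<circ> chart_inv d) ` ?T' \<subseteq> U"
      using yU by (auto simp: chart_inv_chart[OF d'])
    ultimately have 2: "smooth_on ?T' (F \<circ> (snd c \<circ> chart_inv d))"
      by (rule smooth_on_compose)
    show ?thesis using 1 2 by (simp add: compatible_def comp_assoc)
  qed
  ultimately show ?thesis by (simp add: admissible_chart_def)
qed

lemma hyperplane_normal:
  fixes V W :: "'e::euclidean_space set"
  assumes V: "subspace V" and W: "subspace W" "W \<subseteq> V" "dim V = Suc (dim W)"
  obtains e where "e \<in> V" "e \<bullet> e = 1" "W = {v \<in> V. v \<bullet> e = 0}"
proof -
  have "W \<noteq> V" using W(3) by auto
  have sp: "span W = W" "span V = V" using V W(1) by (simp_all only: span_eq_iff)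
  have "span W \<subset> span V" unfolding sp using W(2) \<open>W \<noteq> V\<close> by (rule psubsetI)
  then obtain e' where e': "e' \<noteq> 0" "e' \<in> span V" "\<And>y. y \<in> span W \<Longrightarrow> orthogonal e' y"
    using orthogonal_to_subspace_exists_gen by blast
  define e where "e = e' /\<^sub>R norm e'"
  have eV: "e \<in> V" unfolding e_def using e'(2) sp(2) by (intro subspace_scale[OF V]) simp
  have ee: "e \<bullet> e = 1" using e'(1) by (simp add: e_def dot_square_norm power2_eq_square)
  let ?H = "{v \<in> V. v \<bullet> e = 0}"
  have H: "subspace ?H"
    using V by (auto simp: subspace_def inner_add_left)
  have sub: "W \<subseteq> ?H"
    using W(2) e'(3)[OF span_base] by (auto simp: e_def orthogonal_def inner_commute)
  have "e \<notin> ?H" using ee by simp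
  then have "?H \<noteq> V" using eV by blast
  then have "\<not> dim V \<le> dim ?H"
    using subspace_dim_equal[OF H V] by blast
  then have "W = ?H" using subspace_dim_equal[OF W(1) H sub] W(3) by simp
  then show thesis using that eV ee by blast
qed

text \<open>Replacing the coordinate along a transversal direction by the value of the function turns a
  chart into a slice chart.\<close>

lemma regular_level_set_embedded:
  fixes M :: "('a, 'e::euclidean_space) mfd" and f :: "'a \<Rightarrow> real"
  assumes M: "smooth_manifold M"
    and f: "\<And>x. x \<in> points M \<Longrightarrow> smooth_near M f x"
    and reg: "\<And>x. x \<in> level_set M f l \<Longrightarrow> \<exists>u\<in>tangent_space M x. ext_d M f x u \<noteq> 0"
  shows "embedded_submanifold M (mdim M - 1) (level_set M f l)"
  unfolding embedded_submanifold_def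
proof (intro conjI ballI)
  show "mdim M - 1 \<le> mdim M" by simp
  show "level_set M f l \<subseteq> points M" by (auto simp: level_set_def)
  fix x assume xl: "x \<in> level_set M f l"
  then have x: "x \<in> points M" and fx: "f x = l" by (auto simp: level_set_def)
  let ?V = "model M" and ?W = "slice_model M (mdim M - 1)"
  note V = subspace_model[OF M]
  obtain u where u: "u \<in> tangent_space M x" "ext_d M f x u \<noteq> 0" using reg[OF xl] by blast
  obtain c where c: "c \<in> atlas M" "admissible_chart M c" "x \<in> fst c" using exists_chart[OF M x] .
  note ic = admissible_is_chart[OF c(2)]
  obtain A where A: "openin (mtop M) A" "x \<in> A" "A \<subseteq> fst c" "smooth_on (snd c ` A) (f \<circ> chart_inv c)"
    "openin (top_of_set ?V) (snd c ` A)"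
    using smooth_nearE[OF f[OF x] c(2,3)] .
  define p where "p = snd c x"
  have pA: "p \<in> snd c ` A" using A(2) by (simp add: p_def)
  obtain U \<Phi> where U: "open U" "p \<in> U" "\<And>k. Ck_on k U \<Phi>"
    "\<And>y. y \<in> U \<Longrightarrow> y \<in> snd c ` A \<Longrightarrow> \<Phi> y = (f \<circ> chart_inv c) y"
    by (rule smooth_onE[OF A(4) pA]) (rule that)
  define w where "w = tderiv M (snd c) x u"
  have wV: "w \<in> ?V" unfolding w_def by (rule tderiv_chart_model[OF M u(1) c(2,3)])
  define D where "D = frechet_derivative \<Phi> (at p)"
  have D: "(\<Phi> has_derivative D) (at p)"
    unfolding D_def using U(3) U(2) by (rule Ck_on_SucE)
  have linD: "linear D" using D by (rule has_derivative_linear)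
  have "openin (top_of_set ?V) (snd c ` A \<inter> U)" using A(5) U(1) by (rule openin_Int_open)
  then have "(f \<circ> chart_inv c has_derivative D) (at p within ?V)"
    using has_derivative_at_withinI[OF D] U(2,4) pA
    by (intro has_derivative_within_openin_cong[of ?V "snd c ` A \<inter> U" p \<Phi> "f \<circ> chart_inv c" D]) simp_all
  then have "chart_deriv M c x f w = D w"
    using chart_deriv_unique[OF M c(2,3) wV] by (simp add: p_def)
  then have Dw: "D w \<noteq> 0"
    using u(2) tderiv_in_chart[OF M u(1) c(2,3) f[OF x]] by (simp add: ext_d_eq_tderiv w_def)
  then have "w \<noteq> 0" using linear_0[OF linD] by auto
  then have "dim ?V \<noteq> 0" using wV by (auto simp only: dim_eq_0)
  then have dims: "dim ?V = Suc (mdim M - 1)" unfolding mdim_def by linarith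
  have W: "subspace ?W" "?W \<subseteq> ?V" "dim ?W = mdim M - 1"
    by (rule slice_model[OF _ M]; simp)+
  \<comment> \<open>In the new chart the coordinate along the normal \<open>e0\<close> of the slice model will be \<open>f - l\<close>. The direction
    \<open>e\<close> that gives way is transversal both to the level set and to the slice model.\<close>
  obtain e0 where e0: "e0 \<in> ?V" "e0 \<bullet> e0 = 1" "?W = {v \<in> ?V. v \<bullet> e0 = 0}"
    using hyperplane_normal[OF V W(1,2)] dims W(3) by metis
  obtain e where e: "e \<in> ?V" "e \<bullet> e0 = 1" "D e \<noteq> 0"
  proof (cases "D e0 = 0")
    case True
    \<comment> \<open>If \<open>e0\<close> itself is tangent to the level set, tilt it within the affine hyperplane \<open>q \<bullet> e0 = 1\<close>.\<close>
    let ?e = "e0 + (w - (w \<bullet> e0) *\<^sub>R e0)"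
    have "D ?e = D w" using True by (simp add: linear_add[OF linD] linear_diff[OF linD] linear_scale[OF linD])
    moreover have "?e \<bullet> e0 = 1" using e0(2) by (simp add: inner_add_left inner_diff_left)
    moreover have "?e \<in> ?V" using V e0(1) wV by (intro subspace_add subspace_diff subspace_scale)
    ultimately show thesis using that[of ?e] Dw by simp
  qed (use that[of e0] e0 in auto)
  define \<Psi> where "\<Psi> = (\<lambda>q. \<Phi> q + - l)"
  have \<Psi>: "Ck_on k U \<Psi>" for k unfolding \<Psi>_def by (intro Ck_on_add Ck_on_const U(1,3))
  have "(\<Psi> has_derivative D) (at p)" unfolding \<Psi>_def using D by (auto intro!: derivative_eq_intros)
  then have tr: "frechet_derivative \<Psi> (at p) e \<noteq> 0" using e(3) frechet_derivative_at by metis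
  define F where "F = (\<lambda>q. q - (q \<bullet> e0) *\<^sub>R e + \<Psi> q *\<^sub>R e0)"
  obtain U' X G where S: "open U'" "p \<in> U'" "U' \<subseteq> U" "open X" "homeomorphism U' X F G"
    "\<And>k. Ck_on k X G" "\<And>k. Ck_on k U' F"
    by (rule straightening_local_diffeo[OF U(1) \<Psi> U(2) e(2) e0(2) tr, folded F_def]) (rule that)
  have FV: "F q \<in> ?V \<longleftrightarrow> q \<in> ?V" for q
  proof -
    have k: "- (q \<bullet> e0) *\<^sub>R e + \<Psi> q *\<^sub>R e0 \<in> ?V" using V e(1) e0(1) by (intro subspace_add subspace_scale)
    have "F q = q + (- (q \<bullet> e0) *\<^sub>R e + \<Psi> q *\<^sub>R e0)" by (simp add: F_def)
    then show ?thesis using subspace_add[OF V _ k, of q] subspace_diff[OF V _ k, of "F q"] by auto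
  qed
  have Fe0: "F q \<bullet> e0 = \<Psi> q" for q by (simp add: F_def inner_add_left inner_diff_left e(2) e0(2))
  \<comment> \<open>On \<open>B\<close> the straightening is defined and the extension \<open>\<Phi>\<close> agrees with \<open>f\<close>.\<close>
  define B where "B = A \<inter> {y \<in> fst c. snd c y \<in> U' \<inter> ?V}"
  have oU': "openin (top_of_set ?V) (U' \<inter> ?V)" using S(1) by (auto simp: openin_open)
  have oB: "openin (mtop M) B" unfolding B_def
    by (intro openin_Int A(1) is_chart_openin_preimage[OF ic oU'])
  have BA: "B \<subseteq> fst c" "snd c ` B \<subseteq> U'" by (auto simp: B_def)
  have adm: "admissible_chart M (B, F \<circ> snd c)"
    by (rule admissible_chart_straighten[OF M c(2) oB BA S(1,4,5) S(7) S(6) FV])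
  have "F (snd c y) \<in> ?W \<longleftrightarrow> y \<in> level_set M f l" if y: "y \<in> B" for y
  proof -
    have yA: "y \<in> A" "y \<in> fst c" "snd c y \<in> U" "snd c y \<in> ?V" using y S(3) by (auto simp: B_def)
    have "\<Phi> (snd c y) = f y" using U(4)[of "snd c y"] yA by (simp add: chart_inv_chart[OF c(2)])
    moreover have "F (snd c y) \<in> ?W \<longleftrightarrow> \<Psi> (snd c y) = 0"
      unfolding e0(3) using FV yA(4) Fe0 by simp
    ultimately show ?thesis
      using admissible_points[OF c(2) yA(2)] by (auto simp: \<Psi>_def level_set_def)
  qed
  then have "(F \<circ> snd c) ` (B \<inter> level_set M f l) = (F \<circ> snd c) ` B \<inter> ?W" by auto
  then have "slice_chart M (mdim M - 1) (level_set M f l) (B, F \<circ> snd c)"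
    using adm by (simp add: slice_chart_def)
  moreover have "x \<in> B" using A(2) c(3) S(2) chart_image_model[OF c(2,3)] by (simp add: B_def p_def)
  ultimately show "\<exists>c. slice_chart M (mdim M - 1) (level_set M f l) c \<and> x \<in> fst c"
    by (intro exI[of _ "(B, F \<circ> snd c)"]) simp
qed

lemma inclusion_coordinates:
  assumes M: "smooth_manifold M" and S: "embedded_submanifold M k S" and c: "slice_chart M k S c"
    and x: "x \<in> fst c" "x \<in> S" and u: "u \<in> tangent_space (submfd M k S) x"
  shows "tderiv M (snd c) x (differential (submfd M k S) M (\<lambda>x. x) x u) = tderiv (submfd M k S) (snd c) x u"
proof -
  have xN: "x \<in> points (submfd M k S)" using points_submfd[OF S] x by simp
  show ?thesis
    using tderiv_differential[OF smooth_manifold_submfd[OF M S] M smooth_map_inclusion[OF M S] xN u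
        smooth_near_chart[OF M slice_chartD(1)[OF c] x(1)]]
    by (simp add: o_def)
qed

text \<open>The tangent spaces of a regular level set are the kernels of the differential of the function,
  by comparison of dimensions in a slice chart.\<close>

lemma level_set_tangent:
  fixes M :: "('a, 'e::euclidean_space) mfd" and f :: "'a \<Rightarrow> real" and l :: real
  defines "S \<equiv> level_set M f l"
  defines "N \<equiv> submfd M (mdim M - 1) S"
  assumes M: "smooth_manifold M" and S: "embedded_submanifold M (mdim M - 1) S"
    and f: "\<And>x. x \<in> points M \<Longrightarrow> smooth_near M f x"
    and x: "x \<in> S" and reg: "\<exists>u\<in>tangent_space M x. ext_d M f x u \<noteq> 0"
  shows "u \<in> tangent_space N x \<Longrightarrow> ext_d M f x (differential N M (\<lambda>x. x) x u) = 0" (is "_ \<Longrightarrow> ?th1 u")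
    and "y \<in> tangent_space M x \<Longrightarrow> ext_d M f x y = 0 \<Longrightarrow>
      \<exists>u\<in>tangent_space N x. differential N M (\<lambda>x. x) x u = y"
    and "u \<in> tangent_space N x \<Longrightarrow> differential N M (\<lambda>x. x) x u = (\<lambda>d. 0) \<Longrightarrow> u = (\<lambda>d. 0)"
proof -
  have N: "smooth_manifold N" unfolding N_def by (rule smooth_manifold_submfd[OF M S])
  have i: "smooth_map N M (\<lambda>x. x)" unfolding N_def by (rule smooth_map_inclusion[OF M S])
  have pN: "points N = S" unfolding N_def by (rule points_submfd[OF S])
  have xM: "x \<in> points M" and xN: "x \<in> points N" using x pN by (auto simp: S_def level_set_def)
  show 1: "?th1 u" if u: "u \<in> tangent_space N x" for u
  proof -
    have "tderiv N f x u = 0"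
      by (rule tderiv_const[OF N u xN, of _ l]) (simp add: pN S_def level_set_def)
    then show ?thesis
      using tderiv_differential[OF N M i xN u f[OF xM]] by (simp add: ext_d_eq_tderiv o_def)
  qed
  obtain c where c: "slice_chart M (mdim M - 1) S c" "x \<in> fst c"
    using S x unfolding embedded_submanifold_def by blast
  note adm = slice_chartD(1)[OF c(1)]
  let ?c' = "(fst c \<inter> S, snd c)"
  have c': "admissible_chart N ?c'" "x \<in> fst ?c'"
    unfolding N_def using submfd_slice_chart(2)[OF M S c(1)] c(2) x by simp_all
  have coord: "tderiv M (snd c) x (differential N M (\<lambda>x. x) x u) = tderiv N (snd ?c') x u"
    if "u \<in> tangent_space N x" for u
    using inclusion_coordinates[OF M S c x] that by (simp add: N_def)
  show "u = (\<lambda>d. 0)" if u: "u \<in> tangent_space N x" and 0: "differential N M (\<lambda>x. x) x u = (\<lambda>d. 0)"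
  proof (rule tangent_eqI[OF N c' u tangent_zero[OF N]])
    show "tderiv N (snd ?c') x u = tderiv N (snd ?c') x (\<lambda>d. 0)"
      using coord[OF u] coord[OF tangent_zero[OF N]] 0 differential_zero[OF N M i xN] by simp
  qed
  let ?V = "model M" and ?W = "slice_model M (mdim M - 1)"
  have W: "subspace ?W" "?W \<subseteq> ?V" "dim ?W = mdim M - 1"
    by (rule slice_model[OF _ M]; simp)+
  have mN: "model N = ?W" by (simp add: N_def)
  \<comment> \<open>In the slice chart, \<open>D\<close> vanishes on the slice model and not on the whole model, so its kernel is the
    slice model by dimension.\<close>
  define D where "D = chart_deriv M c x f"
  have linD: "linear D" unfolding D_def by (rule linear_chart_deriv[OF adm c(2) f[OF xM]])
  have DT: "ext_d M f x y = D (tderiv M (snd c) x y)" if "y \<in> tangent_space M x" for y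
    unfolding ext_d_eq_tderiv D_def by (rule tderiv_in_chart[OF M that adm c(2) f[OF xM]])
  have lift: "coord_tvec N ?c' x w \<in> tangent_space N x"
    "tderiv M (snd c) x (differential N M (\<lambda>x. x) x (coord_tvec N ?c' x w)) = w" if w: "w \<in> ?W" for w
  proof -
    have wN: "w \<in> model N" using w mN by simp
    show T: "coord_tvec N ?c' x w \<in> tangent_space N x" by (rule coord_tvec_tangent[OF N c' wN])
    show "tderiv M (snd c) x (differential N M (\<lambda>x. x) x (coord_tvec N ?c' x w)) = w"
      using coord[OF T] tderiv_coord_tvec[OF N c' wN smooth_near_chart[OF N c']]
        chart_deriv_self[OF N c' wN] by simp
  qed
  have DW: "D w = 0" if w: "w \<in> ?W" for w
    using 1[OF lift(1)[OF w]] DT[OF differential_tangent[OF N M i xN lift(1)[OF w]]] lift(2)[OF w] by simp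
  obtain u where u: "u \<in> tangent_space M x" "ext_d M f x u \<noteq> 0" using reg by blast
  let ?K = "{v \<in> ?V. D v = 0}"
  have K: "subspace ?K"
    using subspace_model[OF M] linear_0[OF linD] linear_add[OF linD] linear_scale[OF linD]
    by (simp add: subspace_def)
  have "tderiv M (snd c) x u \<in> ?V - ?K"
    using DT[OF u(1)] u(2) tderiv_chart_model[OF M u(1) adm c(2)] by simp
  then have "\<not> dim ?V \<le> dim ?K"
    using subspace_dim_equal[OF K subspace_model[OF M]] by blast
  then have "dim ?K \<le> mdim M - 1" unfolding mdim_def by linarith
  then have "dim ?K \<le> dim ?W" using W(3) by simp
  moreover have "?W \<subseteq> ?K" using W(2) DW by auto
  ultimately have KW: "?W = ?K" using subspace_dim_equal[OF W(1) K] by blast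
  show "\<exists>u\<in>tangent_space N x. differential N M (\<lambda>x. x) x u = y"
    if y: "y \<in> tangent_space M x" and 0: "ext_d M f x y = 0"
  proof -
    have w: "tderiv M (snd c) x y \<in> ?W"
      unfolding KW using DT[OF y] 0 tderiv_chart_model[OF M y adm c(2)] by simp
    show ?thesis
      by (intro bexI[OF _ lift(1)[OF w]] tangent_eqI[OF M adm c(2)] y lift(2)[OF w]
          differential_tangent[OF N M i xN lift(1)[OF w]])
  qed
qed

section \<open>Homogeneous pairs\<close>

locale homogeneous_pair_on_manifold =
  fixes M :: "('a, 'e::euclidean_space) mfd" and g :: "('a, 'e) tensor2"
    and m :: "real \<Rightarrow> 'a \<Rightarrow> 'a" and f :: "'a \<Rightarrow> real" and \<alpha> :: real
  assumes prM: "pseudo_riemannian_manifold M g" and action: "free_smooth_action M m"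
    and f_smooth: "smooth_map M pos_reals f" and degree_nonzero: "\<alpha> \<noteq> 0" and pair: "homogeneous_pair M m g f \<alpha>"
begin

lemma manifold_M: "smooth_manifold M" and metric_g: "pseudo_riemannian_metric M g"
  using prM by (simp_all add: pseudo_riemannian_manifold_def)

lemma action_smooth: "smooth_map (prod_mfd pos_reals M) M (\<lambda>(s, x). m s x)"
  and action_one: "x \<in> points M \<Longrightarrow> m 1 x = x"
  and action_mult: "s > 0 \<Longrightarrow> t > 0 \<Longrightarrow> x \<in> points M \<Longrightarrow> m (s * t) x = m s (m t x)"
  using action unfolding free_smooth_action_def by blast+

lemma action_metric: "s > 0 \<Longrightarrow> x \<in> points M \<Longrightarrow> u \<in> tangent_space M x \<Longrightarrow> w \<in> tangent_space M x \<Longrightarrow>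
    pullback M M (m s) g x u w = s powr \<alpha> * g x u w"
  and action_f: "s > 0 \<Longrightarrow> x \<in> points M \<Longrightarrow> f (m s x) = s powr \<alpha> * f x"
  and generator_gradient: "x \<in> points M \<Longrightarrow> u \<in> tangent_space M x \<Longrightarrow> g x (generator M m x) u = ext_d M f x u"
  using pair unfolding homogeneous_pair_def by blast+

lemma f_pos: "x \<in> points M \<Longrightarrow> f x > 0"
  using smooth_map_points[OF f_smooth, of x] by simp

lemma f_near: "x \<in> points M \<Longrightarrow> smooth_near M f x"
  by (rule smooth_near_real[OF manifold_M f_smooth])

lemma smooth_map_action:
  assumes P: "smooth_manifold P" and \<phi>: "smooth_map P pos_reals \<phi>" and F: "smooth_map P M F"
  shows "smooth_map P M (\<lambda>z. m (\<phi> z) (F z))"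
  using smooth_map_compose[OF P smooth_manifold_prod_mfd[OF smooth_manifold_pos_reals manifold_M] manifold_M
      smooth_map_paired[OF P smooth_manifold_pos_reals manifold_M \<phi> F] action_smooth]
  by (simp add: o_def)

lemma smooth_map_const_pos: "smooth_manifold P \<Longrightarrow> s > 0 \<Longrightarrow> smooth_map P pos_reals (\<lambda>z. s)"
  by (rule smooth_map_const[OF _ smooth_manifold_pos_reals]) simp_all

lemma smooth_map_orbit: "x \<in> points M \<Longrightarrow> smooth_map pos_reals M (\<lambda>s. m s x)"
  by (intro smooth_map_action smooth_manifold_pos_reals smooth_map_ident smooth_map_const manifold_M)

lemma smooth_map_scaling: "s > 0 \<Longrightarrow> smooth_map M M (m s)"
  using smooth_map_action[OF manifold_M smooth_map_const_pos[OF manifold_M] smooth_map_ident[OF manifold_M]] by simp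

lemma action_points: "s > 0 \<Longrightarrow> x \<in> points M \<Longrightarrow> m s x \<in> points M"
  by (rule smooth_map_points[OF smooth_map_scaling])

lemma generator_tangent:
  assumes "x \<in> points M"
  shows "generator M m x \<in> tangent_space M x"
  using velocity0_exp_tangent[OF manifold_M smooth_map_orbit[OF assms]] action_one[OF assms]
  by (simp add: generator_def)

text \<open>Euler's relation: along an orbit the function is \<open>e\<^sup>\<alpha>\<^sup>t f x\<close>.\<close>

lemma ext_d_generator:
  assumes x: "x \<in> points M"
  shows "ext_d M f x (generator M m x) = \<alpha> * f x"
proof -
  have "((\<lambda>t. f (m (exp t) x)) has_vector_derivative ext_d M f x (generator M m x)) (at 0)"
    using velocity0_exp_tderiv[OF manifold_M smooth_map_orbit[OF x], of f] f_near[OF x] action_one[OF x]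
    by (simp add: generator_def ext_d_eq_tderiv)
  moreover have "(\<lambda>t. f (m (exp t) x)) = (\<lambda>t. exp (\<alpha> * t) * f x)"
    using action_f[OF _ x] by (simp add: powr_def)
  moreover have "((\<lambda>t. exp (\<alpha> * t) * f x) has_vector_derivative \<alpha> * f x) (at 0)"
    unfolding has_real_derivative_iff_has_vector_derivative[symmetric]
    by (auto intro!: derivative_eq_intros)
  ultimately show ?thesis by (simp add: vector_derivative_unique_at)
qed

lemma f_regular:
  assumes x: "x \<in> points M"
  shows "\<exists>u\<in>tangent_space M x. ext_d M f x u \<noteq> 0"
  using generator_tangent[OF x] ext_d_generator[OF x] degree_nonzero f_pos[OF x] by force

lemma metric_generator:
  assumes x: "x \<in> points M"
  shows "g x (generator M m x) (generator M m x) = \<alpha> * f x"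
  using generator_gradient[OF x generator_tangent[OF x]] ext_d_generator[OF x] by simp

lemma level_embedded: "embedded_submanifold M (mdim M - 1) (level_set M f l)"
  using regular_level_set_embedded[OF manifold_M f_near] f_regular by (simp add: level_set_def)

lemma level_manifold: "smooth_manifold (level_mfd M f l)"
  unfolding level_mfd_def by (rule smooth_manifold_submfd[OF manifold_M level_embedded])

lemma points_level: "points (level_mfd M f l) = level_set M f l"
  unfolding level_mfd_def by (rule points_submfd[OF level_embedded])

lemma level_inclusion: "smooth_map (level_mfd M f l) M (\<lambda>x. x)"
  unfolding level_mfd_def by (rule smooth_map_inclusion[OF manifold_M level_embedded])

lemma
  assumes "x \<in> level_set M f l"
  shows level_ext_d: "u \<in> tangent_space (level_mfd M f l) x \<Longrightarrow>
      ext_d M f x (differential (level_mfd M f l) M (\<lambda>x. x) x u) = 0"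
    and level_kernel: "y \<in> tangent_space M x \<Longrightarrow> ext_d M f x y = 0 \<Longrightarrow>
      \<exists>u\<in>tangent_space (level_mfd M f l) x. differential (level_mfd M f l) M (\<lambda>x. x) x u = y"
    and level_immersion: "u \<in> tangent_space (level_mfd M f l) x \<Longrightarrow>
      differential (level_mfd M f l) M (\<lambda>x. x) x u = (\<lambda>d. 0) \<Longrightarrow> u = (\<lambda>d. 0)"
  using level_set_tangent[OF manifold_M level_embedded f_near assms] f_regular assms
  unfolding level_mfd_def by (simp_all add: level_set_def)

lemma ext_d_add: "x \<in> points M \<Longrightarrow> ext_d M f x (\<lambda>c. u c + w c) = ext_d M f x u + ext_d M f x w"
  unfolding ext_d_eq_tderiv by (rule tderiv_add[OF manifold_M _ f_near])

lemma ext_d_scale: "x \<in> points M \<Longrightarrow> ext_d M f x (\<lambda>c. a *\<^sub>R u c) = a * ext_d M f x u"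
  unfolding ext_d_eq_tderiv by (simp add: tderiv_scale[OF manifold_M _ f_near])

text \<open>As \<open>df\<close> does not vanish on the generator, subtracting a multiple of the generator makes any
  tangent vector a vector of \<open>ker df\<close>.\<close>

lemma generator_decomposition:
  assumes x: "x \<in> points M" and y: "y \<in> tangent_space M x"
  obtains a z where "z \<in> tangent_space M x" "ext_d M f x z = 0" "y = (\<lambda>c. a *\<^sub>R generator M m x c + z c)"
proof -
  define a where "a = ext_d M f x y / (\<alpha> * f x)"
  define z where "z = (\<lambda>c. y c + (- a) *\<^sub>R generator M m x c)"
  note P = generator_tangent[OF x]
  have "z \<in> tangent_space M x" unfolding z_def by (rule tangent_add[OF manifold_M y tangent_scale[OF manifold_M P]])
  moreover have "ext_d M f x z = 0"
    unfolding z_def ext_d_add[OF x] ext_d_scale[OF x] ext_d_generator[OF x] a_def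
    using degree_nonzero f_pos[OF x] by simp
  moreover have "y = (\<lambda>c. a *\<^sub>R generator M m x c + z c)" by (simp add: z_def)
  ultimately show thesis by (rule that)
qed

text \<open>A vector tangent to the level set is orthogonal to the generator, because \<open>g(P, -) = df\<close>. If it is
  also orthogonal to the level set, it is orthogonal to everything by the decomposition of
  tangent vectors, and nondegeneracy of \<open>g\<close> makes it zero.\<close>

lemma level_metric:
  "pseudo_riemannian_metric (level_mfd M f l) (level_metric M g f l)"
  unfolding level_metric_def
proof (rule pullback_metric[OF level_manifold manifold_M level_inclusion metric_g])
  let ?N = "level_mfd M f l"
  let ?i = "\<lambda>x u. differential ?N M (\<lambda>x. x) x u"
  fix x u
  assume "x \<in> points ?N" and u: "u \<in> tangent_space ?N x"
    and 0: "\<And>w. w \<in> tangent_space ?N x \<Longrightarrow> pullback ?N M (\<lambda>x. x) g x u w = 0"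
  then have x: "x \<in> level_set M f l" and xN: "x \<in> points ?N" and xM: "x \<in> points M"
    by (auto simp: points_level level_set_def)
  note P = generator_tangent[OF xM]
  have Tu: "?i x u \<in> tangent_space M x" by (rule differential_tangent[OF level_manifold manifold_M level_inclusion xN u])
  have "?i x u = (\<lambda>d. 0)"
  proof (rule metric_nondegenerate[OF metric_g xM Tu])
    fix y assume "y \<in> tangent_space M x"
    then obtain a z where z: "z \<in> tangent_space M x" "ext_d M f x z = 0"
      and y: "y = (\<lambda>c. a *\<^sub>R generator M m x c + z c)"
      using generator_decomposition[OF xM] by metis
    obtain w where w: "w \<in> tangent_space ?N x" "?i x w = z" using level_kernel[OF x z] by blast
    have "g x (?i x u) z = 0" using 0[OF w(1)] w(2) by (simp add: pullback_def)
    moreover have "g x (?i x u) (generator M m x) = 0"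
      using metric_sym[OF metric_g xM Tu P] generator_gradient[OF xM Tu] level_ext_d[OF x u] by simp
    ultimately show "g x (?i x u) y = 0"
      unfolding y metric_add_right[OF manifold_M metric_g xM tangent_scale[OF manifold_M P] z(1) Tu] metric_scale_right[OF manifold_M metric_g xM P Tu]
      by simp
  qed
  then show "u = (\<lambda>d. 0)" by (rule level_immersion[OF x u])
qed

section \<open>The parametrisation by level sets\<close>

abbreviation flow_time :: "real \<Rightarrow> real \<Rightarrow> real" where
  "flow_time l r \<equiv> (r / l) powr (1 / \<alpha>)"

abbreviation cylinder :: "real \<Rightarrow> (real \<times> 'a, real \<times> 'e) mfd" where
  "cylinder l \<equiv> prod_mfd pos_reals (level_mfd M f l)"

text \<open>The parametrisation of \<open>M\<close> by flowing out of a level set. Its inverse reads off \<open>r\<close> as the value of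
  \<open>f\<close> and then flows back to the level \<open>l\<close>.\<close>

definition flow_box :: "real \<Rightarrow> real \<times> 'a \<Rightarrow> 'a" where
  "flow_box l = (\<lambda>(r, y). m (flow_time l r) y)"

definition flow_box_inv :: "real \<Rightarrow> 'a \<Rightarrow> real \<times> 'a" where
  "flow_box_inv l x = (f x, m ((l / f x) powr (1 / \<alpha>)) x)"

lemma cylinder_manifold: "smooth_manifold (cylinder l)"
  by (rule smooth_manifold_prod_mfd[OF smooth_manifold_pos_reals level_manifold])

lemma points_cylinder:
  assumes "z \<in> points (cylinder l)"
  shows "fst z > 0" "snd z \<in> points (level_mfd M f l)" "snd z \<in> level_set M f l" "snd z \<in> points M" "f (snd z) = l"
proof -
  show "fst z > 0" and 2: "snd z \<in> points (level_mfd M f l)"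
    using assms by (simp_all add: mem_Times_iff)
  show 3: "snd z \<in> level_set M f l" using 2 unfolding points_level .
  then show "snd z \<in> points M" "f (snd z) = l" by (simp_all add: level_set_def)
qed

lemma powr_flow: "r > 0 \<Longrightarrow> (r powr (1 / \<alpha>)) powr \<alpha> = (r :: real)"
  using degree_nonzero by (simp add: powr_powr)

lemma smooth_map_flow_box:
  assumes l: "l > 0"
  shows "smooth_map (cylinder l) M (flow_box l)"
proof -
  have t: "smooth_on {0<..} (flow_time l)"
  proof (rule smooth_on_powr)
    have "bounded_linear (\<lambda>r. r / l)" by (rule bounded_linear_divide)
    then show "smooth_on {0<..} (\<lambda>r. r / l)" by (rule smooth_on_bounded_linear)
  qed (use l in simp)
  have "smooth_map (cylinder l) pos_reals (\<lambda>z. flow_time l (fst z))"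
    using t l by (intro smooth_map_real_compose[where \<phi> = "flow_time l"] cylinder_manifold
        smooth_map_fst smooth_manifold_pos_reals level_manifold) simp_all
  moreover have "smooth_map (cylinder l) M ((\<lambda>x. x) \<circ> snd)"
    by (rule smooth_map_compose[OF cylinder_manifold level_manifold manifold_M
          smooth_map_snd[OF smooth_manifold_pos_reals level_manifold] level_inclusion])
  ultimately have "smooth_map (cylinder l) M (\<lambda>z. m (flow_time l (fst z)) (((\<lambda>x. x) \<circ> snd) z))"
    by (rule smooth_map_action[OF cylinder_manifold])
  then show ?thesis by (simp add: flow_box_def case_prod_unfold)
qed

lemma smooth_map_flow_box_inv:
  assumes l: "l > 0"
  shows "smooth_map M (cylinder l) (flow_box_inv l)"
proof -
  have t: "smooth_on {0<..} (\<lambda>s. (l / s) powr (1 / \<alpha>))"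
  proof (rule smooth_on_powr)
    show "smooth_on {0<..} (\<lambda>s. l / s)"
      by (rule smooth_on_cong[OF smooth_on_mult[OF smooth_on_const[of _ l]
              smooth_on_powr[OF smooth_on_ident, of _ "- 1"]]]) (auto simp: powr_minus divide_inverse)
  qed (use l in simp)
  have "smooth_map M pos_reals (\<lambda>x. (l / f x) powr (1 / \<alpha>))"
    using t l by (intro smooth_map_real_compose[where \<phi> = "\<lambda>s. (l / s) powr (1 / \<alpha>)"] manifold_M f_smooth) simp_all
  from smooth_map_action[OF manifold_M this smooth_map_ident[OF manifold_M]]
  have "smooth_map M M (\<lambda>x. m ((l / f x) powr (1 / \<alpha>)) x)" .
  then have "smooth_map M (level_mfd M f l) (\<lambda>x. m ((l / f x) powr (1 / \<alpha>)) x)"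
    unfolding level_mfd_def
  proof (rule smooth_map_into_submfd[OF manifold_M manifold_M level_embedded])
    fix x assume x: "x \<in> points M"
    have "f (m ((l / f x) powr (1 / \<alpha>)) x) = l"
      using f_pos[OF x] l by (simp add: action_f x powr_flow)
    then show "m ((l / f x) powr (1 / \<alpha>)) x \<in> level_set M f l"
      using f_pos[OF x] l by (simp add: level_set_def action_points x)
  qed
  from smooth_map_paired[OF manifold_M smooth_manifold_pos_reals level_manifold f_smooth this]
  show ?thesis by (simp add: flow_box_inv_def[abs_def])
qed

lemma f_flow_box:
  assumes l: "l > 0" and z: "z \<in> points (cylinder l)"
  shows "f (flow_box l z) = fst z"
  using points_cylinder[OF z] l by (simp add: flow_box_def case_prod_unfold action_f powr_flow)

lemma flow_box_right_inverse:
  assumes l: "l > 0" and x: "x \<in> points M"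
  shows "flow_box l (flow_box_inv l x) = x"
proof -
  have "(f x / l) powr (1 / \<alpha>) * (l / f x) powr (1 / \<alpha>) = 1"
    using l f_pos[OF x] by (simp flip: powr_mult)
  then show ?thesis
    using action_mult[of "(f x / l) powr (1 / \<alpha>)" "(l / f x) powr (1 / \<alpha>)" x] l f_pos[OF x] x action_one[OF x]
    by (simp add: flow_box_def flow_box_inv_def)
qed

lemma flow_box_left_inverse:
  assumes l: "l > 0" and z: "z \<in> points (cylinder l)"
  shows "flow_box_inv l (flow_box l z) = z"
proof -
  note z' = points_cylinder(1,4,5)[OF z]
  have "(l / fst z) powr (1 / \<alpha>) * (fst z / l) powr (1 / \<alpha>) = 1"
    using l z' by (simp flip: powr_mult)
  then have "m ((l / fst z) powr (1 / \<alpha>)) (m ((fst z / l) powr (1 / \<alpha>)) (snd z)) = snd z"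
    using action_mult[of "(l / fst z) powr (1 / \<alpha>)" "(fst z / l) powr (1 / \<alpha>)" "snd z"] l z' action_one
    by simp
  then show ?thesis
    using f_flow_box[OF l z] by (simp add: flow_box_inv_def) (simp add: flow_box_def case_prod_unfold)
qed

lemma diffeomorphism_flow_box:
  assumes l: "l > 0"
  shows "diffeomorphism (cylinder l) M (flow_box l)"
proof -
  have bij: "bij_betw (flow_box l) (points (cylinder l)) (points M)"
    using smooth_map_points[OF smooth_map_flow_box[OF l]] smooth_map_points[OF smooth_map_flow_box_inv[OF l]]
    by (intro bij_betw_byWitness[where f' = "flow_box_inv l"]) (auto simp only: flow_box_right_inverse[OF l] flow_box_left_inverse[OF l])
  have "inv_into (points (cylinder l)) (flow_box l) x = flow_box_inv l x" if "x \<in> points M" for x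
    using bij flow_box_right_inverse[OF l that] smooth_map_points[OF smooth_map_flow_box_inv[OF l] that]
    by (intro inv_into_f_eq) (auto simp only: bij_betw_def)
  then have "smooth_map M (cylinder l) (inv_into (points (cylinder l)) (flow_box l))"
    by (intro smooth_map_cong[OF manifold_M cylinder_manifold smooth_map_flow_box_inv[OF l]]) simp
  then show ?thesis using bij smooth_map_flow_box[OF l] unfolding diffeomorphism_def by blast
qed

text \<open>A tangent vector of the cylinder splits into a multiple of the velocity of the curve
  \<open>t \<mapsto> (r exp(\<alpha> t), y)\<close>, which is mapped to an orbit of the action, and a vector tangent to the
  slice \<open>{r} \<times> M\<^sub>l\<close>, on which the map is a scaling.\<close>

lemma differential_flow_box:
  assumes l: "l > 0" and z: "z \<in> points (cylinder l)" and u: "u \<in> tangent_space (cylinder l) z"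
  shows "differential (cylinder l) M (flow_box l) z u = (\<lambda>c.
    (ext_d (cylinder l) fst z u / (\<alpha> * fst z)) *\<^sub>R generator M m (flow_box l z) c +
    differential M M (m (flow_time l (fst z))) (snd z) (differential (level_mfd M f l) M (\<lambda>x. x) (snd z)
      (differential (cylinder l) (level_mfd M f l) snd z u)) c)"
proof -
  let ?C = "cylinder l" and ?N = "level_mfd M f l"
  obtain r y where ry: "z = (r, y)" by (cases z)
  have r: "r > 0" and yN: "y \<in> points ?N" and yM: "y \<in> points M"
    using points_cylinder[OF z] by (simp_all add: ry)
  note C = cylinder_manifold[of l] and N = level_manifold[of l] and R = smooth_manifold_pos_reals
  note fst_smooth = smooth_map_fst[OF R N] and snd_smooth = smooth_map_snd[OF R N]
  define a where "a = ext_d ?C fst z u"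
  \<comment> \<open>The exponent makes \<open>\<sigma> (exp t)\<close> a curve that is mapped to an orbit with its standard
    parametrisation.\<close>
  define \<sigma> where "\<sigma> = (\<lambda>s. (r * s powr \<alpha>, y))"
  have "smooth_on {0<..} (\<lambda>s. r * s powr \<alpha>)"
    by (intro smooth_on_mult smooth_on_const smooth_on_powr smooth_on_ident) simp
  then have "smooth_map pos_reals pos_reals (\<lambda>s. r * s powr \<alpha>)"
    by (rule smooth_map_real_compose[OF R smooth_map_ident[OF R]]) (use r in simp)
  then have \<sigma>: "smooth_map pos_reals ?C \<sigma>"
    unfolding \<sigma>_def by (intro smooth_map_paired R N smooth_map_const[OF R N yN])
  have \<sigma>1: "\<sigma> 1 = z" by (simp add: \<sigma>_def ry)
  define vel where "vel = velocity0 ?C (\<lambda>t. \<sigma> (exp t))"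
  have velT: "vel \<in> tangent_space ?C z"
    using velocity0_exp_tangent[OF C \<sigma>] by (simp add: vel_def \<sigma>1)
  have vel: "((\<lambda>t. h (\<sigma> (exp t))) has_vector_derivative tderiv ?C h z vel) (at 0)" if "smooth_near ?C h z" for h
    using velocity0_exp_tderiv[OF C \<sigma>, of h] that by (simp add: vel_def \<sigma>1)
  define \<iota> where "\<iota> = (\<lambda>x. (r, x) :: real \<times> 'a)"
  have \<iota>: "smooth_map ?N ?C \<iota>"
    unfolding \<iota>_def by (intro smooth_map_paired R N smooth_map_ident smooth_map_const_pos r)
  have \<iota>y: "\<iota> y = z" by (simp add: \<iota>_def ry)
  define w where "w = differential ?C ?N snd z u"
  have w: "w \<in> tangent_space ?N y"
    using differential_tangent[OF C N snd_smooth z u] by (simp add: w_def ry)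
  have dwT: "differential ?N ?C \<iota> y w \<in> tangent_space ?C z"
    using differential_tangent[OF N C \<iota> yN w] by (simp add: \<iota>y)
  define b where "b = a / (\<alpha> * r)"
  obtain c where c: "c \<in> atlas ?N" "admissible_chart ?N c" "y \<in> fst c" using exists_chart[OF N yN] .
  let ?c = "prod_chart ({0<..}, \<lambda>x. x) c"
  have "({0<..}, \<lambda>x. x) \<in> atlas pos_reals" by simp
  then have "?c \<in> atlas ?C" using c(1) unfolding atlas_prod_mfd by blast
  then have adm: "admissible_chart ?C ?c" by (rule atlas_admissible[OF C])
  have zc: "z \<in> fst ?c" using r c(3) by (simp add: ry)
  have near1: "smooth_near ?C fst z" by (rule smooth_near_real[OF C fst_smooth z])
  have near2: "smooth_near ?C (snd c \<circ> snd) z"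
    by (rule smooth_map_chart_near[OF C N snd_smooth z c(2)]) (simp add: ry c(3))
  have c_eq: "snd ?c = (\<lambda>p. (fst p, (snd c \<circ> snd) p))" by auto
  have coord: "tderiv ?C (snd ?c) z \<eta> = (tderiv ?C fst z \<eta>, tderiv ?C (snd c \<circ> snd) z \<eta>)"
    if "\<eta> \<in> tangent_space ?C z" for \<eta>
    unfolding c_eq by (rule tderiv_Pair[OF C that z near1 near2])
  have vel1: "tderiv ?C fst z vel = \<alpha> * r"
  proof -
    have "((\<lambda>t. r * exp (\<alpha> * t)) has_vector_derivative tderiv ?C fst z vel) (at 0)"
      using vel[OF near1] by (simp add: \<sigma>_def powr_def)
    moreover have "((\<lambda>t. r * exp (\<alpha> * t)) has_vector_derivative \<alpha> * r) (at 0)"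
      unfolding has_real_derivative_iff_has_vector_derivative[symmetric]
      by (auto intro!: derivative_eq_intros)
    ultimately show ?thesis by (rule vector_derivative_unique_at)
  qed
  have vel2: "tderiv ?C (snd c \<circ> snd) z vel = 0"
  proof -
    have "((\<lambda>t::real. snd c y) has_vector_derivative tderiv ?C (snd c \<circ> snd) z vel) (at 0)"
      using vel[OF near2] by (simp add: \<sigma>_def)
    then show ?thesis
      using has_vector_derivative_const[of "snd c y" "at (0::real)"] by (rule vector_derivative_unique_at)
  qed
  have dw1: "tderiv ?C fst z (differential ?N ?C \<iota> y w) = 0"
  proof -
    have "tderiv ?N (fst \<circ> \<iota>) y w = 0"
      by (rule tderiv_const[OF N w yN]) (simp add: \<iota>_def)
    then show ?thesis
      using tderiv_differential[OF N C \<iota> yN w, of fst] near1 by (simp add: \<iota>y)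
  qed
  have dw2: "tderiv ?C (snd c \<circ> snd) z (differential ?N ?C \<iota> y w) = tderiv ?C (snd c \<circ> snd) z u"
  proof -
    have "tderiv ?C (snd c \<circ> snd) z (differential ?N ?C \<iota> y w) = tderiv ?N (snd c) y w"
    proof -
      have "(snd c \<circ> snd) \<circ> \<iota> = snd c" by (simp add: fun_eq_iff \<iota>_def)
      then show ?thesis
        using tderiv_differential[OF N C \<iota> yN w, of "snd c \<circ> snd"] near2 by (simp only: \<iota>y)
    qed
    also have "\<dots> = tderiv ?C (snd c \<circ> snd) z u"
      using tderiv_differential[OF C N snd_smooth z u, of "snd c"] smooth_near_chart[OF N c(2,3)]
      by (simp add: w_def ry)
    finally show ?thesis .
  qed
  have u_eq: "u = (\<lambda>d. b *\<^sub>R vel d + differential ?N ?C \<iota> y w d)"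
  proof (rule tangent_eqI[OF C adm zc u])
    note bT = tangent_scale[OF C velT, of b]
    show T: "(\<lambda>d. b *\<^sub>R vel d + differential ?N ?C \<iota> y w d) \<in> tangent_space ?C z"
      by (rule tangent_add[OF C bT dwT])
    have "tderiv ?C fst z u = b * (\<alpha> * r)"
      using degree_nonzero r by (simp add: b_def a_def ext_d_eq_tderiv)
    then show "tderiv ?C (snd ?c) z u = tderiv ?C (snd ?c) z (\<lambda>d. b *\<^sub>R vel d + differential ?N ?C \<iota> y w d)"
      unfolding coord[OF u] coord[OF T] tderiv_add[OF C z near1] tderiv_add[OF C z near2]
        tderiv_scale[OF C z near1] tderiv_scale[OF C z near2]
      by (simp add: vel1 vel2 dw1 dw2)
  qed
  note fb = smooth_map_flow_box[OF l]
  have "differential ?C M (flow_box l) z vel = generator M m (flow_box l z)"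
  proof -
    have "flow_box l (\<sigma> (exp t)) = m (exp t) (flow_box l z)" for t
    proof -
      have "(r * exp t powr \<alpha> / l) powr (1 / \<alpha>) = exp t * flow_time l r"
      proof -
        have "(r * exp t powr \<alpha> / l) powr (1 / \<alpha>) = (exp t powr \<alpha> * (r / l)) powr (1 / \<alpha>)" by (simp add: mult.commute)
        also have "\<dots> = (exp t powr \<alpha>) powr (1 / \<alpha>) * flow_time l r" by (rule powr_mult)
        also have "(exp t powr \<alpha>) powr (1 / \<alpha>) = exp t" using degree_nonzero by (simp add: powr_powr)
        finally show ?thesis .
      qed
      then show ?thesis using r l yM by (simp add: flow_box_def \<sigma>_def ry action_mult)
    qed
    then show ?thesis
      using differential_velocity0_exp[OF C manifold_M \<sigma> fb] by (simp add: vel_def \<sigma>1 generator_def)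
  qed
  moreover have "differential ?C M (flow_box l) z (differential ?N ?C \<iota> y w) =
      differential M M (m (flow_time l r)) y (differential ?N M (\<lambda>x. x) y w)"
  proof -
    have s: "flow_time l r > 0" using r l by simp
    have "differential ?C M (flow_box l) z (differential ?N ?C \<iota> y w) = differential ?N M (flow_box l \<circ> \<iota>) y w"
      using differential_compose[OF N C manifold_M \<iota> fb yN w] by (simp add: \<iota>y)
    also have "flow_box l \<circ> \<iota> = m (flow_time l r) \<circ> (\<lambda>x. x)" by (simp add: fun_eq_iff \<iota>_def flow_box_def)
    also have "differential ?N M \<dots> y w = differential M M (m (flow_time l r)) y (differential ?N M (\<lambda>x. x) y w)"
      by (rule differential_compose[OF N manifold_M manifold_M level_inclusion smooth_map_scaling[OF s] yN w])
    finally show ?thesis .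
  qed
  moreover have "differential ?C M (flow_box l) z u = (\<lambda>d. b *\<^sub>R differential ?C M (flow_box l) z vel d +
      differential ?C M (flow_box l) z (differential ?N ?C \<iota> y w) d)"
    by (subst u_eq) (simp add: differential_add[OF C manifold_M fb z] differential_scale[OF C manifold_M fb z])
  ultimately show ?thesis
    by (simp add: b_def a_def w_def ry)
qed

text \<open>The images of two vectors are \<open>a P + Y\<close> and \<open>b P + Z\<close> with \<open>Y\<close> and \<open>Z\<close> images under the differential of
  a scaling. Since \<open>f\<close> becomes the projection to \<open>r\<close>, and \<open>df(P) = \<alpha> r\<close>, the vectors \<open>Y\<close> and \<open>Z\<close> are in \<open>ker df\<close>, which is
  the orthogonal complement of \<open>P\<close>. So only \<open>g(P, P) = \<alpha> r\<close> and the homogeneity of \<open>g\<close> enter.\<close>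

lemma pullback_flow_box:
  assumes l: "l > 0" and z: "z \<in> points (cylinder l)"
    and u: "u \<in> tangent_space (cylinder l) z" and w: "w \<in> tangent_space (cylinder l) z"
  shows "pullback (cylinder l) M (flow_box l) (\<lambda>x u w. v (f x) * g x u w) z u w =
    warped_metric v \<alpha> l (level_mfd M f l) (level_metric M g f l) z u w"
proof -
  let ?C = "cylinder l" and ?N = "level_mfd M f l"
  obtain r y where ry: "z = (r, y)" by (cases z)
  have r: "r > 0" and yN: "y \<in> points ?N" and yM: "y \<in> points M"
    using points_cylinder[OF z] by (simp_all add: ry)
  note C = cylinder_manifold[of l] and N = level_manifold[of l] and R = smooth_manifold_pos_reals
  define s where "s = flow_time l r"
  have s: "s > 0" using r l by (simp add: s_def)
  have sa: "s powr \<alpha> = r / l" using r l by (simp add: s_def powr_flow)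
  define x where "x = flow_box l z"
  have x_eq: "x = m s y" by (simp add: x_def flow_box_def ry s_def)
  have x: "x \<in> points M" unfolding x_eq by (rule action_points[OF s yM])
  have fx: "f x = r" using f_flow_box[OF l z] by (simp add: x_def ry)
  define P where "P = generator M m x"
  have P: "P \<in> tangent_space M x" unfolding P_def by (rule generator_tangent[OF x])
  define a where "a u = ext_d ?C fst z u" for u
  define I where "I u = differential ?N M (\<lambda>x. x) y (differential ?C ?N snd z u)" for u
  define Y where "Y u = differential M M (m s) y (I u)" for u
  have d: "differential ?C M (flow_box l) z u = (\<lambda>c. (a u / (\<alpha> * r)) *\<^sub>R P c + Y u c)"
    if "u \<in> tangent_space ?C z" for u
    unfolding differential_flow_box[OF l z that] by (simp add: a_def P_def Y_def I_def x_def ry s_def)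
  have I: "I u \<in> tangent_space M y" if "u \<in> tangent_space ?C z" for u
    using differential_tangent[OF N manifold_M level_inclusion yN] differential_tangent[OF C N smooth_map_snd[OF R N] z that]
    by (simp add: I_def ry)
  have Y: "Y u \<in> tangent_space M x" if "u \<in> tangent_space ?C z" for u
    unfolding Y_def x_eq by (rule differential_tangent[OF manifold_M manifold_M smooth_map_scaling[OF s] yM I[OF that]])
  have YY: "g x (Y u) (Y w) = r / l * g y (I u) (I w)"
    using action_metric[OF s yM I[OF u] I[OF w]] by (simp add: pullback_def Y_def sa x_eq)
  have PP: "g x P P = \<alpha> * r" using metric_generator[OF x] by (simp add: P_def fx)
  \<comment> \<open>\<open>df\<close> takes the value \<open>a u\<close> both on the image of \<open>u\<close> and on its component along \<open>P\<close>.\<close>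
  have PY: "g x P (Y u) = 0" if u: "u \<in> tangent_space ?C z" for u
  proof -
    have "ext_d M f x (differential ?C M (flow_box l) z u) = a u"
    proof -
      have "tderiv ?C (f \<circ> flow_box l) z u = tderiv ?C fst z u"
        by (rule tderiv_cong[OF C z]) (simp add: f_flow_box[OF l])
      then show ?thesis
        using tderiv_differential[OF C manifold_M smooth_map_flow_box[OF l] z u, of f] f_near[OF x]
        by (simp add: x_def a_def ext_d_eq_tderiv)
    qed
    moreover have "ext_d M f x P = \<alpha> * r" using ext_d_generator[OF x] by (simp add: P_def fx)
    ultimately have "ext_d M f x (Y u) = 0"
      using degree_nonzero r unfolding d[OF u] ext_d_add[OF x] ext_d_scale[OF x] by simp
    then show ?thesis using generator_gradient[OF x Y[OF u]] by (simp add: P_def)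
  qed
  have YP: "g x (Y u) P = 0" if "u \<in> tangent_space ?C z" for u
    using PY[OF that] metric_sym[OF metric_g x Y[OF that] P] by simp
  have "g x (\<lambda>c. b *\<^sub>R P c + Y u c) (\<lambda>c. b' *\<^sub>R P c + Y w c) = b * b' * (\<alpha> * r) + r / l * g y (I u) (I w)" for b b'
  proof -
    note bP = tangent_scale[OF manifold_M P]
    have T: "(\<lambda>c. b' *\<^sub>R P c + Y w c) \<in> tangent_space M x" by (rule tangent_add[OF manifold_M bP Y[OF w]])
    show ?thesis
      unfolding metric_add_left[OF metric_g x bP Y[OF u] T] metric_scale_left[OF metric_g x P T]
        metric_add_right[OF manifold_M metric_g x bP Y[OF w] P] metric_add_right[OF manifold_M metric_g x bP Y[OF w] Y[OF u]]
        metric_scale_right[OF manifold_M metric_g x P P] metric_scale_right[OF manifold_M metric_g x P Y[OF u]]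
      by (simp add: PP YP[OF u] PY[OF w] YY)
  qed
  then have "g x (differential ?C M (flow_box l) z u) (differential ?C M (flow_box l) z w) =
      a u / (\<alpha> * r) * (a w / (\<alpha> * r)) * (\<alpha> * r) + r / l * g y (I u) (I w)"
    unfolding d[OF u] d[OF w] .
  also have "\<dots> = 1 / (\<alpha> * r) * (a u * a w) + r / l * g y (I u) (I w)"
    using degree_nonzero r by simp
  finally show ?thesis
    using fx by (simp add: pullback_def warped_metric_def level_metric_def ry x_def a_def I_def)
qed

text \<open>The warped product is a metric because it is the pullback of one along a diffeomorphism.\<close>

lemma isometry_flow_box:
  assumes l: "l > 0" and v: "smooth_map pos_reals pos_reals v"
  shows "isometry (cylinder l) (warped_metric v \<alpha> l (level_mfd M f l) (level_metric M g f l))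
    M (\<lambda>x u w. v (f x) * g x u w) (flow_box l)"
proof -
  let ?h = "\<lambda>x u w. v (f x) * g x u w"
  have "smooth_map M pos_reals (v \<circ> f)"
    by (rule smooth_map_compose[OF manifold_M smooth_manifold_pos_reals smooth_manifold_pos_reals f_smooth v])
  then have vf: "smooth_near M (\<lambda>x. v (f x)) x" if "x \<in> points M" for x
    using smooth_near_real[OF manifold_M _ that] by (simp add: o_def)
  have vpos: "v (f x) \<noteq> 0" if "x \<in> points M" for x
    using smooth_map_points[OF v, of "f x"] f_pos[OF that] by simp
  have h: "pseudo_riemannian_metric M ?h"
    by (rule conformal_metric[OF manifold_M metric_g vf vpos])
  have "pseudo_riemannian_metric (cylinder l) (pullback (cylinder l) M (flow_box l) ?h)"
    by (rule diffeomorphism_pullback_metric[OF cylinder_manifold manifold_M smooth_map_flow_box[OF l] smooth_map_flow_box_inv[OF l]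
          flow_box_left_inverse[OF l] flow_box_right_inverse[OF l] h])
  then have "pseudo_riemannian_metric (cylinder l) (warped_metric v \<alpha> l (level_mfd M f l) (level_metric M g f l))"
    by (rule metric_cong[OF cylinder_manifold]) (simp only: pullback_flow_box[OF l])
  then show ?thesis
    using h manifold_M cylinder_manifold diffeomorphism_flow_box[OF l] pullback_flow_box[OF l]
    unfolding isometry_def pseudo_riemannian_manifold_def by blast
qed

end

theorem theorem3p3:
  fixes M :: "('a, 'e::euclidean_space) mfd"
    and g :: "('a, 'e) tensor2"
    and m :: "real \<Rightarrow> 'a \<Rightarrow> 'a"
    and f :: "'a \<Rightarrow> real"
    and \<alpha> :: real
  assumes "pseudo_riemannian_manifold M g"
    and "free_smooth_action M m"
    and "smooth_map M pos_reals f"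
    and "\<alpha> \<noteq> 0"
    and "homogeneous_pair M m g f \<alpha>"
  shows "(\<forall>x\<in>points M. \<exists>u\<in>tangent_space M x. ext_d M f x u \<noteq> 0) \<and>
    (\<forall>l>0. embedded_submanifold M (mdim M - 1) (level_set M f l) \<and>
       pseudo_riemannian_manifold (level_mfd M f l) (level_metric M g f l)) \<and>
    (\<forall>l>0. \<forall>v. smooth_map pos_reals pos_reals v \<longrightarrow>
       isometry (prod_mfd pos_reals (level_mfd M f l))
         (warped_metric v \<alpha> l (level_mfd M f l) (level_metric M g f l))
         M (\<lambda>x u w. v (f x) * g x u w)
         (\<lambda>(r, y). m ((r / l) powr (1 / \<alpha>)) y))"
proof -
  interpret homogeneous_pair_on_manifold M g m f \<alpha>
    using assms by unfold_locales
  show ?thesis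
    using f_regular level_embedded level_manifold level_metric isometry_flow_box
    unfolding pseudo_riemannian_manifold_def flow_box_def by blast
qed

end
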